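(* Let $F=\langle a_1,\dots,a_r\rangle$ be a finitely generated free group and $N\triangleleft F$. Let $F\hookrightarrow\mathcal{A}$ and $F\hookrightarrow\mathcal{S}$ be the embeddings into the direct products of alternating, respectively symmetric, groups over all homomorphisms from $F$ to such groups. Then $F/N$ is sofic if and only if $N=\langle\langle N\rangle\rangle_{\mathcal{A}}\cap F$. Likewise, $F/N$ is sofic if and only if $N=\langle\langle N\rangle\rangle_{\mathcal{S}}\cap F$.
   Context: $S_m$ is the group of all permutations of $[m]=\{1,\dots,m\}$ and $A_m$ is the alternating subgroup of $S_m$. $\mathcal{A}=\prod_{m\ge1}\prod_{\phi\in\mathrm{Hom}(F,A_m)}A_m$ is the unrestricted direct product having one factor $A_m$ for each homomorphism $\phi:F\to A_m$; $F$ is regarded as a subgroup of $\mathcal{A}$ via the injective homomorphism $w\mapsto(\phi(w))_\phi$. $\mathcal{S}$ and $F\hookrightarrow\mathcal{S}$ are defined in the same way with the symmetric groups $S_m$ in place of $A_m$. $\langle\langle N\rangle\rangle_{G}$ denotes the smallest normal subgroup of $G$ containing $N$ (no topological closure is taken). The normalized Hamming length on $S_m$ is $\|h\|=|\{x\in[m] : xh\neq x\}|/m$. A group $G$ is sofic if there is a function $\alpha:G\to\mathbb{R}$ with $\alpha_1=0$ and $\alpha_g>0$ for $g\ne 1$ such that for every finite $\Phi\subset G$ and every $\epsilon>0$ there exist $m$ and a function $\phi:\Phi\to S_m$ with: $\phi(1)=1$ (when $1\in\Phi$); $\|\phi(g)\|\ge\alpha_g$ for all $g\in\Phi$; and $\|\phi(gh)(\phi(g)\phi(h))^{-1}\|<\epsilon$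 whenever $g,h,gh\in\Phi$. *)

theory Defs
  imports "HOL-Algebra.Algebra"
begin

section \<open>Free groups\<close>

text \<open>A word is a list of signed letters: \<open>(True, x)\<close> stands for \<open>x\<close> and
  \<open>(False, x)\<close> for its inverse.\<close>

fun eval_letter :: "('a, 'b) monoid_scheme \<Rightarrow> bool \<times> 'a \<Rightarrow> 'a" where
  "eval_letter G (s, x) = (if s then x else inv\<^bsub>G\<^esub> x)"

definition eval_word :: "('a, 'b) monoid_scheme \<Rightarrow> (bool \<times> 'a) list \<Rightarrow> 'a" where
  "eval_word G w = foldr (\<lambda>l g. eval_letter G l \<otimes>\<^bsub>G\<^esub> g) w \<one>\<^bsub>G\<^esub>"

definition reduced_word :: "(bool \<times> 'a) list \<Rightarrow> bool" where
  "reduced_word w \<longleftrightarrow>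
     successively (\<lambda>(s, x) (t, y). \<not> (x = y \<and> s \<noteq> t)) w"

definition free_basis :: "('a, 'b) monoid_scheme \<Rightarrow> 'a set \<Rightarrow> bool" where
  "free_basis G B \<longleftrightarrow>
     B \<subseteq> carrier G \<and> generate G B = carrier G \<and>
     (\<forall>w. snd ` set w \<subseteq> B \<and> reduced_word w \<and> w \<noteq> [] \<longrightarrow> eval_word G w \<noteq> \<one>\<^bsub>G\<^esub>)"


section \<open>Sofic groups\<close>

text \<open>Permutations are composed here as functions (\<open>f \<circ> g\<close> applies \<open>g\<close> first), whereas
  with right actions \<open>xh\<close> the product applies the left factor first. Inversion is an
  isomorphism between the two multiplications that preserves the Hamming length, so the
  choice is immaterial below.\<close>

definition hamming_length :: "nat \<Rightarrow> (nat \<Rightarrow> nat) \<Rightarrow> real" where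
  "hamming_length m h = real (card {x \<in> {1..m}. h x \<noteq> x}) / real m"

definition sofic :: "('a, 'b) monoid_scheme \<Rightarrow> bool" where
  "sofic G \<longleftrightarrow>
     (\<exists>\<alpha> :: 'a \<Rightarrow> real.
        \<alpha> \<one>\<^bsub>G\<^esub> = 0 \<and> (\<forall>g \<in> carrier G. g \<noteq> \<one>\<^bsub>G\<^esub> \<longrightarrow> \<alpha> g > 0) \<and>
        (\<forall>\<Phi> \<epsilon>. finite \<Phi> \<and> \<Phi> \<subseteq> carrier G \<and> \<epsilon> > 0 \<longrightarrow>
           (\<exists>m \<ge> 1. \<exists>\<phi> \<in> \<Phi> \<rightarrow> carrier (sym_group m).
              (\<one>\<^bsub>G\<^esub> \<in> \<Phi> \<longrightarrow> \<phi> \<one>\<^bsub>G\<^esub> = \<one>\<^bsub>sym_group m\<^esub>) \<and>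
              (\<forall>g \<in> \<Phi>. hamming_length m (\<phi> g) \<ge> \<alpha> g) \<and>
              (\<forall>g \<in> \<Phi>. \<forall>h \<in> \<Phi>. g \<otimes>\<^bsub>G\<^esub> h \<in> \<Phi> \<longrightarrow>
                 hamming_length m
                   (\<phi> (g \<otimes>\<^bsub>G\<^esub> h) \<otimes>\<^bsub>sym_group m\<^esub>
                    inv\<^bsub>sym_group m\<^esub> (\<phi> g \<otimes>\<^bsub>sym_group m\<^esub> \<phi> h)) < \<epsilon>))))"


section \<open>Products over all homomorphisms\<close>

definition normal_closure :: "('a, 'b) monoid_scheme \<Rightarrow> 'a set \<Rightarrow> 'a set" where
  "normal_closure G S = \<Inter> {K. K \<lhd> G \<and> S \<subseteq> K}"

text \<open>\<open>hom F H\<close> does not constrain the values of a homomorphism outside \<open>carrier F\<close>;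
  intersecting with \<open>extensional\<close> makes each homomorphism occur exactly once.\<close>

definition hom_index ::
  "('a, 'b) monoid_scheme \<Rightarrow> (nat \<Rightarrow> ('c, 'd) monoid_scheme) \<Rightarrow> (nat \<times> ('a \<Rightarrow> 'c)) set" where
  "hom_index F H = (SIGMA m : {1..}. hom F (H m) \<inter> extensional (carrier F))"

definition hom_product ::
  "('a, 'b) monoid_scheme \<Rightarrow> (nat \<Rightarrow> ('c, 'd) monoid_scheme) \<Rightarrow> (nat \<times> ('a \<Rightarrow> 'c) \<Rightarrow> 'c) monoid" where
  "hom_product F H = product_group (hom_index F H) (\<lambda>(m, \<phi>). H m)"

definition hom_embed ::
  "('a, 'b) monoid_scheme \<Rightarrow> (nat \<Rightarrow> ('c, 'd) monoid_scheme) \<Rightarrow> 'a \<Rightarrow> nat \<times> ('a \<Rightarrow> 'c) \<Rightarrow> 'c" where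
  "hom_embed F H w = (\<lambda>(m, \<phi>) \<in> hom_index F H. \<phi> w)"

end

theory Submission
  imports Defs
begin

text \<open>
  Write \<open>\<parallel>\<cdot>\<parallel>\<close> for the normalized Hamming length. It is subadditive and invariant under conjugation, so if
  \<open>w\<close> lies in the normal closure of \<open>N\<close> in the product, then there are finitely many \<open>n \<in> N\<close> with
  \<open>\<parallel>\<phi> w\<parallel> \<le> c \<cdot> \<Sum> \<parallel>\<phi> n\<parallel>\<close> for all \<open>\<phi>\<close> simultaneously; a sofic approximation of \<open>F/N\<close>, lifted to the free
  group \<open>F\<close>, violates this when \<open>w \<notin> N\<close>.

  Conversely, for \<open>m \<ge> 5\<close> every even \<open>g\<close> with \<open>\<parallel>g\<parallel> \<le> k \<cdot> \<parallel>h\<parallel>\<close> is a product of \<open>48 k + 8\<close> factors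
  \<open>(a h a\<^sup>-\<^sup>1) (b h\<^sup>-\<^sup>1 b\<^sup>-\<^sup>1)\<close> with \<open>a, b \<in> A\<^sub>m\<close>. Each factor can be made trivial by choosing \<open>a = b\<close>, so such
  products with prescribed support in the index set stay inside the normal closure. Hence, if \<open>w\<close> is not in
  the normal closure, then for each finite \<open>E \<subseteq> N\<close> some \<open>\<phi>\<close> makes all ratios \<open>\<parallel>\<phi> n\<parallel> / \<parallel>\<phi> w\<parallel>\<close> with \<open>n \<in> E\<close>
  tiny, and a tensor power of \<open>\<phi>\<close> amplifies \<open>\<parallel>\<phi> w\<parallel>\<close> to at least \<open>1/2\<close> while \<open>\<parallel>\<phi> n\<parallel>\<close> stays small.
  Homomorphisms to groups of degree at most 4, and signs, escape the covering statement; as \<open>F\<close> is finitely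
  generated, they only see a finite quotient of \<open>F\<close>, whose regular representation handles them.
\<close>

section \<open>Products of disjoint transpositions\<close>

text \<open>The product is unrestricted, so conjugators may be picked independently in every
  coordinate, but an element of a normal closure is a product of finitely many conjugates. Hence the
  number of factors has to depend on the ratio \<open>k\<close> alone, never on the degree
  \<open>m\<close>. The lists in \<open>swaps\<close> turn this into counting: up to conjugation by
  even permutations only the length of the list matters. The constants arise as follows. A set
  disjoint from its image under \<open>h\<close> can contain a third of the points moved by
  \<open>h\<close>; it yields \<open>swaps xs\<close> for up to \<open>t\<close> quadruples of
  points at a cost of 4 factors, where \<open>h\<close> moves at most \<open>21 * t\<close> points.
  Since \<open>g\<close> is a product of two involutions, each needs at most \<open>6 * k\<close>
  such lots, that is \<open>24 * k\<close> factors; if both are odd, 8 more factors repair the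
  parity. The link between soficity and either product is \<open>separates\<close>, stated with
  symmetric groups only: a permutation acting on two copies of its domain is even and keeps its
  length, so symmetric homomorphisms are visible in both products.\<close>

fun swaps :: "'a list \<Rightarrow> 'a \<Rightarrow> 'a" where
  "swaps (x # y # xs) = transpose x y \<circ> swaps xs"
| "swaps _ = id"

text \<open>Evenness keeps the pairing: otherwise the last entry of \<open>xs\<close> would be
  paired with the head of \<open>ys\<close>.\<close>

lemma swaps_append: "even (length xs) \<Longrightarrow> swaps (xs @ ys) = swaps xs \<circ> swaps ys"
  by (induction xs rule: swaps.induct) (auto simp: comp_assoc)

lemma swaps_permutes: "set xs \<subseteq> A \<Longrightarrow> swaps xs permutes A"
  by (induction xs rule: swaps.induct) (auto intro!: permutes_compose permutes_swap_id)

lemma swaps_fixes: "x \<notin> set xs \<Longrightarrow> swaps xs x = x"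
  using swaps_permutes[of xs "set xs"] permutes_not_in by fastforce

lemma permutation_swaps: "permutation (swaps xs)"
  using permutation_permutes swaps_permutes by blast

lemma evenperm_swaps: "distinct xs \<Longrightarrow> evenperm (swaps xs) \<longleftrightarrow> even (length xs div 2)"
  by (induction xs rule: swaps.induct)
     (auto simp: evenperm_comp permutation_swaps permutation_swap_id evenperm_swap)

lemma conj_swaps:
  assumes "bij p"
  shows "p \<circ> swaps xs \<circ> inv' p = swaps (map p xs)"
proof (induction xs rule: swaps.induct)
  case (1 x y xs)
  have "p \<circ> transpose x y = transpose (p x) (p y) \<circ> p"
    using assms by (auto simp: fun_eq_iff transpose_def bij_def inj_eq)
  then have "p \<circ> swaps (x # y # xs) \<circ> inv' p = transpose (p x) (p y) \<circ> (p \<circ> swaps xs \<circ> inv' p)"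
    by (simp add: fun_eq_iff)
  with 1 show ?case by (simp only: swaps.simps list.map)
qed (use assms in \<open>simp_all add: fun_eq_iff bij_is_surj surj_f_inv_f\<close>)

lemma swaps_commute:
  assumes "set xs \<inter> set ys = {}"
  shows "swaps xs \<circ> swaps ys = swaps ys \<circ> swaps xs"
proof
  fix z
  have *: "swaps xs z \<in> set xs \<longleftrightarrow> z \<in> set xs" "swaps ys z \<in> set ys \<longleftrightarrow> z \<in> set ys"
    by (rule permutes_in_image[OF swaps_permutes[OF subset_refl]])+
  show "(swaps xs \<circ> swaps ys) z = (swaps ys \<circ> swaps xs) z"
  proof (cases "z \<in> set xs")
    case True
    then have "z \<notin> set ys" "swaps xs z \<notin> set ys" using assms * by auto
    then show ?thesis by (simp add: swaps_fixes)
  next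
    case False
    then have "swaps ys z \<notin> set xs" using assms * by (cases "z \<in> set ys") (auto simp: swaps_fixes)
    then show ?thesis using False by (simp add: swaps_fixes)
  qed
qed

lemma swaps_involution: "distinct xs \<Longrightarrow> swaps xs \<circ> swaps xs = id"
proof (induction xs rule: swaps.induct)
  case (1 x y xs)
  have "transpose x y \<circ> swaps xs = swaps xs \<circ> transpose x y"
    using swaps_commute[of "[x, y]" xs] 1 by auto
  then have "swaps (x # y # xs) \<circ> swaps (x # y # xs) = transpose x y \<circ> transpose x y \<circ> (swaps xs \<circ> swaps xs)"
    by (simp add: fun_eq_iff)
  moreover have "swaps xs \<circ> swaps xs = id" using 1(2) by (intro 1(1)) simp
  ultimately show ?case by (simp only: transpose_comp_involutory comp_id)
qed auto

text \<open>The bijection between the two lists is completed by any bijection of their complements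
  in \<open>A\<close>, which have equal size.\<close>

lemma ex_permutes_map_eq:
  assumes "finite A" "set xs \<subseteq> A" "set ys \<subseteq> A" "distinct xs" "distinct ys" "length xs = length ys"
  shows "\<exists>p. p permutes A \<and> map p xs = ys"
proof -
  define f where "f = the \<circ> map_of (zip xs ys)"
  have fm: "map f xs = ys"
    using assms unfolding f_def
    by (auto intro!: nth_equalityI simp: map_of_zip_nth)
  have fb: "bij_betw f (set xs) (set ys)"
  proof -
    have "inj_on f (set xs)"
      using fm assms by (metis distinct_map)
    then show ?thesis using fm by (metis bij_betw_def image_set)
  qed
  have "card (A - set xs) = card (A - set ys)"
    using assms by (simp add: card_Diff_subset distinct_card)
  then obtain g where g: "bij_betw g (A - set xs) (A - set ys)"
    using assms(1) by (metis bij_betw_iff_card finite_Diff)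
  define p where "p x = (if x \<in> set xs then f x else if x \<in> A then g x else x)" for x
  have b1: "bij_betw p (set xs) (set ys)"
    using fb by (subst bij_betw_cong[of _ _ f]) (auto simp: p_def)
  have b2: "bij_betw p (A - set xs) (A - set ys)"
    using g by (subst bij_betw_cong[of _ _ g]) (auto simp: p_def)
  have "bij_betw p (set xs \<union> (A - set xs)) (set ys \<union> (A - set ys))"
    by (rule bij_betw_combine[OF b1 b2]) auto
  moreover have "set xs \<union> (A - set xs) = A" "set ys \<union> (A - set ys) = A" using assms by auto
  ultimately have "bij_betw p A A" by simp
  moreover have "p x = x" if "x \<notin> A" for x using that assms by (auto simp: p_def)
  ultimately have "p permutes A" by (rule bij_imp_permutes)
  moreover have "map p xs = map f xs" by (simp add: p_def)
  then have "map p xs = ys" using fm by simp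
  ultimately show ?thesis by blast
qed

text \<open>If a conjugating permutation is odd, composing it with the first transposition of
  \<open>swaps xs\<close> makes it even. This does not change the conjugate, since flipping the
  first two entries of \<open>xs\<close> leaves \<open>swaps xs\<close> unchanged.\<close>

lemma ex_evenperm_conj_swaps:
  assumes "finite A" "set xs \<subseteq> A" "set ys \<subseteq> A" "distinct xs" "distinct ys"
    "length xs = length ys" "length xs \<ge> 2"
  shows "\<exists>p. p permutes A \<and> evenperm p \<and> p \<circ> swaps xs \<circ> inv' p = swaps ys"
proof -
  obtain p where p: "p permutes A" "map p xs = ys"
    using ex_permutes_map_eq[OF assms(1-6)] by blast
  obtain x y zs where xs: "xs = x # y # zs"
    using assms(7) by (metis Suc_le_length_iff numeral_2_eq_2)
  define zs' where "zs' = y # x # zs"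
  let ?r = "p \<circ> transpose x y"
  have r: "?r permutes A"
    by (rule permutes_compose[OF permutes_swap_id p(1)]) (use assms xs in auto)
  have "map (transpose x y) zs' = xs"
    using assms(4) unfolding xs zs'_def by (auto intro!: map_idI transpose_apply_other)
  then have "map ?r zs' = ys" using p by (simp flip: map_map)
  moreover have "swaps zs' = swaps xs" unfolding xs zs'_def by (simp add: transpose_commute)
  moreover have "bij p" "bij ?r" using p r permutes_bij by blast+
  ultimately have "p \<circ> swaps xs \<circ> inv' p = swaps ys" "?r \<circ> swaps xs \<circ> inv' ?r = swaps ys"
    using conj_swaps[of p xs] conj_swaps[of ?r zs'] p by auto
  moreover have "evenperm p \<or> evenperm ?r"
    using evenperm_comp[OF permutes_imp_permutation[OF assms(1) p(1)] permutation_swap_id, of x y] assms(4) xs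
    by (auto simp: evenperm_swap)
  ultimately show ?thesis using p r by blast
qed

section \<open>Products of conjugates in alternating groups\<close>

definition moved :: "('a \<Rightarrow> 'a) \<Rightarrow> 'a set" where
  "moved p = {x. p x \<noteq> x}"

lemma moved_subset: "p permutes A \<Longrightarrow> moved p \<subseteq> A"
  by (auto simp: moved_def permutes_def)

text \<open>The conjugators are even although \<open>h\<close> may be odd, so that the same sets
  serve both the alternating and the symmetric product.\<close>

primrec conj_prods :: "nat \<Rightarrow> (nat \<Rightarrow> nat) \<Rightarrow> nat \<Rightarrow> (nat \<Rightarrow> nat) set" where
  "conj_prods m h 0 = {id}"
| "conj_prods m h (Suc n) =
     {p \<circ> (a \<circ> h \<circ> inv' a) \<circ> (b \<circ> inv' h \<circ> inv' b) | p a b.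
        p \<in> conj_prods m h n \<and> a \<in> carrier (alt_group m) \<and> b \<in> carrier (alt_group m)}"

lemma alt_compose:
  "a \<in> carrier (alt_group m) \<Longrightarrow> b \<in> carrier (alt_group m) \<Longrightarrow> a \<circ> b \<in> carrier (alt_group m)"
  using monoid.m_closed[OF group.is_monoid[OF alt_group_is_group]] by (simp add: alt_group_mult)

lemma alt_id: "id \<in> carrier (alt_group m)"
  by (simp add: alt_group_carrier permutes_id)

lemma bij_alt: "a \<in> carrier (alt_group m) \<Longrightarrow> bij a"
  by (auto simp: alt_group_carrier permutes_bij)

lemma conj_prods_permutes:
  assumes "h permutes {1..m}"
  shows "p \<in> conj_prods m h n \<Longrightarrow> p permutes {1..m}"
proof (induction n arbitrary: p)
  case (Suc n)
  then show ?case
    using assms by (auto simp: alt_group_carrier intro!: permutes_compose permutes_inv)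
qed (auto simp: permutes_id)

lemma conj_prods_one:
  assumes "a \<in> carrier (alt_group m)" "b \<in> carrier (alt_group m)"
  shows "(a \<circ> h \<circ> inv' a) \<circ> (b \<circ> inv' h \<circ> inv' b) \<in> conj_prods m h 1"
proof -
  have "id \<circ> (a \<circ> h \<circ> inv' a) \<circ> (b \<circ> inv' h \<circ> inv' b) \<in> conj_prods m h 1"
    unfolding One_nat_def conj_prods.simps using assms by blast
  then show ?thesis by (simp only: id_comp)
qed

lemma conj_prods_add:
  "p \<in> conj_prods m h i \<Longrightarrow> q \<in> conj_prods m h j \<Longrightarrow> p \<circ> q \<in> conj_prods m h (i + j)"
proof (induction j arbitrary: q)
  case 0
  then show ?case by simp
next
  case (Suc j)
  then obtain r a b where q: "q = r \<circ> (a \<circ> h \<circ> inv' a) \<circ> (b \<circ> inv' h \<circ> inv' b)"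
    and r: "r \<in> conj_prods m h j" and ab: "a \<in> carrier (alt_group m)" "b \<in> carrier (alt_group m)"
    by auto
  have "p \<circ> q = (p \<circ> r) \<circ> (a \<circ> h \<circ> inv' a) \<circ> (b \<circ> inv' h \<circ> inv' b)"
    by (simp only: q comp_assoc)
  moreover have "p \<circ> r \<in> conj_prods m h (i + j)" using Suc r by blast
  ultimately show ?case unfolding add_Suc_right conj_prods.simps using ab by blast
qed

lemma id_in_conj_prods:
  assumes "h permutes {1..m}"
  shows "id \<in> conj_prods m h n"
proof (induction n)
  case (Suc n)
  have "id = id \<circ> (id \<circ> h \<circ> inv' id) \<circ> (id \<circ> inv' h \<circ> inv' id)"
    using permutes_inv_o[OF assms] by (simp only: id_comp comp_id inv_id)
  then show ?case unfolding conj_prods.simps using Suc alt_id by blast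
qed (simp add: fun_eq_iff)

lemma conj_prods_mono:
  assumes "h permutes {1..m}" "i \<le> j"
  shows "conj_prods m h i \<subseteq> conj_prods m h j"
  using conj_prods_add[OF _ id_in_conj_prods[OF assms(1)], of _ i "j - i"] assms(2)
  by (force simp del: conj_prods.simps)

lemma conj_prods_conj:
  assumes c: "c \<in> carrier (alt_group m)"
  shows "p \<in> conj_prods m h n \<Longrightarrow> c \<circ> p \<circ> inv' c \<in> conj_prods m h n"
proof (induction n arbitrary: p)
  case 0
  then show ?case using bij_alt[OF c] by (simp add: fun_eq_iff bij_is_surj surj_f_inv_f)
next
  case (Suc n)
  then obtain r a b where p: "p = r \<circ> (a \<circ> h \<circ> inv' a) \<circ> (b \<circ> inv' h \<circ> inv' b)"
    and r: "r \<in> conj_prods m h n" and ab: "a \<in> carrier (alt_group m)" "b \<in> carrier (alt_group m)"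
    by auto
  have "c \<circ> p \<circ> inv' c = (c \<circ> r \<circ> inv' c) \<circ> ((c \<circ> a) \<circ> h \<circ> inv' (c \<circ> a)) \<circ> ((c \<circ> b) \<circ> inv' h \<circ> inv' (c \<circ> b))"
    using bij_alt[OF c] bij_alt[OF ab(1)] bij_alt[OF ab(2)]
    by (simp add: fun_eq_iff p o_inv_distrib inv_f_f bij_is_inj)
  then show ?case unfolding conj_prods.simps using Suc.IH[OF r] alt_compose[OF c] ab by blast
qed

text \<open>Inverting a single factor exchanges the roles of \<open>a\<close> and \<open>b\<close>
  and so preserves its shape.\<close>

lemma conj_prods_inv:
  assumes h: "h permutes {1..m}"
  shows "p \<in> conj_prods m h n \<Longrightarrow> inv' p \<in> conj_prods m h n"
proof (induction n arbitrary: p)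
  case 0
  then show ?case by (simp add: fun_eq_iff)
next
  case (Suc n)
  then obtain r a b where p: "p = r \<circ> (a \<circ> h \<circ> inv' a) \<circ> (b \<circ> inv' h \<circ> inv' b)"
    and r: "r \<in> conj_prods m h n" and ab: "a \<in> carrier (alt_group m)" "b \<in> carrier (alt_group m)"
    by auto
  have "bij r" "bij h" using conj_prods_permutes[OF h r] h permutes_bij by blast+
  then have "inv' p = ((b \<circ> h \<circ> inv' b) \<circ> (a \<circ> inv' h \<circ> inv' a)) \<circ> inv' r"
    using bij_alt[OF ab(1)] bij_alt[OF ab(2)]
    by (simp add: p o_inv_distrib bij_comp bij_imp_bij_inv inv_inv_eq comp_assoc)
  then show ?case
    using conj_prods_add[OF conj_prods_one[OF ab(2,1)] Suc.IH[OF r]] by (simp only: plus_1_eq_Suc)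
qed

lemma commutator_in_conj_prods:
  assumes "h permutes {1..m}" "p \<in> conj_prods m h n" "c \<in> carrier (alt_group m)"
  shows "p \<circ> c \<circ> inv' p \<circ> inv' c \<in> conj_prods m h (n + n)"
  using conj_prods_add[OF assms(2) conj_prods_conj[OF assms(3) conj_prods_inv[OF assms(1,2)]]]
  by (simp add: comp_assoc)

text \<open>Taking \<open>a = id\<close> and \<open>b = c\<close> spends one factor only, although
  \<open>h\<close> itself, when odd, lies in none of the sets
  \<open>conj_prods m h n\<close>.\<close>

lemma commutator_in_conj_prods_one:
  assumes "c \<in> carrier (alt_group m)"
  shows "h \<circ> c \<circ> inv' h \<circ> inv' c \<in> conj_prods m h 1"
  using conj_prods_one[OF alt_id assms, of h] by (simp add: comp_assoc)

text \<open>\<open>conj_prods\<close> is invariant under even conjugation, so membership depends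
  only on the length of the list; lists with fewer than two entries give \<open>id\<close>.\<close>

lemma swaps_in_conj_prods_transfer:
  assumes "swaps xs \<in> conj_prods m h n" "length xs = length ys" "distinct xs" "distinct ys"
    "set xs \<subseteq> {1..m}" "set ys \<subseteq> {1..m}"
  shows "swaps ys \<in> conj_prods m h n"
proof (cases "length xs \<ge> 2")
  case True
  then obtain p where "p permutes {1..m}" "evenperm p" "p \<circ> swaps xs \<circ> inv' p = swaps ys"
    using ex_evenperm_conj_swaps[of "{1..m}" xs ys] assms by auto
  then show ?thesis using conj_prods_conj[OF _ assms(1)] by (metis alt_group_carrier)
next
  case False
  then have "length xs = 0 \<or> length xs = 1" by linarith
  then have "swaps xs = swaps ys"
    using assms(2) by (auto simp: length_Suc_conv)
  then show ?thesis using assms(1) by simp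
qed

text \<open>In the Klein four-group on \<open>{a, b, c, d}\<close> each double transposition is the
  product of the other two. The list is treated in blocks of four.\<close>

lemma swaps_eq_comp_swaps:
  "distinct xs \<Longrightarrow> length xs = 4 * k \<Longrightarrow>
    \<exists>ys zs. set ys = set xs \<and> distinct ys \<and> set zs = set xs \<and> distinct zs \<and>
      length ys = length xs \<and> length zs = length xs \<and> swaps ys \<circ> swaps zs = swaps xs"
proof (induction k arbitrary: xs)
  case (Suc k)
  obtain a xs1 where 1: "xs = a # xs1" "length xs1 = Suc (Suc (Suc (4 * k)))"
    using Suc.prems(2) by (cases xs) auto
  obtain b xs2 where 2: "xs1 = b # xs2" "length xs2 = Suc (Suc (4 * k))"
    using 1(2) by (cases xs1) auto
  obtain c xs3 where 3: "xs2 = c # xs3" "length xs3 = Suc (4 * k)"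
    using 2(2) by (cases xs2) auto
  obtain d xs' where 4: "xs3 = d # xs'" "length xs' = 4 * k"
    using 3(2) by (cases xs3) auto
  have xs: "xs = a # b # c # d # xs'" using 1 2 3 4 by simp
  then have d: "distinct xs'" "length xs' = 4 * k" using Suc.prems by auto
  obtain ys zs where IH: "set ys = set xs'" "distinct ys" "set zs = set xs'" "distinct zs"
    "length ys = length xs'" "length zs = length xs'" "swaps ys \<circ> swaps zs = swaps xs'"
    using Suc.IH[OF d] by blast
  let ?ys = "[a,c,b,d]" and ?zs = "[b,c,a,d]"
  have "swaps (?ys @ ys) \<circ> swaps (?zs @ zs) = swaps ?ys \<circ> (swaps ys \<circ> swaps ?zs) \<circ> swaps zs"
    by (subst (1 2) swaps_append) (simp_all add: comp_assoc del: swaps.simps)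
  also have "swaps ys \<circ> swaps ?zs = swaps ?zs \<circ> swaps ys"
    by (rule swaps_commute) (use IH Suc.prems xs in auto)
  also have "swaps ?ys \<circ> (swaps ?zs \<circ> swaps ys) \<circ> swaps zs = (swaps ?ys \<circ> swaps ?zs) \<circ> (swaps ys \<circ> swaps zs)"
    by (simp only: comp_assoc)
  also have "swaps ?ys \<circ> swaps ?zs = swaps [a,b,c,d]"
    using Suc.prems unfolding xs by (auto simp: fun_eq_iff transpose_def)
  also have "swaps [a,b,c,d] \<circ> (swaps ys \<circ> swaps zs) = swaps xs"
    unfolding IH(7) xs by (simp only: swaps.simps comp_assoc comp_id)
  finally have "swaps (?ys @ ys) \<circ> swaps (?zs @ zs) = swaps xs" .
  moreover have "set (?ys @ ys) = set xs" "set (?zs @ zs) = set xs"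
    "length (?ys @ ys) = length xs" "length (?zs @ zs) = length xs"
    using IH(1,3,5,6) xs by auto
  moreover have "distinct (?ys @ ys)" "distinct (?zs @ zs)"
    using IH(1-4) Suc.prems(1) xs by auto
  ultimately show ?case by blast
qed (simp add: fun_eq_iff)

lemma inv_swaps: "distinct xs \<Longrightarrow> inv' (swaps xs) = swaps xs"
  by (intro inv_unique_comp swaps_involution)

lemma ex_distinct_list:
  assumes "finite A" "n \<le> card A"
  shows "\<exists>xs. distinct xs \<and> set xs \<subseteq> A \<and> length xs = n"
proof -
  obtain B where B: "B \<subseteq> A" "card B = n" "finite B"
    using obtain_subset_with_card_n[OF assms(2)] by blast
  then obtain xs where "set xs = B" "distinct xs" using finite_distinct_list by blast
  then show ?thesis using B distinct_card[of xs] by (intro exI[of _ xs]) simp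
qed

text \<open>For a list \<open>as\<close> in \<open>D\<close>, the commutator of \<open>h\<close> and \<open>swaps as\<close> is \<open>swaps (map h as @ as)\<close>, a product of
  disjoint transpositions; two such products that share one half multiply to \<open>swaps xs\<close>.\<close>

lemma swaps_in_conj_prods_of_displaced:
  assumes h: "h permutes {1..m}" and D: "D \<subseteq> {1..m}" "D \<inter> h ` D = {}" "4 * k \<le> card D"
    and xs: "distinct xs" "set xs \<subseteq> {1..m}" "length xs = 4 * k"
  shows "swaps xs \<in> conj_prods m h 2"
proof -
  have fX: "finite D" using D(1) finite_subset by blast
  obtain as where as: "distinct as" "set as \<subseteq> D" "length as = 4 * k"
    using ex_distinct_list[OF fX D(3)] by blast
  have hX: "h ` D \<subseteq> {1..m}" using D(1) permutes_image[OF h] by blast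
  have inj: "inj h" using h permutes_inj by blast
  have evas: "swaps as \<in> carrier (alt_group m)"
    using as D(1) evenperm_swaps[OF as(1)] swaps_permutes[of as "{1..m}"] by (auto simp: alt_group_carrier)
  have dist: "distinct (map h as @ as)"
    using as D(2) inj by (auto simp: distinct_map inj_on_subset)
  have "swaps (map h as @ as) = h \<circ> swaps as \<circ> inv' h \<circ> inv' (swaps as)"
    using swaps_append[of "map h as" as] as conj_swaps[OF permutes_bij[OF h], of as] inv_swaps[OF as(1)]
    by (simp add: comp_assoc)
  then have "swaps (map h as @ as) \<in> conj_prods m h 1"
    using commutator_in_conj_prods_one[OF evas] by simp
  then have one: "swaps ys \<in> conj_prods m h 1" if "distinct ys" "set ys \<subseteq> {1..m}" "length ys = 8 * k" for ys
  proof (rule swaps_in_conj_prods_transfer)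
    show "set (map h as @ as) \<subseteq> {1..m}"
      using subset_trans[OF as(2) D(1)] subset_trans[OF image_mono[OF as(2), of h] hX] by simp
  qed (use that as dist in auto)
  \<comment> \<open>Room for the shared half: \<open>D\<close> and its image are disjoint, so
    \<open>8 * k \<le> 2 * card D \<le> m\<close>, and at least \<open>4 * k\<close> points remain
    outside \<open>xs\<close>.\<close>
  have "card (D \<union> h ` D) = 2 * card D"
    using D(2) fX card_image[OF inj_on_subset[OF inj]] by (subst card_Un_disjoint) auto
  then have "2 * card D \<le> m" using card_mono[of "{1..m}" "D \<union> h ` D"] D hX by simp
  then have "4 * k \<le> card ({1..m} - set xs)"
    using D(3) xs by (simp add: card_Diff_subset distinct_card)
  then obtain cs where cs: "distinct cs" "set cs \<subseteq> {1..m} - set xs" "length cs = 4 * k"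
    using ex_distinct_list[of "{1..m} - set xs" "4 * k"] by auto
  obtain ys zs where yz: "set ys = set xs" "distinct ys" "set zs = set xs" "distinct zs"
      "length ys = length xs" "length zs = length xs" "swaps ys \<circ> swaps zs = swaps xs"
    using swaps_eq_comp_swaps[OF xs(1,3)] by blast
  have "swaps (cs @ ys) \<circ> swaps (cs @ zs) \<in> conj_prods m h (1 + 1)"
    by (intro conj_prods_add one) (use yz cs xs in auto)
  moreover have "swaps (cs @ ys) \<circ> swaps (cs @ zs) = swaps xs"
  proof -
    have "even (length cs)" using cs by simp
    then have "swaps (cs @ ys) \<circ> swaps (cs @ zs) = (swaps cs \<circ> swaps ys) \<circ> (swaps cs \<circ> swaps zs)"
      by (simp only: swaps_append)
    also have "swaps cs \<circ> swaps ys = swaps ys \<circ> swaps cs"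
      by (rule swaps_commute) (use cs yz in auto)
    also have "(swaps ys \<circ> swaps cs) \<circ> (swaps cs \<circ> swaps zs) = swaps ys \<circ> (swaps cs \<circ> swaps cs) \<circ> swaps zs"
      by (simp only: comp_assoc)
    also have "\<dots> = swaps xs" by (simp only: swaps_involution[OF cs(1)] comp_id yz(7))
    finally show ?thesis .
  qed
  ultimately show ?thesis by (simp only: one_add_one)
qed

text \<open>Take \<open>D\<close> of maximal size. A moved point outside \<open>D\<close>, its image
  and its preimage could be added to \<open>D\<close>, so these three sets cover
  \<open>moved h\<close>.\<close>

lemma ex_displaced_subset:
  assumes h: "h permutes A" "finite A"
  shows "\<exists>D \<subseteq> moved h. D \<inter> h ` D = {} \<and> card (moved h) \<le> 3 * card D"
proof -
  have fin: "finite (moved h)" using moved_subset[OF h(1)] h(2) finite_subset by blast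
  let ?P = "\<lambda>D. D \<subseteq> moved h \<and> D \<inter> h ` D = {}"
  have "\<exists>D. ?P D \<and> (\<forall>Y. ?P Y \<longrightarrow> card Y \<le> card D)"
    by (rule ex_has_greatest_nat[where k = "{}" and b = "Suc (card (moved h))"])
      (use card_mono[OF fin] in \<open>simp_all add: less_Suc_eq_le\<close>)
  then obtain D where D: "?P D" and max: "\<And>Y. ?P Y \<Longrightarrow> card Y \<le> card D" by blast
  have fX: "finite D" using D fin finite_subset by blast
  have "moved h \<subseteq> D \<union> h ` D \<union> inv' h ` D"
  proof (rule ccontr)
    assume "\<not> ?thesis"
    then obtain x where x: "x \<in> moved h" "x \<notin> D" "x \<notin> h ` D" "x \<notin> inv' h ` D" by blast
    then have "h x \<notin> D" using permutes_inverses[OF h(1)] by (metis image_eqI)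
    then have "?P (insert x D)" using D x by (auto simp: moved_def)
    then show False using max[of "insert x D"] x fX by simp
  qed
  then have "card (moved h) \<le> card (D \<union> h ` D \<union> inv' h ` D)" using fX by (intro card_mono) auto
  also have "\<dots> \<le> card D + card (h ` D) + card (inv' h ` D)"
    using card_Un_le[of "D \<union> h ` D" "inv' h ` D"] card_Un_le[of D "h ` D"] by linarith
  also have "\<dots> \<le> 3 * card D"
    using card_image_le[OF fX, of h] card_image_le[OF fX, of "inv' h"] by linarith
  finally show ?thesis using D by blast
qed

section \<open>Double transpositions from an arbitrary nontrivial permutation\<close>

text \<open>The 3-cycle taking \<open>a\<close> to \<open>b\<close> to \<open>c\<close> to
  \<open>a\<close>, composed with its conjugate taking \<open>d\<close> to \<open>b\<close> to
  \<open>c\<close> to \<open>d\<close>, is \<open>swaps [a, b, c, d]\<close>. The fifth point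
  \<open>e\<close> allows an even conjugator, the 3-cycle taking \<open>a\<close> to
  \<open>d\<close> to \<open>e\<close> to \<open>a\<close>.\<close>

lemma conj_prods_double_of_three_cycle:
  assumes h: "h permutes {1..m}"
    and p: "transpose a b \<circ> transpose b c \<in> conj_prods m h n"
    and d: "distinct [a, b, c, d, e]" "set [a, b, c, d, e] \<subseteq> {1..m}"
  shows "swaps [a, b, c, d] \<in> conj_prods m h (n + n)"
proof -
  let ?q = "transpose a d \<circ> transpose d e"
  have q: "?q \<in> carrier (alt_group m)"
    using d by (auto simp: alt_group_carrier evenperm_comp permutation_swap_id evenperm_swap
        intro!: permutes_compose permutes_swap_id)
  have iq: "inv' ?q = transpose d e \<circ> transpose a d"
    by (simp add: o_inv_distrib)
  have "swaps [a, b, c, d] =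
     (transpose a b \<circ> transpose b c) \<circ> (?q \<circ> (transpose a b \<circ> transpose b c) \<circ> inv' ?q)"
    unfolding iq
    by (rule ext, rename_tac u, case_tac "u \<in> {a, b, c, d, e}") (use d(1) in auto)
  then show ?thesis using conj_prods_add[OF p conj_prods_conj[OF q p]] by simp
qed

lemma ex_fresh:
  assumes "length xs < m"
  obtains z where "z \<in> {1..m}" "z \<notin> set xs"
proof -
  have "\<not> {1..m} \<subseteq> set xs"
    using card_mono[of "set xs" "{1..m}"] card_length[of xs] assms by auto
  then show ?thesis using that by blast
qed

text \<open>The bound 4 is the worst case: a commutator with \<open>h\<close> costs one factor, a
  second commutator doubles this to two, and turning the resulting 3-cycle into a double
  transposition doubles it to four.\<close>

lemma conj_prods_double:
  assumes m: "5 \<le> m" and h: "h permutes {1..m}" "h \<noteq> id"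
    and xs: "distinct xs" "set xs \<subseteq> {1..m}" "length xs = 4"
  shows "swaps xs \<in> conj_prods m h 4"
proof -
  have double: "swaps xs \<in> conj_prods m h 4"
    if "swaps [a, b, c, d] \<in> conj_prods m h n" "distinct [a, b, c, d]" "set [a, b, c, d] \<subseteq> {1..m}" "n \<le> 4"
    for a b c d n
    using swaps_in_conj_prods_transfer[OF that(1), of xs] that xs conj_prods_mono[OF h(1), of n 4] by auto
  have three: "swaps xs \<in> conj_prods m h 4"
    if "transpose a b \<circ> transpose b c \<in> conj_prods m h n" "distinct [a, b, c]" "set [a, b, c] \<subseteq> {1..m}" "n \<le> 2"
    for a b c n
  proof -
    obtain d where d: "d \<in> {1..m}" "d \<notin> set [a,b,c]"
      using m by (rule_tac ex_fresh[of "[a,b,c]" m]) simp_all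
    obtain e where e: "e \<in> {1..m}" "e \<notin> set [a,b,c,d]"
      using m by (rule_tac ex_fresh[of "[a,b,c,d]" m]) simp_all
    have "swaps [a,b,c,d] \<in> conj_prods m h (n + n)"
      by (rule conj_prods_double_of_three_cycle[OF h(1) that(1), of d e]) (use that d e in auto)
    then show ?thesis by (rule double) (use that d in auto)
  qed
  obtain a where a: "h a \<noteq> a" using h(2) by (auto simp: fun_eq_iff)
  define b where "b = h a"
  define c where "c = h b"
  obtain z where z: "z \<in> {1..m}" "z \<notin> set [a,b,c]"
    using m by (rule_tac ex_fresh[of "[a,b,c]" m]) simp_all
  define w where "w = h z"
  have inj: "h x = h y \<longleftrightarrow> x = y" for x y using permutes_inj[OF h(1)] by (auto simp: inj_eq)
  have "a \<in> {1..m}" using a h(1) permutes_not_in by metis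
  then have mem: "a \<in> {1..m}" "b \<in> {1..m}" "c \<in> {1..m}" "z \<in> {1..m}" "w \<in> {1..m}"
    using z permutes_in_image[OF h(1)] by (simp_all add: b_def c_def w_def)
  have ne: "a \<noteq> b" "b \<noteq> c" "z \<noteq> a" "z \<noteq> b" "z \<noteq> c" "w \<noteq> b" "w \<noteq> c"
    using a z inj by (auto simp: b_def c_def w_def)
  \<comment> \<open>The commutator of \<open>h\<close> with the 3-cycle \<open>(a b z)\<close> is supported on the at most five points
    \<open>a, b, c, z, w\<close>. If it is a 5-cycle, a second commutator yields a 3-cycle.\<close>
  let ?y = "transpose a b \<circ> transpose b z"
  have alt: "transpose x y \<circ> transpose y u \<in> carrier (alt_group m)"
    if "x \<noteq> y" "y \<noteq> u" "x \<in> {1..m}" "y \<in> {1..m}" "u \<in> {1..m}" for x y u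
    using that by (auto simp: alt_group_carrier evenperm_comp permutation_swap_id evenperm_swap
        intro!: permutes_compose permutes_swap_id)
  have conj: "p \<circ> (transpose x y \<circ> transpose y u) \<circ> inv' p = transpose (p x) (p y) \<circ> transpose (p y) (p u)"
    if "bij p" for p :: "nat \<Rightarrow> nat" and x y u
  proof -
    have "p \<circ> (transpose x y \<circ> transpose y u) \<circ> inv' p = (p \<circ> swaps [x,y] \<circ> inv' p) \<circ> (p \<circ> swaps [y,u] \<circ> inv' p)"
      by (simp add: fun_eq_iff inv_f_f[OF bij_is_inj[OF that]])
    then show ?thesis by (simp only: conj_swaps[OF that]) simp
  qed
  let ?d = "transpose b c \<circ> transpose c w \<circ> transpose b z \<circ> transpose a b"
  have "h \<circ> ?y \<circ> inv' h \<circ> inv' ?y \<in> conj_prods m h 1"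
    by (rule commutator_in_conj_prods_one[OF alt]) (use ne mem in auto)
  moreover have "h \<circ> ?y \<circ> inv' h \<circ> inv' ?y = ?d"
    by (subst conj[OF permutes_bij[OF h(1)]]) (simp add: b_def c_def w_def o_inv_distrib comp_assoc)
  ultimately have d: "?d \<in> conj_prods m h 1" by simp
  \<comment> \<open>Injectivity of \<open>h\<close> already excludes that \<open>w\<close> is
    \<open>b\<close> or \<open>c\<close>. The five coincidence patterns make \<open>?d\<close> a
    3-cycle, a double transposition, a 3-cycle, a double transposition and a 5-cycle, in this
    order.\<close>
  consider "c = a" "w = z" | "c = a" "w \<noteq> z" | "c \<noteq> a" "w = a" | "c \<noteq> a" "w = z" | "c \<noteq> a" "w \<noteq> a" "w \<noteq> z"
    by blast
  then show ?thesis
  proof cases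
    case 1
    have "?d = transpose b z \<circ> transpose z a"
      by (rule ext, rename_tac u, case_tac "u \<in> {a, b, c, z, w}") (use ne 1 in auto)
    then show ?thesis using three[of b z a 1] d ne mem by auto
  next
    case 2
    have "w \<noteq> a" using 2 ne by simp
    have "?d = swaps [a, z, b, w]"
      by (rule ext, rename_tac u, case_tac "u \<in> {a, b, c, z, w}") (use ne 2 in auto)
    then show ?thesis using double[of a z b w 1] d ne mem 2 \<open>w \<noteq> a\<close> by auto
  next
    case 3
    have "?d = transpose a z \<circ> transpose z c"
      by (rule ext, rename_tac u, case_tac "u \<in> {a, b, c, z, w}") (use ne 3 in auto)
    then show ?thesis using three[of a z c 1] d ne mem 3 by auto
  next
    case 4
    have "?d = swaps [a, b, z, c]"
      by (rule ext, rename_tac u, case_tac "u \<in> {a, b, c, z, w}") (use ne 4 in auto)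
    then show ?thesis using double[of a b z c 1] d ne mem 4 by auto
  next
    case 5
    \<comment> \<open>Here \<open>?d\<close> takes \<open>a\<close> to \<open>z\<close> to
      \<open>c\<close> to \<open>w\<close> to \<open>b\<close> to \<open>a\<close>, and
      \<open>?y'\<close> is the 3-cycle on three consecutive points. Conjugation by
      \<open>?d\<close> shifts it one step along the 5-cycle, and the quotient of the shifted and
      the original 3-cycle is again a 3-cycle.\<close>
    let ?y' = "transpose a z \<circ> transpose z c"
    have bd: "bij ?d" by (intro bij_comp) auto
    have com: "?d \<circ> ?y' \<circ> inv' ?d \<circ> inv' ?y' \<in> conj_prods m h (1 + 1)"
      by (rule commutator_in_conj_prods[OF h(1) d alt]) (use ne mem in auto)
    have "?d a = z" "?d z = c" "?d c = w"
      using ne 5 by auto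
    then have "?d \<circ> ?y' \<circ> inv' ?d = transpose z c \<circ> transpose c w"
      by (subst conj[OF bd]) (simp only:)
    then have "?d \<circ> ?y' \<circ> inv' ?d \<circ> inv' ?y' = transpose z c \<circ> transpose c w \<circ> (transpose z c \<circ> transpose a z)"
      by (simp only: o_inv_distrib[OF bij_transpose bij_transpose] inv_transpose_eq)
    also have "\<dots> = transpose a w \<circ> transpose w z"
      by (rule ext, rename_tac u, case_tac "u \<in> {a, b, c, z, w}") (use ne 5 in auto)
    finally have "transpose a w \<circ> transpose w z \<in> conj_prods m h (1 + 1)" using com by (simp only:)
    then show ?thesis by (rule three) (use ne mem 5 in auto)
  qed
qed

lemma ex_swaps_rank:
  assumes m: "5 \<le> m" and h: "h permutes {1..m}" "h \<noteq> id"
  shows "\<exists>t \<ge> 1. card (moved h) \<le> 21 * t \<and>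
    (\<forall>xs k. distinct xs \<and> set xs \<subseteq> {1..m} \<and> length xs = 4 * k \<and> k \<le> t \<longrightarrow> swaps xs \<in> conj_prods m h 4)"
proof -
  obtain D where D: "D \<subseteq> moved h" "D \<inter> h ` D = {}" "card (moved h) \<le> 3 * card D"
    using ex_displaced_subset[OF h(1)] by auto
  have D': "D \<subseteq> {1..m}" using D(1) moved_subset[OF h(1)] by blast
  \<comment> \<open>One quadruple is always available by \<open>conj_prods_double\<close>, hence the
    \<open>max\<close>. Then \<open>card D \<le> 4 * t + 3 \<le> 7 * t\<close>, and the factor 3
    relating \<open>moved h\<close> to \<open>D\<close> gives 21.\<close>
  define t where "t = max 1 (card D div 4)"
  have "swaps xs \<in> conj_prods m h 4"
    if xs: "distinct xs" "set xs \<subseteq> {1..m}" "length xs = 4 * k" "k \<le> t" for xs k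
  proof (cases "4 * k \<le> card D")
    case True
    then show ?thesis
      using swaps_in_conj_prods_of_displaced[OF h(1) D' D(2) True xs(1-3)] conj_prods_mono[OF h(1), of 2 4] by auto
  next
    case False
    then have "k = 1" using xs(4) by (auto simp: t_def)
    then show ?thesis using conj_prods_double[OF m h] xs by simp
  qed
  moreover have "card (moved h) \<le> 21 * t" using D(3) by (auto simp: t_def max_def)
  moreover have "1 \<le> t" by (simp add: t_def)
  ultimately show ?thesis by blast
qed

text \<open>Reflecting every cycle in a chosen base point gives an involution that inverts \<open>p\<close>.\<close>

lemma permutes_eq_comp_involutions:
  assumes p: "p permutes A" and A: "finite A"
  shows "\<exists>u v. p = u \<circ> v \<and> u \<circ> u = id \<and> v \<circ> v = id \<and> moved u \<subseteq> moved p \<and> moved v \<subseteq> moved p"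
proof -
  define q where "q = inv' p"
  have pq: "p (q x) = x" "q (p x) = x" for x
    using permutes_inverses[OF p] by (simp_all add: q_def)
  have pqn: "(p ^^ n) ((q ^^ n) x) = x" "(q ^^ n) ((p ^^ n) x) = x" for n x
  proof -
    show "(p ^^ n) ((q ^^ n) x) = x"
      by (induction n arbitrary: x) (simp_all add: pq funpow_swap1)
    show "(q ^^ n) ((p ^^ n) x) = x"
      by (induction n arbitrary: x) (simp_all add: pq funpow_swap1)
  qed
  \<comment> \<open>Going \<open>j\<close> steps backwards on a cycle equals going \<open>i\<close>
    steps forwards when \<open>i + j\<close> is a period.\<close>
  have qp: "(q ^^ j) x = (p ^^ i) x" if "(p ^^ (i + j)) x = x" for i j x
  proof -
    have "(p ^^ (j + i)) x = x" using that by (simp only: add.commute)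
    then have "(p ^^ j) ((p ^^ i) x) = x" by (simp add: funpow_add)
    then show ?thesis using pqn(2)[of j "(p ^^ i) x"] by simp
  qed
  have "\<exists>n>0. (p ^^ n) x = x" for x
    using permutation_self[OF permutes_imp_permutation[OF A p]] by metis
  then obtain n where n: "n x > 0" "(p ^^ n x) x = x" for x by metis
  have period: "(p ^^ (k * n x)) x = x" for k x
    by (induction k) (simp_all add: funpow_add n)
  define R where "R x y \<longleftrightarrow> (\<exists>i. (p ^^ i) x = y)" for x y
  have R_refl: "R x x" for x unfolding R_def by (intro exI[of _ 0]) simp
  have R_trans: "R x z" if R: "R x y" "R y z" for x y z
  proof -
    obtain i j where "(p ^^ i) x = y" "(p ^^ j) y = z" using R unfolding R_def by blast
    then have "(p ^^ (j + i)) x = z" by (simp add: funpow_add)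
    then show ?thesis unfolding R_def by blast
  qed
  have R_sym: "R y x" if R: "R x y" for x y
  proof -
    obtain i where i: "(p ^^ i) x = y" using R unfolding R_def by blast
    have le: "i \<le> i * n x" using n(1)[of x] by simp
    have "(p ^^ (i * n x - i)) y = (p ^^ (i * n x - i + i)) x"
      unfolding i[symmetric] by (simp only: funpow_add comp_apply)
    also have "\<dots> = x" using le period[of i x] by simp
    finally show ?thesis unfolding R_def by blast
  qed
  \<comment> \<open>The base point of the cycle of \<open>x\<close>. It is the same for all points
    of the cycle because the predicate under \<open>SOME\<close> is the same.\<close>
  define r where "r x = (SOME y. R y x)" for x
  have r: "R (r x) x" for x unfolding r_def by (rule someI[of _ x]) (rule R_refl)
  have r_cong: "r x = r y" if "R x y" for x y
  proof -
    have "(\<lambda>z. R z x) = (\<lambda>z. R z y)" using that R_trans R_sym by blast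
    then show ?thesis by (simp add: r_def)
  qed
  have q_cong: "(q ^^ i) a = (q ^^ j) a" if "(p ^^ i) a = (p ^^ j) a" "i \<le> j" for i j a
  proof -
    have "(p ^^ i) ((p ^^ (j - i)) a) = (p ^^ i) a"
      using that by (metis comp_apply funpow_add le_add_diff_inverse)
    then have "(p ^^ (j - i)) a = a" using pqn(2) by metis
    then have "(q ^^ (j - i)) a = a" using pqn(2) by metis
    then show ?thesis
      using that(2) by (metis comp_apply funpow_add le_add_diff_inverse)
  qed
  \<comment> \<open>The reflection: the point \<open>i\<close> steps after the base point goes to
    the point \<open>i\<close> steps before it. By \<open>q_cong\<close> the choice of the exponent
    is immaterial. Both \<open>u\<close> and \<open>u \<circ> p\<close> are reflections of each
    cycle, and \<open>p = u \<circ> (u \<circ> p)\<close>.\<close>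
  define u where "u x = (q ^^ (SOME i. (p ^^ i) (r x) = x)) (r x)" for x
  have u: "u ((p ^^ i) (r x)) = (q ^^ i) (r x)" for i x
  proof -
    let ?y = "(p ^^ i) (r x)"
    have "R (r x) ?y" unfolding R_def by blast
    then have ry: "r ?y = r x" using r_cong[of x ?y] r R_trans R_sym by metis
    define j where "j = (SOME i. (p ^^ i) (r ?y) = ?y)"
    have "(p ^^ j) (r ?y) = ?y" unfolding j_def by (rule someI[of _ i]) (simp add: ry)
    then have "(p ^^ j) (r x) = (p ^^ i) (r x)" by (simp add: ry)
    then have "(q ^^ j) (r x) = (q ^^ i) (r x)"
      by (metis q_cong nat_le_linear)
    then show ?thesis by (simp add: u_def j_def ry)
  qed
  have ex: "\<exists>i. x = (p ^^ i) (r x)" for x using r[of x] unfolding R_def by metis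
  have u': "u ((q ^^ i) (r x)) = (p ^^ i) (r x)" for i x
  proof -
    have le: "i \<le> i * n (r x)" using n(1)[of "r x"] by simp
    define j where "j = i * n (r x) - i"
    have per: "(p ^^ (j + i)) (r x) = r x" using period le by (simp add: j_def)
    have "(q ^^ i) (r x) = (p ^^ j) (r x)" by (rule qp) (rule per)
    then have "u ((q ^^ i) (r x)) = (q ^^ j) (r x)" by (simp add: u)
    also have "\<dots> = (p ^^ i) (r x)" by (rule qp) (use per in \<open>simp add: add.commute\<close>)
    finally show ?thesis .
  qed
  have uu: "u (u x) = x" for x
    using ex[of x] u u' by metis
  have up: "u (p (u (p x))) = x" for x
  proof -
    obtain i where i: "x = (p ^^ i) (r x)" using ex by blast
    have "p x = (p ^^ Suc i) (r x)" using i by simp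
    then have "u (p x) = q ((q ^^ i) (r x))" using u[of "Suc i" x] by simp
    then have "p (u (p x)) = (q ^^ i) (r x)" by (simp add: pq)
    then show ?thesis using u'[of i x] i by simp
  qed
  have fixed: "u x = x" if px: "p x = x" for x
  proof -
    have pn: "(p ^^ i) x = x" for i by (induction i) (simp_all add: px)
    have "r x = x" using R_sym[OF r[of x]] pn unfolding R_def by metis
    then show ?thesis using u[of 0 x] by simp
  qed
  have "p = u \<circ> (u \<circ> p)" "u \<circ> u = id" "(u \<circ> p) \<circ> (u \<circ> p) = id"
    using uu up by (simp_all add: fun_eq_iff)
  moreover have "moved u \<subseteq> moved p" "moved (u \<circ> p) \<subseteq> moved p"
    using fixed by (auto simp: moved_def)
  ultimately show ?thesis by blast
qed

text \<open>A moved point and its image form one transposition; removing this pair leaves an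
  involution with fewer moved points.\<close>

lemma involution_eq_swaps:
  assumes "finite (moved u)" "u \<circ> u = id"
  shows "\<exists>xs. distinct xs \<and> set xs = moved u \<and> even (length xs) \<and> u = swaps xs"
  using assms
proof (induction "card (moved u)" arbitrary: u rule: less_induct)
  case less
  have uu: "u (u x) = x" for x using less.prems(2) by (metis comp_apply id_apply)
  show ?case
  proof (cases "moved u = {}")
    case True
    then have "u = id" by (auto simp: moved_def fun_eq_iff)
    then show ?thesis using True by (intro exI[of _ "[]"]) simp
  next
    case False
    then obtain x where x: "u x \<noteq> x" by (auto simp: moved_def)
    define y where "y = u x"
    have y: "u y = x" "x \<noteq> y" using uu x by (auto simp: y_def)
    define v where "v z = (if z = x \<or> z = y then z else u z)" for z
    have inj: "u z = u w \<longleftrightarrow> z = w" for z w using uu by metis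
    have uz: "u z \<noteq> x" "u z \<noteq> y" if "z \<noteq> x" "z \<noteq> y" for z
      using that inj y by (auto simp: y_def)
    have vv: "v \<circ> v = id" using uu uz by (auto simp: fun_eq_iff v_def)
    have mv: "moved v = moved u - {x, y}" by (auto simp: moved_def v_def)
    have "moved v \<subset> moved u" using mv x by (auto simp: moved_def)
    then have "card (moved v) < card (moved u)" using less.prems(1) psubset_card_mono by blast
    moreover have "finite (moved v)" using mv less.prems(1) by simp
    ultimately obtain xs where xs: "distinct xs" "set xs = moved v" "even (length xs)" "v = swaps xs"
      using less.hyps vv by meson
    have "u = transpose x y \<circ> v"
    proof
      fix z
      show "u z = (transpose x y \<circ> v) z"
        using y uz[of z] by (cases "z = x"; cases "z = y") (simp_all add: v_def y_def[symmetric])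
    qed
    then have "u = swaps (x # y # xs)" using xs(4) by simp
    moreover have "set (x # y # xs) = moved u" using xs(2) mv x y by (auto simp: moved_def)
    moreover have "distinct (x # y # xs)" using xs mv y by auto
    ultimately show ?thesis using xs(3) by (intro exI[of _ "x # y # xs"]) simp
  qed
qed

section \<open>The covering statement for even permutations\<close>

text \<open>If the transpositions overlap, together they involve at most three points. As
  \<open>m \<ge> 5\<close>, a disjoint transposition of \<open>e\<close> and \<open>f\<close> can be
  inserted twice, which gives two double transpositions at a cost of 4 each.\<close>

lemma two_transposes_in_conj_prods:
  assumes m: "5 \<le> m" and h: "h permutes {1..m}" "h \<noteq> id"
    and ab: "a \<noteq> b" "c \<noteq> d" "{a, b, c, d} \<subseteq> {1..m}"
  shows "transpose a b \<circ> transpose c d \<in> conj_prods m h 8"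
proof -
  have double: "swaps [x, y, z, w] \<in> conj_prods m h 4"
    if "distinct [x, y, z, w]" "{x, y, z, w} \<subseteq> {1..m}" for x y z w
    using conj_prods_double[OF m h that(1)] that(2) by simp
  have share: "transpose a b \<circ> transpose c d \<in> conj_prods m h 8"
    if x: "x \<in> {1..m}" "{c, d} \<subseteq> {a, b, x}" for x
  proof -
    obtain e where e: "e \<in> {1..m}" "e \<notin> set [a, b, x]"
      using m by (rule_tac ex_fresh[of "[a, b, x]" m]) simp_all
    obtain f where f: "f \<in> {1..m}" "f \<notin> set [a, b, x, e]"
      using m by (rule_tac ex_fresh[of "[a, b, x, e]" m]) simp_all
    have "distinct [a, b, e, f]" using e(2) f(2) ab(1) by simp
    moreover have "e \<notin> {c, d}" "f \<notin> {c, d}" using x(2) e(2) f(2) by auto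
    then have "distinct [e, f, c, d]" using f(2) ab(2) by simp
    moreover have "{a, b, e, f} \<subseteq> {1..m}" "{e, f, c, d} \<subseteq> {1..m}" using ab(3) e(1) f(1) by auto
    ultimately have "swaps [a, b, e, f] \<circ> swaps [e, f, c, d] \<in> conj_prods m h (4 + 4)"
      by (intro conj_prods_add[OF double double])
    moreover have "swaps [a, b, e, f] \<circ> swaps [e, f, c, d] = transpose a b \<circ> transpose c d"
      by (simp add: fun_eq_iff)
    ultimately show ?thesis by simp
  qed
  show ?thesis
  proof (cases "{a, b} \<inter> {c, d} = {}")
    case True
    then have "swaps [a, b, c, d] \<in> conj_prods m h 4" using double[of a b c d] ab by auto
    then show ?thesis using conj_prods_mono[OF h(1), of 4 8] by auto
  next
    case False
    then have "c \<in> {a, b} \<or> d \<in> {a, b}" by blast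
    then show ?thesis using share[of c] share[of d] ab(3) by blast
  qed
qed

text \<open>Both involutions making up \<open>g\<close> are cut into lots of at most
  \<open>4 * t\<close> points. A lot costs 4 factors whatever its size, which is why the count does
  not depend on \<open>m\<close>.\<close>

theorem evenperm_in_conj_prods:
  assumes m: "5 \<le> m" and h: "h permutes {1..m}" and g: "g permutes {1..m}" "evenperm g"
    and k: "card (moved g) \<le> k * card (moved h)"
  shows "g \<in> conj_prods m h (48 * k + 8)"
proof (cases "h = id")
  case True
  then have "card (moved g) = 0" using k by (simp add: moved_def)
  moreover have "finite (moved g)" using moved_subset[OF g(1)] finite_subset by blast
  ultimately have "g = id" by (auto simp: moved_def fun_eq_iff)
  then show ?thesis using id_in_conj_prods[OF h] by simp
next
  case hne: False
  obtain t where t: "t \<ge> 1" "card (moved h) \<le> 21 * t"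
    and sw: "\<And>xs k. \<lbrakk>distinct xs; set xs \<subseteq> {1..m}; length xs = 4 * k; k \<le> t\<rbrakk> \<Longrightarrow> swaps xs \<in> conj_prods m h 4"
    using ex_swaps_rank[OF m h hne] by blast
  have chunks: "swaps xs \<in> conj_prods m h (4 * c)"
    if "distinct xs" "set xs \<subseteq> {1..m}" "length xs = 4 * j" "j \<le> c * t" for xs j c
    using that
  proof (induction c arbitrary: xs j)
    case 0
    then show ?case by (simp add: fun_eq_iff)
  next
    case (Suc c)
    show ?case
    proof (cases "j \<le> t")
      case True
      then show ?thesis
        using sw[of xs j] Suc.prems conj_prods_mono[OF h, of 4 "4 * Suc c"] by auto
    next
      case False
      let ?ys = "take (4 * t) xs" and ?zs = "drop (4 * t) xs"
      have "swaps ?ys \<in> conj_prods m h 4"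
        using Suc.prems False by (intro sw[of _ t]) (auto dest: in_set_takeD)
      moreover have "swaps ?zs \<in> conj_prods m h (4 * c)"
        using Suc.prems False by (intro Suc.IH[of _ "j - t"]) (auto dest: in_set_dropD)
      ultimately have "swaps ?ys \<circ> swaps ?zs \<in> conj_prods m h (4 + 4 * c)"
        by (rule conj_prods_add)
      moreover have "swaps ?ys \<circ> swaps ?zs = swaps xs"
        using swaps_append[of ?ys ?zs] Suc.prems False by simp
      ultimately show ?thesis by simp
    qed
  qed
  obtain u v where uv: "g = u \<circ> v" "u \<circ> u = id" "v \<circ> v = id" "moved u \<subseteq> moved g" "moved v \<subseteq> moved g"
    using permutes_eq_comp_involutions[OF g(1)] by auto
  have fin: "finite (moved g)" using moved_subset[OF g(1)] finite_subset by blast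
  obtain xs where xs: "distinct xs" "set xs = moved u" "even (length xs)" "u = swaps xs"
    using involution_eq_swaps[OF finite_subset[OF uv(4) fin] uv(2)] by blast
  obtain ys where ys: "distinct ys" "set ys = moved v" "even (length ys)" "v = swaps ys"
    using involution_eq_swaps[OF finite_subset[OF uv(5) fin] uv(3)] by blast
  have sub: "set xs \<subseteq> {1..m}" "set ys \<subseteq> {1..m}"
    using xs(2) ys(2) uv(4,5) moved_subset[OF g(1)] by auto
  have "card (moved g) \<le> k * (21 * t)"
    using k mult_le_mono2[OF t(2), of k] by linarith
  then have kt: "card (moved g) \<le> 21 * (k * t)" by simp
  have len: "length xs \<le> 21 * (k * t)" "length ys \<le> 21 * (k * t)"
    using card_mono[OF fin uv(4)] card_mono[OF fin uv(5)] distinct_card[OF xs(1)] distinct_card[OF ys(1)]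
      xs(2) ys(2) kt by simp_all
  have four: "swaps zs \<in> conj_prods m h (24 * k)"
    if "distinct zs" "set zs \<subseteq> {1..m}" and dvd: "4 dvd length zs" and "length zs \<le> 21 * (k * t)" for zs
  proof -
    obtain j where j: "length zs = 4 * j" using dvd by blast
    \<comment> \<open>At most \<open>21 * (k * t)\<close> points form at most
      \<open>6 * (k * t)\<close> quadruples, since \<open>21 / 4 < 6\<close>.\<close>
    have "j \<le> 6 * (k * t)" using that(4) j by linarith
    then have "j \<le> 6 * k * t" by simp
    then show ?thesis using chunks[OF that(1,2) j, of "6 * k"] by simp
  qed
  \<comment> \<open>As \<open>g\<close> is even, the two involutions have the same parity: both
    lengths are divisible by 4, or both are 2 modulo 4.\<close>
  have par: "even (length xs div 2) \<longleftrightarrow> even (length ys div 2)"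
    using g(2) evenperm_comp[OF permutation_swaps permutation_swaps, of xs ys]
      evenperm_swaps[OF xs(1)] evenperm_swaps[OF ys(1)] uv(1) xs(4) ys(4) by simp
  show ?thesis
  proof (cases "even (length xs div 2)")
    case True
    then have "4 dvd length xs" "4 dvd length ys" using par xs(3) ys(3) by presburger+
    then have "swaps xs \<circ> swaps ys \<in> conj_prods m h (24 * k + 24 * k)"
      using conj_prods_add[OF four four] xs(1) ys(1) sub len by blast
    moreover have "24 * k + 24 * k \<le> 48 * k + 8" by simp
    ultimately show ?thesis
      using conj_prods_mono[OF h] xs(4) ys(4) uv(1) by blast
  next
    case False
    then have "odd (length ys div 2)" using par by simp

    have "length xs \<ge> 2" "length ys \<ge> 2" using False par by (auto simp: div_less intro!: leI)
    \<comment> \<open>One transposition is split off each odd involution: the last pair of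
      \<open>xs\<close> and the first pair of \<open>ys\<close>, which are adjacent in
      \<open>u \<circ> v\<close>.\<close>
    define b a as where "b = last xs" and "a = last (butlast xs)" and "as = butlast (butlast xs)"
    have "xs \<noteq> []" "butlast xs \<noteq> []" using \<open>2 \<le> length xs\<close> by (auto simp flip: length_0_conv)
    have "xs = butlast xs @ [b]"
      using append_butlast_last_id[OF \<open>xs \<noteq> []\<close>] by (simp only: b_def)
    also have "butlast xs = as @ [a]"
      using append_butlast_last_id[OF \<open>butlast xs \<noteq> []\<close>] by (simp only: a_def as_def)
    finally have ab: "xs = as @ [a, b]" by simp
    obtain c d bs where cd: "ys = c # d # bs"
      using \<open>2 \<le> length ys\<close> by (metis Suc_le_length_iff numeral_2_eq_2)
    have dvd: "4 dvd length as" "4 dvd length bs"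
      using False \<open>odd (length ys div 2)\<close> xs(3) ys(3) ab cd by simp_all presburger+
    have "transpose a b \<circ> transpose c d \<in> conj_prods m h 8"
      by (rule two_transposes_in_conj_prods[OF m h hne]) (use xs(1) ys(1) ab cd sub in auto)
    moreover have "swaps as \<in> conj_prods m h (24 * k)"
      by (rule four[OF _ _ dvd(1)]) (use xs(1) ab sub len in auto)
    moreover have "swaps bs \<in> conj_prods m h (24 * k)"
      by (rule four[OF _ _ dvd(2)]) (use ys(1) cd sub len in auto)
    ultimately have "swaps as \<circ> (transpose a b \<circ> transpose c d) \<circ> swaps bs \<in> conj_prods m h (24 * k + 8 + 24 * k)"
      using conj_prods_add by blast
    moreover have "swaps as \<circ> (transpose a b \<circ> transpose c d) \<circ> swaps bs = g"
    proof -
      have "even (length as)" using dvd(1) by presburger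
      then have "u = swaps as \<circ> transpose a b"
        using swaps_append[of as "[a, b]"] xs(4) ab by simp
      moreover have "v = transpose c d \<circ> swaps bs" using ys(4) cd by simp
      ultimately show ?thesis using uv(1) by (simp only: comp_assoc)
    qed
    ultimately show ?thesis by simp
  qed
qed

section \<open>Homomorphisms from free groups\<close>

context group
begin

lemma eval_word_Nil [simp]: "eval_word G [] = \<one>"
  by (simp add: eval_word_def)

lemma eval_word_Cons [simp]: "eval_word G (l # w) = eval_letter G l \<otimes> eval_word G w"
  by (simp add: eval_word_def)

lemma eval_letter_closed: "snd l \<in> carrier G \<Longrightarrow> eval_letter G l \<in> carrier G"
  by (cases l) auto

lemma eval_word_closed: "snd ` set w \<subseteq> carrier G \<Longrightarrow> eval_word G w \<in> carrier G"
  by (induction w) (auto simp: eval_letter_closed)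

lemma eval_word_append:
  "snd ` set u \<subseteq> carrier G \<Longrightarrow> snd ` set v \<subseteq> carrier G \<Longrightarrow>
    eval_word G (u @ v) = eval_word G u \<otimes> eval_word G v"
  by (induction u) (auto simp: eval_letter_closed eval_word_closed m_assoc)

lemma eval_word_inverse:
  "snd ` set w \<subseteq> carrier G \<Longrightarrow> eval_word G (rev (map (apfst Not) w)) = inv (eval_word G w)"
proof (induction w)
  case (Cons l w)
  obtain s x where l: "l = (s, x)" by (cases l)
  have x: "x \<in> carrier G" "snd ` set w \<subseteq> carrier G" using Cons.prems l by auto
  have "snd ` set (rev (map (apfst Not) w)) \<subseteq> carrier G"
    using x(2) by (force simp: apfst_def)
  then have "eval_word G (rev (map (apfst Not) (l # w))) = inv (eval_word G w) \<otimes> eval_letter G (\<not> s, x)"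
    using Cons.IH[OF x(2)] x eval_word_append[of "rev (map (apfst Not) w)" "[(\<not> s, x)]"]
    by (simp add: l)
  also have "eval_letter G (\<not> s, x) = inv (eval_letter G l)"
    using x by (simp add: l)
  also have "inv (eval_word G w) \<otimes> inv (eval_letter G l) = inv (eval_word G (l # w))"
    using eval_word_closed[OF x(2)] eval_letter_closed[of l] x l by (simp add: inv_mult_group)
  finally show ?case .
qed simp

lemma eval_letter_cancel:
  assumes "x \<in> carrier G" "s \<noteq> t" "y \<in> carrier G"
  shows "eval_letter G (s, x) \<otimes> (eval_letter G (t, x) \<otimes> y) = y"
  using assms by (cases s; cases t) (simp_all add: m_assoc[symmetric])

lemma generate_eq_eval_word:
  assumes "B \<subseteq> carrier G" "x \<in> generate G B"
  shows "\<exists>w. snd ` set w \<subseteq> B \<and> eval_word G w = x"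
  using assms(2)
proof induction
  case one
  then show ?case by (intro exI[of _ "[]"]) simp
next
  case (incl h)
  then show ?case using assms(1) by (intro exI[of _ "[(True, h)]"]) auto
next
  case (inv h)
  then show ?case using assms(1) by (intro exI[of _ "[(False, h)]"]) auto
next
  case (eng g h)
  then obtain u v where uv: "snd ` set u \<subseteq> B" "eval_word G u = g" "snd ` set v \<subseteq> B" "eval_word G v = h"
    by blast
  then have "eval_word G (u @ v) = g \<otimes> h"
    using assms(1) eval_word_append[of u v] by auto
  then show ?case using uv by (intro exI[of _ "u @ v"]) auto
qed

end

lemma hom_eval_word:
  assumes "group F" "group G" "\<phi> \<in> hom F G" "snd ` set w \<subseteq> carrier F"
  shows "\<phi> (eval_word F w) = eval_word G (map (apsnd \<phi>) w)"
  using assms(4)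
proof (induction w)
  case Nil
  then show ?case
    using group.eval_word_Nil[OF assms(1)] group.eval_word_Nil[OF assms(2)] hom_one[OF assms(3,1,2)] by simp
next
  case (Cons l w)
  interpret F: group F by fact
  interpret G: group G by fact
  interpret group_hom F G \<phi> by unfold_locales fact
  obtain s x where l: "l = (s, x)" by (cases l)
  have x: "x \<in> carrier F" "snd ` set w \<subseteq> carrier F" using Cons.prems l by auto
  have "\<phi> (eval_letter F l) = eval_letter G (apsnd \<phi> l)" using x by (simp add: l)
  then show ?case
    using Cons.IH[OF x(2)] F.eval_word_closed[OF x(2)] F.eval_letter_closed[of l] x l by simp
qed

lemma not_successively_split:
  "\<not> successively P w \<Longrightarrow> \<exists>u x y v. w = u @ x # y # v \<and> \<not> P x y"
proof (induction w rule: induct_list012)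
  case (3 x y zs)
  show ?case
  proof (cases "P x y")
    case True
    then have "\<not> successively P (y # zs)" using 3(3) by simp
    then obtain u a b v where "y # zs = u @ a # b # v" "\<not> P a b" using 3(2) by blast
    then have "x # y # zs = (x # u) @ a # b # v" by simp
    then show ?thesis using \<open>\<not> P a b\<close> by blast
  next
    case False
    then show ?thesis by (intro exI[of _ "[]"]) auto
  qed
qed auto

text \<open>By freeness a nonempty word with trivial value is not reduced, so it contains two
  adjacent mutually inverse letters. Cancelling them changes neither of the two values and shortens
  the word.\<close>

lemma free_basis_eval_word_transfer:
  assumes F: "group F" and B: "free_basis F B" and G: "group G" and f: "f \<in> B \<rightarrow> carrier G"
  shows "snd ` set w \<subseteq> B \<Longrightarrow> eval_word F w = \<one>\<^bsub>F\<^esub> \<Longrightarrow> eval_word G (map (apsnd f) w) = \<one>\<^bsub>G\<^esub>"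
proof (induction "length w" arbitrary: w rule: less_induct)
  case less
  interpret F: group F by fact
  interpret G: group G by fact
  have Bc: "B \<subseteq> carrier F" using B by (simp add: free_basis_def)
  show ?case
  proof (cases "w = []")
    case False
    then have "\<not> reduced_word w" using less.prems B by (auto simp: free_basis_def)
    then obtain u p q v where w: "w = u @ p # q # v" "\<not> (\<lambda>(s, x) (t, y). \<not> (x = y \<and> s \<noteq> t)) p q"
      using not_successively_split unfolding reduced_word_def by blast
    obtain s t x where p: "p = (s, x)" "q = (t, x)" "s \<noteq> t" using w(2) by (cases p; cases q) auto
    have sets: "snd ` set u \<subseteq> B" "snd ` set v \<subseteq> B" "x \<in> B" using less.prems(1) w(1) p by auto
    have setsF: "snd ` set u \<subseteq> carrier F" "snd ` set v \<subseteq> carrier F" "x \<in> carrier F"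
      using sets Bc by blast+
    let ?f = "map (apsnd f)"
    have setsG: "snd ` set (?f u) \<subseteq> carrier G" "snd ` set (?f v) \<subseteq> carrier G" "f x \<in> carrier G"
      using sets f by (force simp: apsnd_def)+
    have "eval_word F w = eval_word F (u @ v)"
    proof -
      have "eval_word F w = eval_word F u \<otimes>\<^bsub>F\<^esub> eval_word F (p # q # v)"
        unfolding w(1) by (rule F.eval_word_append) (use setsF p in auto)
      also have "eval_word F (p # q # v) = eval_word F v"
        using F.eval_letter_cancel[OF setsF(3) p(3) F.eval_word_closed[OF setsF(2)]] p by simp
      finally show ?thesis using F.eval_word_append[OF setsF(1,2)] by simp
    qed
    then have "eval_word G (?f (u @ v)) = \<one>\<^bsub>G\<^esub>"
      using less.prems sets w by (intro less.hyps) auto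
    moreover have "eval_word G (?f w) = eval_word G (?f (u @ v))"
    proof -
      have "eval_word G (?f w) = eval_word G (?f u) \<otimes>\<^bsub>G\<^esub> eval_word G (?f (p # q # v))"
        unfolding w(1) map_append by (rule G.eval_word_append) (use setsG p in auto)
      also have "eval_word G (?f (p # q # v)) = eval_word G (?f v)"
        using G.eval_letter_cancel[OF setsG(3) p(3) G.eval_word_closed[OF setsG(2)]] p by simp
      finally show ?thesis using G.eval_word_append[OF setsG(1,2)] by simp
    qed
    ultimately show ?thesis by simp
  next
    case True
    then show ?thesis by (simp add: G.eval_word_Nil)
  qed
qed

text \<open>The universal property. The value at \<open>g\<close> is read off any word for
  \<open>g\<close>; two words for the same element differ by a word with trivial value, so the
  previous lemma makes the choice immaterial.\<close>

theorem free_basis_ex_hom: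
  assumes F: "group F" and B: "free_basis F B" and G: "group G" and f: "f \<in> B \<rightarrow> carrier G"
  shows "\<exists>\<phi> \<in> hom F G. \<forall>b \<in> B. \<phi> b = f b"
proof -
  interpret F: group F by fact
  interpret G: group G by fact
  have Bc: "B \<subseteq> carrier F" and gen: "generate F B = carrier F" using B by (simp_all add: free_basis_def)
  let ?f = "map (apsnd f)"
  have setG: "snd ` set (?f w) \<subseteq> carrier G" if "snd ` set w \<subseteq> B" for w
    using that f by (force simp: apsnd_def)
  have wd: "eval_word G (?f u) = eval_word G (?f v)"
    if u: "snd ` set u \<subseteq> B" and v: "snd ` set v \<subseteq> B" and eq: "eval_word F u = eval_word F v" for u v
  proof -
    let ?v = "rev (map (apfst Not) v)"
    have v': "snd ` set ?v \<subseteq> B" using v by (simp add: image_image)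
    have cu: "snd ` set u \<subseteq> carrier F" and cv: "snd ` set v \<subseteq> carrier F" and cv': "snd ` set ?v \<subseteq> carrier F"
      using u v v' Bc by blast+
    have "eval_word F (u @ ?v) = eval_word F u \<otimes>\<^bsub>F\<^esub> inv\<^bsub>F\<^esub> (eval_word F v)"
      by (simp only: F.eval_word_append[OF cu cv'] F.eval_word_inverse[OF cv])
    then have "eval_word F (u @ ?v) = \<one>\<^bsub>F\<^esub>"
      using eq F.eval_word_closed[OF cv] by simp
    moreover have "snd ` set (u @ ?v) \<subseteq> B" using u v' by (simp add: image_Un)
    ultimately have "eval_word G (?f (u @ ?v)) = \<one>\<^bsub>G\<^esub>"
      by (intro free_basis_eval_word_transfer[OF F B G f])
    moreover have "?f ?v = rev (map (apfst Not) (?f v))"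
      by (simp add: rev_map)
    ultimately have "eval_word G (?f u) \<otimes>\<^bsub>G\<^esub> inv\<^bsub>G\<^esub> (eval_word G (?f v)) = \<one>\<^bsub>G\<^esub>"
      using G.eval_word_append[OF setG[OF u] setG[OF v']] G.eval_word_inverse[OF setG[OF v]] by simp
    then show ?thesis
      using G.inv_equality G.eval_word_closed[OF setG[OF u]] G.eval_word_closed[OF setG[OF v]]
      by (metis G.inv_closed G.inv_inv)
  qed
  define W where "W g = (SOME w. snd ` set w \<subseteq> B \<and> eval_word F w = g)" for g
  have W: "snd ` set (W g) \<subseteq> B" "eval_word F (W g) = g" if "g \<in> carrier F" for g
    using someI_ex[OF F.generate_eq_eval_word[OF Bc, of g]] that gen unfolding W_def by auto
  define \<phi> where "\<phi> g = eval_word G (?f (W g))" for g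
  have \<phi>: "\<phi> (eval_word F w) = eval_word G (?f w)" if w: "snd ` set w \<subseteq> B" for w
  proof -
    have "eval_word F w \<in> carrier F" using F.eval_word_closed w Bc by blast
    then show ?thesis unfolding \<phi>_def using W w by (intro wd) auto
  qed
  have "\<phi> \<in> hom F G"
  proof (rule homI)
    fix g assume "g \<in> carrier F"
    then show "\<phi> g \<in> carrier G" unfolding \<phi>_def by (intro G.eval_word_closed setG W)
  next
    fix g h assume gh: "g \<in> carrier F" "h \<in> carrier F"
    have "snd ` set (W g @ W h) \<subseteq> B" using W gh by (simp add: image_Un)
    moreover have "eval_word F (W g @ W h) = g \<otimes>\<^bsub>F\<^esub> h"
      using W gh Bc by (subst F.eval_word_append) auto
    ultimately have "\<phi> (g \<otimes>\<^bsub>F\<^esub> h) = eval_word G (?f (W g @ W h))"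
      using \<phi> by metis
    then show "\<phi> (g \<otimes>\<^bsub>F\<^esub> h) = \<phi> g \<otimes>\<^bsub>G\<^esub> \<phi> h"
      unfolding \<phi>_def map_append using G.eval_word_append[OF setG setG] W gh by simp
  qed
  moreover have "\<phi> b = f b" if b: "b \<in> B" for b
  proof -
    have "\<phi> (eval_word F [(True, b)]) = eval_word G (?f [(True, b)])" by (rule \<phi>) (use b in simp)
    then show ?thesis using b Bc f by (auto simp: Pi_iff)
  qed
  ultimately show ?thesis by blast
qed

section \<open>Separating elements of a free group by permutations\<close>

lemma ex_permutes_extending:
  assumes "finite A" "D \<subseteq> A" "f ` D \<subseteq> A" "inj_on f D"
  shows "\<exists>p. p permutes A \<and> (\<forall>x \<in> D. p x = f x)"
proof -
  obtain xs where xs: "set xs = D" "distinct xs"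
    using finite_distinct_list finite_subset[OF assms(2,1)] by blast
  then obtain p where "p permutes A" "map p xs = map f xs"
    using ex_permutes_map_eq[of A xs "map f xs"] assms by (auto simp: distinct_map)
  then show ?thesis using xs by auto
qed

text \<open>The word \<open>w\<close> of length \<open>n\<close> moves the point \<open>n + 1\<close> down to \<open>1\<close>, one step per letter; being reduced
  makes the partial maps prescribed for the single letters well defined and injective.\<close>

lemma reduced_word_acts_nontrivially:
  assumes w: "reduced_word w" "w \<noteq> []"
  shows "\<exists>\<sigma>. (\<forall>b. \<sigma> b permutes {1..Suc (length w)}) \<and>
    eval_word (sym_group (Suc (length w))) (map (apsnd \<sigma>) w) \<noteq> id"
proof -
  define n where "n = length w"
  let ?S = "sym_group (Suc n)"
  interpret S: group ?S by (rule sym_group_is_group)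
  \<comment> \<open>The letter with index \<open>i\<close>, counted from 0, has to take
    \<open>i + 2\<close> to \<open>i + 1\<close>. For an inverse letter the pair is reversed, since
    it constrains the generator.\<close>
  define R where "R b = {(i + 2, i + 1) | i. i < n \<and> w ! i = (True, b)} \<union>
    {(i + 1, i + 2) | i. i < n \<and> w ! i = (False, b)}" for b
  have red: "\<not> (x = y \<and> s \<noteq> t)" if "Suc i < n" "w ! i = (s, x)" "w ! Suc i = (t, y)" for i s t x y
    using w(1) that unfolding reduced_word_def successively_conv_nth n_def by fastforce
  \<comment> \<open>Two pairs of the same generator can share a point only if they come from
    neighbouring letters of opposite sign, which \<open>red\<close> excludes.\<close>
  have sv: "y = z" if "(x, y) \<in> R b" "(x, z) \<in> R b" for b x y z
    using that red unfolding R_def by fastforce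
  have inj: "x = z" if "(x, y) \<in> R b" "(z, y) \<in> R b" for b x y z
    using that red unfolding R_def by fastforce
  have "\<exists>p. p permutes {1..Suc n} \<and> (\<forall>(x, y) \<in> R b. p x = y)" for b
  proof -
    define f where "f x = (THE y. (x, y) \<in> R b)" for x
    have f: "f x = y" if "(x, y) \<in> R b" for x y
      unfolding f_def using that sv by (intro the_equality) auto
    have "\<exists>p. p permutes {1..Suc n} \<and> (\<forall>x \<in> Domain (R b). p x = f x)"
    proof (rule ex_permutes_extending)
      show "Domain (R b) \<subseteq> {1..Suc n}" by (auto simp: R_def)
      have "f x \<in> {1..Suc n}" if "(x, y) \<in> R b" for x y
        unfolding f[OF that] using that by (auto simp: R_def)
      then show "f ` Domain (R b) \<subseteq> {1..Suc n}" by blast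
      show "inj_on f (Domain (R b))" using f inj by (metis DomainE inj_onI)
    qed simp
    then show ?thesis using f by fastforce
  qed
  then have "\<exists>\<sigma>. \<forall>b. \<sigma> b permutes {1..Suc n} \<and> (\<forall>(x, y) \<in> R b. \<sigma> b x = y)"
    by (intro choice allI)
  then obtain \<sigma> where "\<forall>b. \<sigma> b permutes {1..Suc n} \<and> (\<forall>(x, y) \<in> R b. \<sigma> b x = y)" ..
  then have \<sigma>: "\<And>b. \<sigma> b permutes {1..Suc n}" "\<And>b x y. (x, y) \<in> R b \<Longrightarrow> \<sigma> b x = y"
    by auto
  have \<sigma>c: "\<sigma> b \<in> carrier ?S" for b using \<sigma>(1) by (simp add: sym_group_carrier)
  have letter: "eval_letter ?S (apsnd \<sigma> (w ! i)) (i + 2) = i + 1" if i: "i < n" for i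
  proof -
    obtain s b where wi: "w ! i = (s, b)" by (cases "w ! i")
    show ?thesis
    proof (cases s)
      case True
      then have "(i + 2, i + 1) \<in> R b" using wi i by (auto simp: R_def)
      then show ?thesis using \<sigma>(2) wi True by simp
    next
      case False
      then have "(i + 1, i + 2) \<in> R b" using wi i by (auto simp: R_def)
      then have "inv' (\<sigma> b) (i + 2) = i + 1"
        using \<sigma> permutes_inverses(2)[OF \<sigma>(1)] by metis
      then show ?thesis using wi False \<sigma>c by simp
    qed
  qed
  \<comment> \<open>The last letter acts first, hence the suffixes: the last \<open>k\<close>
    letters bring \<open>n + 1\<close> down by \<open>k\<close>.\<close>
  have "eval_word ?S (map (apsnd \<sigma>) (drop (n - k) w)) (n + 1) = n - k + 1" if "k \<le> n" for k
    using that
  proof (induction k)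
    case 0
    then show ?case using S.eval_word_Nil by (simp add: n_def sym_group_one)
  next
    case (Suc k)
    define i where "i = n - Suc k"
    have i: "i < n" "n - k = Suc i" using Suc.prems by (auto simp: i_def)
    have "drop i w = w ! i # drop (Suc i) w" using i by (simp add: Cons_nth_drop_Suc n_def)
    then show ?case using Suc letter[OF i(1)] i S.eval_word_Cons by (simp add: sym_group_mult i_def[symmetric])
  qed
  from this[of n] have "eval_word ?S (map (apsnd \<sigma>) w) (n + 1) = 1" by simp
  moreover have "n \<ge> 1" using w(2) by (cases w) (auto simp: n_def)
  ultimately have "eval_word ?S (map (apsnd \<sigma>) w) \<noteq> id" by auto
  then show ?thesis using \<sigma>(1) unfolding n_def by blast
qed

text \<open>A shortest word for \<open>g\<close> is reduced, since cancelling a pair of adjacent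
  inverse letters would shorten it.\<close>

lemma ex_reduced_word:
  assumes F: "group F" and B: "free_basis F B" and g: "g \<in> carrier F"
  shows "\<exists>w. snd ` set w \<subseteq> B \<and> reduced_word w \<and> eval_word F w = g"
proof -
  interpret F: group F by fact
  have Bc: "B \<subseteq> carrier F" and gen: "generate F B = carrier F" using B by (simp_all add: free_basis_def)
  let ?P = "\<lambda>w. snd ` set w \<subseteq> B \<and> eval_word F w = g"
  define w where "w = arg_min length ?P"
  have "\<exists>w. ?P w" using F.generate_eq_eval_word[OF Bc] g gen by blast
  then have w: "?P w" and min: "\<And>v. ?P v \<Longrightarrow> length w \<le> length v"
    unfolding w_def by (metis (mono_tags, lifting) arg_min_nat_lemma)+
  have "reduced_word w"
  proof (rule ccontr)
    assume "\<not> reduced_word w"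
    then obtain u p q v where uv: "w = u @ p # q # v" "\<not> (\<lambda>(s, x) (t, y). \<not> (x = y \<and> s \<noteq> t)) p q"
      using not_successively_split unfolding reduced_word_def by blast
    obtain s t x where p: "p = (s, x)" "q = (t, x)" "s \<noteq> t" using uv(2) by (cases p; cases q) auto
    have sets: "snd ` set u \<subseteq> B" "snd ` set v \<subseteq> B" "x \<in> B" using w uv(1) p by auto
    then have setsF: "snd ` set u \<subseteq> carrier F" "snd ` set v \<subseteq> carrier F" "x \<in> carrier F"
      using Bc by blast+
    have "eval_word F w = eval_word F u \<otimes>\<^bsub>F\<^esub> eval_word F (p # q # v)"
      unfolding uv(1) by (rule F.eval_word_append) (use setsF p in auto)
    also have "eval_word F (p # q # v) = eval_word F v"
      using F.eval_letter_cancel[OF setsF(3) p(3) F.eval_word_closed[OF setsF(2)]] p by simp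
    finally have "?P (u @ v)" using F.eval_word_append[OF setsF(1,2)] w sets by auto
    then show False using min[of "u @ v"] uv(1) by simp
  qed
  then show ?thesis using w by blast
qed

text \<open>Needed for the injectivity of \<open>hom_embed\<close>, without which membership in the
  image of \<open>N\<close> could not be read back in \<open>F\<close>.\<close>

theorem free_basis_residually_symmetric:
  assumes F: "group F" and B: "free_basis F B" and g: "g \<in> carrier F" "g \<noteq> \<one>\<^bsub>F\<^esub>"
  shows "\<exists>m \<ge> 1. \<exists>\<phi> \<in> hom F (sym_group m). \<phi> g \<noteq> id"
proof -
  have Bc: "B \<subseteq> carrier F" using B by (simp add: free_basis_def)
  obtain w where w: "snd ` set w \<subseteq> B" "reduced_word w" "eval_word F w = g"
    using ex_reduced_word[OF F B g(1)] by blast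
  have "w \<noteq> []" using w(3) g(2) group.eval_word_Nil[OF F] by auto
  then obtain \<sigma> where \<sigma>: "\<And>b. \<sigma> b permutes {1..Suc (length w)}"
    "eval_word (sym_group (Suc (length w))) (map (apsnd \<sigma>) w) \<noteq> id"
    using reduced_word_acts_nontrivially[OF w(2)] by blast
  let ?S = "sym_group (Suc (length w))"
  have "\<sigma> \<in> B \<rightarrow> carrier ?S" using \<sigma>(1) by (simp add: sym_group_carrier)
  then obtain \<phi> where \<phi>: "\<phi> \<in> hom F ?S" "\<forall>b \<in> B. \<phi> b = \<sigma> b"
    using free_basis_ex_hom[OF F B sym_group_is_group] by blast
  have "\<phi> g = eval_word ?S (map (apsnd \<phi>) w)"
    using hom_eval_word[OF F sym_group_is_group \<phi>(1)] w Bc by blast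
  also have "map (apsnd \<phi>) w = map (apsnd \<sigma>) w"
    using \<phi>(2) w(1) by (auto simp: apsnd_def)
  finally have "\<phi> g \<noteq> id" using \<sigma>(2) by simp
  then show ?thesis using \<phi>(1) by (intro exI[of _ "Suc (length w)"]) auto
qed

section \<open>The Hamming length\<close>

lemma hamming_length_eq: "p permutes {1..m} \<Longrightarrow> hamming_length m p = card (moved p) / m"
proof -
  assume p: "p permutes {1..m}"
  have "{x \<in> {1..m}. p x \<noteq> x} = moved p" using moved_subset[OF p] by (auto simp: moved_def)
  then show ?thesis by (simp add: hamming_length_def)
qed

lemma hamming_length_id [simp]: "hamming_length m id = 0"
  by (simp add: hamming_length_def)

lemma hamming_length_nonneg: "0 \<le> hamming_length m p"
  by (simp add: hamming_length_def)

lemma hamming_length_comp: "hamming_length m (p \<circ> q) \<le> hamming_length m p + hamming_length m q"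
  if q: "q permutes {1..m}"
proof -
  let ?S = "\<lambda>p. {x \<in> {1..m}. p x \<noteq> x}"
  have "?S (p \<circ> q) \<subseteq> ?S p \<union> ?S q" by auto
  then have "card (?S (p \<circ> q)) \<le> card (?S p \<union> ?S q)" by (intro card_mono) auto
  also have "\<dots> \<le> card (?S p) + card (?S q)" by (rule card_Un_le)
  finally have "real (card (?S (p \<circ> q))) \<le> real (card (?S p) + card (?S q))" by (rule of_nat_mono)
  then show ?thesis
    unfolding hamming_length_def add_divide_distrib[symmetric] of_nat_add by (rule divide_right_mono) simp
qed

lemma hamming_length_conj:
  assumes "c permutes {1..m}"
  shows "hamming_length m (c \<circ> p \<circ> inv' c) = hamming_length m p"
proof -
  have "bij_betw c {x \<in> {1..m}. p x \<noteq> x} {x \<in> {1..m}. (c \<circ> p \<circ> inv' c) x \<noteq> x}"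
  proof (rule bij_betw_byWitness[where f' = "inv' c"])
    show "inv' c ` {x \<in> {1..m}. (c \<circ> p \<circ> inv' c) x \<noteq> x} \<subseteq> {x \<in> {1..m}. p x \<noteq> x}"
    proof safe
      fix x assume x: "x \<in> {1..m}" "(c \<circ> p \<circ> inv' c) x \<noteq> x"
      show "inv' c x \<in> {1..m}" using x(1) permutes_in_image[OF permutes_inv[OF assms]] by blast
      assume "p (inv' c x) = inv' c x"
      then show False using x(2) permutes_inverses(1)[OF assms] by simp
    qed
    show "c ` {x \<in> {1..m}. p x \<noteq> x} \<subseteq> {x \<in> {1..m}. (c \<circ> p \<circ> inv' c) x \<noteq> x}"
    proof safe
      fix x assume x: "x \<in> {1..m}" "p x \<noteq> x"
      show "c x \<in> {1..m}" using x(1) permutes_in_image[OF assms] by blast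
      assume "(c \<circ> p \<circ> inv' c) (c x) = c x"
      then show False using x(2) permutes_inverses(2)[OF assms] inj_eq[OF permutes_inj[OF assms]] by simp
    qed
  qed (use permutes_inverses[OF assms] in auto)
  then show ?thesis unfolding hamming_length_def by (simp add: bij_betw_same_card)
qed

lemma hamming_length_inv:
  assumes "p permutes {1..m}"
  shows "hamming_length m (inv' p) = hamming_length m p"
proof -
  have "{x \<in> {1..m}. inv' p x \<noteq> x} = {x \<in> {1..m}. p x \<noteq> x}"
    using permutes_inv_eq[OF assms] by metis
  then show ?thesis by (simp add: hamming_length_def)
qed

lemma sym_group_hom_facts:
  assumes "group F" "\<phi> \<in> hom F (sym_group m)"
  shows "g \<in> carrier F \<Longrightarrow> \<phi> g permutes {1..m}"
    and "g \<in> carrier F \<Longrightarrow> h \<in> carrier F \<Longrightarrow> \<phi> (g \<otimes>\<^bsub>F\<^esub> h) = \<phi> g \<circ> \<phi> h"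
    and "g \<in> carrier F \<Longrightarrow> \<phi> (inv\<^bsub>F\<^esub> g) = inv' (\<phi> g)"
    and "\<phi> \<one>\<^bsub>F\<^esub> = id"
proof -
  interpret group_hom F "sym_group m" \<phi>
    using assms sym_group_is_group by (simp add: group_hom_def group_hom_axioms_def)
  show "g \<in> carrier F \<Longrightarrow> \<phi> g permutes {1..m}"
    using hom_closed[of g] by (simp add: sym_group_carrier)
  show "g \<in> carrier F \<Longrightarrow> h \<in> carrier F \<Longrightarrow> \<phi> (g \<otimes>\<^bsub>F\<^esub> h) = \<phi> g \<circ> \<phi> h"
    by (simp add: sym_group_mult)
  show "g \<in> carrier F \<Longrightarrow> \<phi> (inv\<^bsub>F\<^esub> g) = inv' (\<phi> g)"
    using hom_closed[of g] by simp
  show "\<phi> \<one>\<^bsub>F\<^esub> = id" by (simp add: sym_group_one)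
qed

section \<open>Homomorphisms from actions, tensor powers and amplification\<close>

text \<open>The action is transported along an enumeration of \<open>D\<close> and extended by the
  identity outside \<open>{1..m}\<close>. The conclusion speaks of the density of fixed points
  because this quantity is multiplicative for product actions.\<close>

lemma sym_group_hom_of_action:
  assumes F: "group F" and D: "finite D" "D \<noteq> {}"
    and act: "\<And>g x. g \<in> carrier F \<Longrightarrow> x \<in> D \<Longrightarrow> \<rho> g x \<in> D"
    and mult: "\<And>g h x. g \<in> carrier F \<Longrightarrow> h \<in> carrier F \<Longrightarrow> x \<in> D \<Longrightarrow> \<rho> (g \<otimes>\<^bsub>F\<^esub> h) x = \<rho> g (\<rho> h x)"
    and one: "\<And>x. x \<in> D \<Longrightarrow> \<rho> \<one>\<^bsub>F\<^esub> x = x"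
  shows "\<exists>\<phi> \<in> hom F (sym_group (card D)). \<forall>g \<in> carrier F.
    1 - hamming_length (card D) (\<phi> g) = card {x \<in> D. \<rho> g x = x} / card D"
proof -
  interpret F: group F by fact
  define m where "m = card D"
  have m: "m > 0" using D by (simp add: m_def card_gt_0_iff)
  obtain e where e: "bij_betw e {1..m} D" using ex_bij_betw_nat_finite_1[OF D(1)] by (auto simp: m_def)
  define d where "d = inv_into {1..m} e"
  have eD: "e i \<in> D" if "i \<in> {1..m}" for i using e that by (auto simp: bij_betw_def)
  have dm: "d x \<in> {1..m}" if "x \<in> D" for x
    using that e unfolding d_def by (metis bij_betw_def inv_into_into)
  have ed: "e (d x) = x" if "x \<in> D" for x
    using that e unfolding d_def by (simp add: bij_betw_inv_into_right)
  have de: "d (e i) = i" if "i \<in> {1..m}" for i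
    using that e unfolding d_def by (simp add: bij_betw_inv_into_left)
  define \<phi> where "\<phi> g i = (if i \<in> {1..m} then d (\<rho> g (e i)) else i)" for g i
  have in_m: "\<phi> g i \<in> {1..m}" if "g \<in> carrier F" "i \<in> {1..m}" for g i
    using that by (simp only: \<phi>_def if_True) (intro dm act eD)
  have comp: "\<phi> (g \<otimes>\<^bsub>F\<^esub> h) = \<phi> g \<circ> \<phi> h" if gh: "g \<in> carrier F" "h \<in> carrier F" for g h
  proof
    fix i
    show "\<phi> (g \<otimes>\<^bsub>F\<^esub> h) i = (\<phi> g \<circ> \<phi> h) i"
    proof (cases "i \<in> {1..m}")
      case True
      then have "\<phi> (g \<otimes>\<^bsub>F\<^esub> h) i = d (\<rho> g (\<rho> h (e i)))" using mult[OF gh eD] by (simp only: \<phi>_def if_True)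
      moreover have "e (\<phi> h i) = \<rho> h (e i)" using True ed[OF act[OF gh(2) eD]] by (simp only: \<phi>_def if_True)
      moreover have "\<phi> g (\<phi> h i) = d (\<rho> g (e (\<phi> h i)))" using in_m[OF gh(2) True] by (simp only: \<phi>_def if_True)
      ultimately show ?thesis by simp
    next
      case False
      then show ?thesis by (simp only: \<phi>_def if_False comp_apply)
    qed
  qed
  have \<phi>1: "\<phi> \<one>\<^bsub>F\<^esub> = id"
  proof
    fix i show "\<phi> \<one>\<^bsub>F\<^esub> i = id i"
      using one[OF eD] de by (cases "i \<in> {1..m}") (simp_all only: \<phi>_def if_True if_False id_apply)
  qed
  have perm: "\<phi> g permutes {1..m}" if g: "g \<in> carrier F" for g
  proof -
    have "\<phi> g \<circ> \<phi> (inv\<^bsub>F\<^esub> g) = id" "\<phi> (inv\<^bsub>F\<^esub> g) \<circ> \<phi> g = id"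
      using comp[symmetric] g \<phi>1 by (simp_all only: F.inv_closed F.r_inv F.l_inv)
    then have "bij (\<phi> g)" using o_bij by blast
    moreover have "\<phi> g x = x" if "x \<notin> {1..m}" for x using that by (simp only: \<phi>_def if_False)
    ultimately show ?thesis by (auto simp: permutes_def bij_iff)
  qed
  have "\<phi> \<in> hom F (sym_group m)"
    using perm comp by (intro homI) (simp_all add: sym_group_carrier sym_group_mult)
  moreover have "1 - hamming_length m (\<phi> g) = card {x \<in> D. \<rho> g x = x} / m" if g: "g \<in> carrier F" for g
  proof -
    let ?A = "{i \<in> {1..m}. \<phi> g i = i}" and ?B = "{i \<in> {1..m}. \<phi> g i \<noteq> i}"
    have "bij_betw e ?A {x \<in> D. \<rho> g x = x}"
    proof (rule bij_betw_byWitness[where f' = d])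
      show "e ` ?A \<subseteq> {x \<in> D. \<rho> g x = x}"
      proof safe
        fix i assume i: "i \<in> {1..m}" "\<phi> g i = i"
        show "e i \<in> D" using eD[OF i(1)] .
        have "d (\<rho> g (e i)) = i" using i by (simp only: \<phi>_def if_True)
        then show "\<rho> g (e i) = e i" using ed[OF act[OF g eD[OF i(1)]]] by simp
      qed
      show "d ` {x \<in> D. \<rho> g x = x} \<subseteq> ?A"
        using dm ed by (auto simp: \<phi>_def)
    qed (use de ed in auto)
    then have "card ?A = card {x \<in> D. \<rho> g x = x}" by (rule bij_betw_same_card)
    moreover have "card ?A + card ?B = m"
    proof -
      have "card (?A \<union> ?B) = card ?A + card ?B" by (rule card_Un_disjoint) auto
      moreover have "?A \<union> ?B = {1..m}" by auto
      ultimately show ?thesis by simp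
    qed
    then have "real (card ?A) = real m - real (card ?B)" by linarith
    ultimately show ?thesis using m by (simp add: hamming_length_def diff_divide_distrib)
  qed
  ultimately show ?thesis unfolding m_def by blast
qed

text \<open>For the diagonal action on pairs the set of fixed points of \<open>g\<close> is the
  product of the two sets of fixed points.\<close>

lemma ex_tensor_hom:
  assumes F: "group F" and ab: "a \<ge> 1" "b \<ge> 1"
    and \<phi>: "\<phi> \<in> hom F (sym_group a)" and \<psi>: "\<psi> \<in> hom F (sym_group b)"
  shows "\<exists>\<chi> \<in> hom F (sym_group (a * b)). \<forall>g \<in> carrier F. 1 - hamming_length (a * b) (\<chi> g) =
    (1 - hamming_length a (\<phi> g)) * (1 - hamming_length b (\<psi> g))"
proof -
  note \<phi>f = sym_group_hom_facts[OF F \<phi>] and \<psi>f = sym_group_hom_facts[OF F \<psi>]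
  let ?D = "{1..a} \<times> {1..b}"
  define \<rho> where "\<rho> g = map_prod (\<phi> g) (\<psi> g)" for g
  have cD: "card ?D = a * b" by simp
  have fixed: "1 - hamming_length c p = card {x \<in> {1..c}. p x = x} / c" if "c \<ge> 1" for c p
  proof -
    let ?A = "{i \<in> {1..c}. p i = i}" and ?B = "{i \<in> {1..c}. p i \<noteq> i}"
    have "card (?A \<union> ?B) = card ?A + card ?B" by (rule card_Un_disjoint) auto
    moreover have "?A \<union> ?B = {1..c}" by auto
    ultimately have "real (card ?A) = real c - real (card ?B)" by simp
    then show ?thesis using that by (simp add: hamming_length_def diff_divide_distrib)
  qed
  have "\<exists>\<chi> \<in> hom F (sym_group (card ?D)). \<forall>g \<in> carrier F.
    1 - hamming_length (card ?D) (\<chi> g) = card {x \<in> ?D. \<rho> g x = x} / card ?D"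
  proof (rule sym_group_hom_of_action[OF F])
    show "\<rho> g x \<in> ?D" if "g \<in> carrier F" "x \<in> ?D" for g x
      using that permutes_in_image[OF \<phi>f(1)] permutes_in_image[OF \<psi>f(1)]
      by (cases x) (simp add: \<rho>_def)
    show "\<rho> (g \<otimes>\<^bsub>F\<^esub> h) x = \<rho> g (\<rho> h x)" if "g \<in> carrier F" "h \<in> carrier F" for g h x
      using that by (cases x) (simp add: \<rho>_def \<phi>f(2) \<psi>f(2))
    show "\<rho> \<one>\<^bsub>F\<^esub> x = x" for x by (cases x) (simp add: \<rho>_def \<phi>f(4) \<psi>f(4))
  qed (use ab in auto)
  then obtain \<chi> where \<chi>: "\<chi> \<in> hom F (sym_group (a * b))"
    "\<And>g. g \<in> carrier F \<Longrightarrow> 1 - hamming_length (a * b) (\<chi> g) = card {x \<in> ?D. \<rho> g x = x} / (a * b)"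
    unfolding cD by auto
  have "1 - hamming_length (a * b) (\<chi> g) = (1 - hamming_length a (\<phi> g)) * (1 - hamming_length b (\<psi> g))"
    if g: "g \<in> carrier F" for g
  proof -
    have "{x \<in> ?D. \<rho> g x = x} = {x \<in> {1..a}. \<phi> g x = x} \<times> {x \<in> {1..b}. \<psi> g x = x}"
      by (auto simp: \<rho>_def)
    then have "card {x \<in> ?D. \<rho> g x = x} = card {x \<in> {1..a}. \<phi> g x = x} * card {x \<in> {1..b}. \<psi> g x = x}"
      by (simp only: card_cartesian_product)
    then show ?thesis unfolding \<chi>(2)[OF g] fixed[OF ab(1)] fixed[OF ab(2)] by simp
  qed
  then show ?thesis using \<chi>(1) by blast
qed

lemma hamming_length_le_1: "hamming_length m p \<le> 1"
proof -
  have "card {x \<in> {1..m}. p x \<noteq> x} \<le> card {1..m}" by (rule card_mono) auto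
  then show ?thesis by (auto simp: hamming_length_def divide_le_eq_1)
qed

lemma ex_tensor_power_hom:
  assumes F: "group F" and m: "m \<ge> 1" and \<phi>: "\<phi> \<in> hom F (sym_group m)"
  shows "\<exists>l \<ge> 1. \<exists>\<chi> \<in> hom F (sym_group l). \<forall>g \<in> carrier F. 1 - hamming_length l (\<chi> g) = (1 - hamming_length m (\<phi> g)) ^ k"
proof (induction k)
  case 0
  have "(\<lambda>_. id) \<in> hom F (sym_group 1)"
    by (intro homI) (auto simp: sym_group_carrier sym_group_mult permutes_id)
  then show ?case by (intro exI[of _ 1]) (auto intro!: bexI[of _ "\<lambda>_. id"])
next
  case (Suc k)
  then obtain l \<chi> where l: "l \<ge> 1" "\<chi> \<in> hom F (sym_group l)"
    "\<And>g. g \<in> carrier F \<Longrightarrow> 1 - hamming_length l (\<chi> g) = (1 - hamming_length m (\<phi> g)) ^ k" by blast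
  obtain \<chi>' where "\<chi>' \<in> hom F (sym_group (m * l))"
    "\<And>g. g \<in> carrier F \<Longrightarrow> 1 - hamming_length (m * l) (\<chi>' g) = (1 - hamming_length m (\<phi> g)) * (1 - hamming_length l (\<chi> g))"
    using ex_tensor_hom[OF F m l(1) \<phi> l(2)] by blast
  then show ?case using l m by (intro exI[of _ "m * l"]) auto
qed

text \<open>With \<open>x\<close> the length of \<open>\<phi> w\<close>, the tensor power of order
  \<open>p\<close>, where \<open>1/x \<le> p \<le> 2/x\<close>, is taken. Bernoulli gives
  \<open>(1 + x) ^ p \<ge> 2\<close>, and \<open>(1 - x) ^ p * (1 + x) ^ p \<le> 1\<close> then
  bounds the fixed points of \<open>w\<close> by one half. For \<open>n \<in> E\<close> Bernoulli
  bounds the new length by \<open>p\<close> times the old one, hence by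
  \<open>(2 / x) * (x / k)\<close>.\<close>

lemma ex_amplified_hom:
  assumes F: "group F" and m: "m \<ge> 1" and \<phi>: "\<phi> \<in> hom F (sym_group m)"
    and w: "w \<in> carrier F" and k: "k > 0"
    and E: "\<And>n. n \<in> E \<Longrightarrow> n \<in> carrier F \<and> k * hamming_length m (\<phi> n) < hamming_length m (\<phi> w)" "E \<noteq> {}"
  shows "\<exists>l \<ge> 1. \<exists>\<chi> \<in> hom F (sym_group l). hamming_length l (\<chi> w) \<ge> 1/2 \<and> (\<forall>n \<in> E. hamming_length l (\<chi> n) \<le> 2 / k)"
proof -
  define x where "x = hamming_length m (\<phi> w)"
  \<comment> \<open>Any element of \<open>E\<close> shows \<open>x > 0\<close> through the strict
    inequality; this is where \<open>E\<close> must be nonempty.\<close>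
  obtain n0 where "n0 \<in> E" using E(2) by blast
  have "0 \<le> k * hamming_length m (\<phi> n0)" using k hamming_length_nonneg by simp
  also have "\<dots> < x" using E(1)[OF \<open>n0 \<in> E\<close>] by (simp add: x_def)
  finally have x0: "x > 0" .
  have x1: "x \<le> 1" by (simp add: x_def hamming_length_le_1)
  define p where "p = nat \<lceil>1 / x\<rceil>"
  have p: "real p \<ge> 1 / x" "real p \<le> 2 / x"
  proof -
    have pos: "1 / x \<ge> 1" using x0 x1 by simp
    then show "real p \<ge> 1 / x" unfolding p_def by linarith
    have "real p \<le> 1 / x + 1" unfolding p_def using pos by linarith
    also have "\<dots> \<le> 2 / x" using pos by simp
    finally show "real p \<le> 2 / x" .
  qed
  obtain l \<chi> where l: "l \<ge> 1" "\<chi> \<in> hom F (sym_group l)"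
    "\<And>g. g \<in> carrier F \<Longrightarrow> 1 - hamming_length l (\<chi> g) = (1 - hamming_length m (\<phi> g)) ^ p"
    using ex_tensor_power_hom[OF F m \<phi>, of p] by blast
  have "(1 + x) ^ p \<ge> 1 + real p * x" using x0 by (intro Bernoulli_inequality) simp
  moreover have "real p * x \<ge> 1" using p(1) x0 by (simp add: field_simps)
  ultimately have two: "(1 + x) ^ p \<ge> 2" by simp
  have "(1 - x) ^ p * (1 + x) ^ p \<le> 1"
  proof -
    have "(1 - x) * (1 + x) = 1 - x * x" by (simp add: algebra_simps)
    then have "(1 - x) * (1 + x) \<le> 1" by simp
    moreover have "0 \<le> (1 - x) * (1 + x)" using x0 x1 by (intro mult_nonneg_nonneg) simp_all
    ultimately
    show ?thesis unfolding power_mult_distrib[symmetric] by (intro power_le_one)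
  qed
  moreover have "(1 - x) ^ p * 2 \<le> (1 - x) ^ p * (1 + x) ^ p"
    using two x1 by (intro mult_left_mono) simp_all
  ultimately have "(1 - x) ^ p \<le> 1 / 2" by simp
  then have "hamming_length l (\<chi> w) \<ge> 1 / 2" using l(3)[OF w] by (simp add: x_def)
  moreover have "hamming_length l (\<chi> n) \<le> 2 / k" if "n \<in> E" for n
  proof -
    define y where "y = hamming_length m (\<phi> n)"
    have y: "0 \<le> y" "y \<le> 1" "k * y < x"
      using E(1)[OF that] by (simp_all add: x_def y_def hamming_length_nonneg hamming_length_le_1)
    have "1 + real p * (- y) \<le> (1 + - y) ^ p" using y by (intro Bernoulli_inequality) simp
    then have "hamming_length l (\<chi> n) \<le> real p * y" using l(3)[of n] E(1)[OF that] by (simp add: y_def)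
    also have "\<dots> \<le> (2 / x) * (x / k)"
    proof (rule mult_mono)
      show "y \<le> x / k" using y(3) k by (simp add: pos_le_divide_eq mult.commute)
    qed (use p(2) x0 y(1) in auto)
    also have "\<dots> = 2 / k" using x0 by simp
    finally show ?thesis .
  qed
  ultimately show ?thesis using l(1,2) by blast
qed

section \<open>Passing to even permutations by doubling\<close>

text \<open>Two side by side copies of \<open>p\<close>, on \<open>{1..m}\<close> and on its
  translate by \<open>m\<close>. This squares the sign and keeps the proportion of moved
  points.\<close>

definition double_perm :: "nat \<Rightarrow> (nat \<Rightarrow> nat) \<Rightarrow> nat \<Rightarrow> nat" where
  "double_perm m p x = (if x \<le> m then p x else p (x - m) + m)"

lemma double_perm:
  assumes p: "p permutes {1..m}"
  shows "double_perm m p \<in> carrier (alt_group (2 * m))"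
    and "hamming_length (2 * m) (double_perm m p) = hamming_length m p"
    and "q permutes {1..m} \<Longrightarrow> double_perm m (p \<circ> q) = double_perm m p \<circ> double_perm m q"
proof -
  let ?s = "\<lambda>x. x + m"
  have inj: "inj_on ?s {1..m}" by (auto simp: inj_on_def)
  let ?q = "map_permutation {1..m} ?s p"
  have im: "?s ` {1..m} = {m+1..2*m}" by (auto simp: image_iff intro!: bexI[of _ "_ - m"])
  have qp: "?q permutes {m+1..2*m}"
    using map_permutation_permutes[OF bij_betw_imageI[OF inj im] p] .
  have low: "p x \<le> m" if "x \<le> m" for x
    using that p permutes_in_image[OF p, of x] permutes_not_in[OF p, of x] by (cases "x \<in> {1..m}") auto
  have ge: "p x \<ge> 1" if "x \<ge> 1" for x
    using that p permutes_in_image[OF p, of x] permutes_not_in[OF p, of x] by (cases "x \<in> {1..m}") auto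
  \<comment> \<open>The second copy is a translate of \<open>p\<close> with the same parity, so the
    composition is even.\<close>
  have eq: "double_perm m p = p \<circ> ?q"
  proof
    fix x
    consider "x \<le> m" | "x \<in> {m+1..2*m}" | "x > 2 * m" by force
    then show "double_perm m p x = (p \<circ> ?q) x"
    proof cases
      case 1
      then show ?thesis using permutes_not_in[OF qp, of x] by (simp add: double_perm_def)
    next
      case 2
      then obtain y where y: "x = y + m" "y \<in> {1..m}" using im by blast
      then have "?q x = p y + m" using map_permutation_apply[OF inj y(2), of p] by simp
      moreover have "p (p y + m) = p y + m" using ge[of y] y by (intro permutes_not_in[OF p]) simp
      ultimately show ?thesis using y by (simp add: double_perm_def)
    next
      case 3
      then have out: "x \<notin> {m+1..2*m}" "x \<notin> {1..m}" "x - m \<notin> {1..m}" by auto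
      note permutes_not_in[OF qp out(1)] permutes_not_in[OF p out(2)] permutes_not_in[OF p out(3)]
      then show ?thesis using 3 by (simp add: double_perm_def)
    qed
  qed
  have "evenperm (p \<circ> ?q)"
    using evenperm_comp[OF permutes_imp_permutation[OF _ p] permutes_imp_permutation[OF _ qp]]
      evenperm_map_permutation[OF inj p] by simp
  moreover have "p \<circ> ?q permutes {1..2*m}"
    by (intro permutes_compose permutes_subset[OF p] permutes_subset[OF qp]) auto
  ultimately show "double_perm m p \<in> carrier (alt_group (2 * m))"
    by (simp only: eq alt_group_carrier)
  show "double_perm m (p \<circ> q) = double_perm m p \<circ> double_perm m q" if q: "q permutes {1..m}"
  proof
    fix x
    have up: "q x \<le> m" if "x \<le> m" for x
      using that q permutes_in_image[OF q, of x] permutes_not_in[OF q, of x] by (cases "x \<in> {1..m}") auto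
    have low: "q x \<ge> 1" if "x \<ge> 1" for x
      using that q permutes_in_image[OF q, of x] permutes_not_in[OF q, of x] by (cases "x \<in> {1..m}") auto
    show "double_perm m (p \<circ> q) x = (double_perm m p \<circ> double_perm m q) x"
    proof (cases "x \<le> m")
      case True
      then show ?thesis using up[OF True] by (simp add: double_perm_def)
    next
      case False
      then have "\<not> q (x - m) + m \<le> m" using low[of "x - m"] by linarith
      then show ?thesis using False by (simp add: double_perm_def)
    qed
  qed
  have "{x \<in> {1..2*m}. double_perm m p x \<noteq> x} = {x \<in> {1..m}. p x \<noteq> x} \<union> ?s ` {x \<in> {1..m}. p x \<noteq> x}"
  proof (intro equalityI subsetI)
    fix x assume x: "x \<in> {x \<in> {1..2*m}. double_perm m p x \<noteq> x}"
    show "x \<in> {x \<in> {1..m}. p x \<noteq> x} \<union> ?s ` {x \<in> {1..m}. p x \<noteq> x}"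
    proof (cases "x \<le> m")
      case False
      then have "x - m \<in> {x \<in> {1..m}. p x \<noteq> x}" using x by (auto simp: double_perm_def)
      then show ?thesis using False by (intro UnI2 image_eqI[of _ _ "x - m"]) auto
    qed (use x in \<open>auto simp: double_perm_def\<close>)
  qed (auto simp: double_perm_def)
  moreover have "card ({x \<in> {1..m}. p x \<noteq> x} \<union> ?s ` {x \<in> {1..m}. p x \<noteq> x}) = 2 * card {x \<in> {1..m}. p x \<noteq> x}"
    by (subst card_Un_disjoint) (auto simp: card_image inj_on_def)
  ultimately show "hamming_length (2 * m) (double_perm m p) = hamming_length m p"
    by (simp add: hamming_length_def)
qed

lemma ex_double_hom:
  assumes F: "group F" and \<phi>: "\<phi> \<in> hom F (sym_group m)"
  shows "\<exists>\<chi> \<in> hom F (alt_group (2 * m)). \<forall>g \<in> carrier F. hamming_length (2 * m) (\<chi> g) = hamming_length m (\<phi> g)"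
proof
  note \<phi>f = sym_group_hom_facts[OF F \<phi>]
  show "(\<lambda>g. double_perm m (\<phi> g)) \<in> hom F (alt_group (2 * m))"
    by (intro homI double_perm(1)) (simp_all only: \<phi>f double_perm(3)[OF \<phi>f(1) \<phi>f(1)] alt_group_mult)
  show "\<forall>g \<in> carrier F. hamming_length (2 * m) (double_perm m (\<phi> g)) = hamming_length m (\<phi> g)"
    using double_perm(2)[OF \<phi>f(1)] by blast
qed

section \<open>Normal closures in the product\<close>

text \<open>Both equivalences are proved at once. Beyond the elementary facts about
  \<open>H\<close>, the two cases part only over signs, in
  \<open>evenperm_if_small_kernel\<close>.\<close>

locale perm_family =
  fixes H :: "nat \<Rightarrow> (nat \<Rightarrow> nat) monoid"
  assumes H_cases: "H = alt_group \<or> H = sym_group"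
begin

lemma H_group: "group (H m)"
  using H_cases alt_group_is_group sym_group_is_group by auto

lemma H_mult: "p \<otimes>\<^bsub>H m\<^esub> q = p \<circ> q"
  using H_cases by (auto simp: alt_group_mult sym_group_mult)

lemma H_one: "\<one>\<^bsub>H m\<^esub> = id"
  using H_cases by (auto simp: alt_group_one sym_group_one)

lemma H_inv: "p \<in> carrier (H m) \<Longrightarrow> inv\<^bsub>H m\<^esub> p = inv' p"
  using H_cases alt_group_inv_equality sym_group_inv_equality by auto

lemma H_permutes: "p \<in> carrier (H m) \<Longrightarrow> p permutes {1..m}"
  using H_cases alt_group_carrier sym_group_carrier by auto

lemma alt_subset_H: "p \<in> carrier (alt_group m) \<Longrightarrow> p \<in> carrier (H m)"
  using H_cases alt_group_carrier sym_group_carrier by auto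

lemma H_hom_sym: "\<phi> \<in> hom F (H m) \<Longrightarrow> \<phi> \<in> hom F (sym_group m)"
  using H_permutes by (auto simp: hom_def H_mult sym_group_mult sym_group_carrier Pi_iff)

lemma conj_prods_in_H:
  assumes h: "h \<in> carrier (H m)"
  shows "p \<in> conj_prods m h n \<Longrightarrow> p \<in> carrier (H m)"
proof (induction n arbitrary: p)
  case 0
  then have "p = id" unfolding conj_prods.simps by (rule singletonD)
  then show ?case by (simp only: alt_subset_H[OF alt_id])
next
  case (Suc n)
  interpret Hm: group "H m" by (rule H_group)
  obtain r a b where p: "p = r \<circ> (a \<circ> h \<circ> inv' a) \<circ> (b \<circ> inv' h \<circ> inv' b)" and r: "r \<in> conj_prods m h n"
    and ab: "a \<in> carrier (alt_group m)" "b \<in> carrier (alt_group m)"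
    using Suc.prems by auto
  note abH = ab[THEN alt_subset_H]
  have "p = r \<otimes>\<^bsub>H m\<^esub> (a \<otimes>\<^bsub>H m\<^esub> h \<otimes>\<^bsub>H m\<^esub> inv\<^bsub>H m\<^esub> a) \<otimes>\<^bsub>H m\<^esub> (b \<otimes>\<^bsub>H m\<^esub> inv\<^bsub>H m\<^esub> h \<otimes>\<^bsub>H m\<^esub> inv\<^bsub>H m\<^esub> b)"
    unfolding p H_mult H_inv[OF h] H_inv[OF abH(1)] H_inv[OF abH(2)] ..
  then show ?case using Suc.IH[OF r] h abH by simp
qed

lemma hom_product_eq: "hom_product F H = product_group (hom_index F H) (\<lambda>i. H (fst i))"
  by (simp add: hom_product_def case_prod_unfold)

lemma group_hom_product: "group (hom_product F H)"
  unfolding hom_product_eq by (intro product_group H_group)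

lemma hom_embed_apply: "i \<in> hom_index F H \<Longrightarrow> hom_embed F H w i = snd i w"
  by (simp add: hom_embed_def case_prod_unfold)

lemma hom_indexD:
  assumes "i \<in> hom_index F H"
  shows "1 \<le> fst i" "snd i \<in> hom F (H (fst i))"
  using assms by (auto simp: hom_index_def)

lemma hom_embed_closed: "w \<in> carrier F \<Longrightarrow> hom_embed F H w \<in> carrier (hom_product F H)"
proof -
  assume w: "w \<in> carrier F"
  have "snd i w \<in> carrier (H (fst i))" if "i \<in> hom_index F H" for i
    using hom_indexD(2)[OF that] w by (auto simp: hom_def)
  then show ?thesis
    by (auto simp: hom_product_eq hom_embed_def case_prod_unfold)
qed

lemma hom_index_hom:
  assumes "group F" "m \<ge> 1" "\<phi> \<in> hom F (H m)"
  shows "(m, restrict \<phi> (carrier F)) \<in> hom_index F H"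
proof -
  interpret group F by fact
  show ?thesis using assms by (auto simp: hom_index_def hom_def)
qed

lemma hom_product_apply:
  assumes "i \<in> hom_index F H"
  shows "f \<in> carrier (hom_product F H) \<Longrightarrow> f i \<in> carrier (H (fst i))"
    and "(f \<otimes>\<^bsub>hom_product F H\<^esub> g) i = f i \<circ> g i"
    and "f \<in> carrier (hom_product F H) \<Longrightarrow> (inv\<^bsub>hom_product F H\<^esub> f) i = inv' (f i)"
    and "\<one>\<^bsub>hom_product F H\<^esub> i = id"
proof -
  show f: "f \<in> carrier (hom_product F H) \<Longrightarrow> f i \<in> carrier (H (fst i))"
    using assms by (auto simp: hom_product_eq)
  show "(f \<otimes>\<^bsub>hom_product F H\<^esub> g) i = f i \<circ> g i" "\<one>\<^bsub>hom_product F H\<^esub> i = id"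
    using assms by (simp_all add: hom_product_eq H_mult H_one)
  show "f \<in> carrier (hom_product F H) \<Longrightarrow> (inv\<^bsub>hom_product F H\<^esub> f) i = inv' (f i)"
    using f H_inv[of "f i" "fst i"] assms
    by (auto simp: hom_product_eq inv_product_group[OF _ H_group])
qed

text \<open>The functions whose Hamming lengths are dominated by those of finitely many elements of \<open>N\<close>
  form a normal subgroup.\<close>

lemma normal_closure_hamming_bound:
  assumes F: "group F" and N: "N \<subseteq> carrier F"
    and f: "f \<in> normal_closure (hom_product F H) (hom_embed F H ` N)"
  shows "\<exists>(c::real) E. c \<ge> 0 \<and> finite E \<and> E \<subseteq> N \<and>
    (\<forall>i \<in> hom_index F H. hamming_length (fst i) (f i) \<le> c * (\<Sum>n \<in> E. hamming_length (fst i) (snd i n)))"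
proof -
  let ?P = "hom_product F H" and ?I = "hom_index F H"
  interpret P: group ?P by (rule group_hom_product)
  define S where "S i E = (\<Sum>n \<in> E. hamming_length (fst i) (snd i n))" for i and E :: "'a set"
  have S_mono: "S i E \<le> S i E'" if "finite E'" "E \<subseteq> E'" for i E E'
    unfolding S_def using that by (intro sum_mono2) (auto simp: hamming_length_nonneg)
  have S_nonneg: "0 \<le> S i E" for i E
    unfolding S_def by (intro sum_nonneg hamming_length_nonneg)
  \<comment> \<open>The constant \<open>c\<close> and the set \<open>E\<close> depend on
    \<open>f\<close> but serve all coordinates simultaneously. Under products the constants add and
    the finite sets unite.\<close>
  define Q where "Q f c E \<longleftrightarrow> c \<ge> 0 \<and> finite E \<and> E \<subseteq> N \<and>
    (\<forall>i \<in> ?I. hamming_length (fst i) (f i) \<le> c * S i E)" for f and c :: real and E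
  define K where "K = {f \<in> carrier ?P. \<exists>c E. Q f c E}"
  have perm: "f i permutes {1..fst i}" if "f \<in> carrier ?P" "i \<in> ?I" for f i
    using that H_permutes hom_product_apply(1) by blast
  have "subgroup K ?P"
  proof
    show "K \<subseteq> carrier ?P" by (auto simp: K_def)
    show "\<one>\<^bsub>?P\<^esub> \<in> K"
      unfolding K_def Q_def using P.one_closed
      by (auto simp: hom_product_apply(4) intro!: exI[of _ "0 :: real"] exI[of _ "{}"])
  next
    fix f g assume "f \<in> K" "g \<in> K"
    then obtain c d E E' where fg: "f \<in> carrier ?P" "g \<in> carrier ?P" and Q: "Q f c E" "Q g d E'"
      by (auto simp: K_def)
    have "hamming_length (fst i) ((f \<otimes>\<^bsub>?P\<^esub> g) i) \<le> (c + d) * S i (E \<union> E')" if i: "i \<in> ?I" for i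
    proof -
      have "hamming_length (fst i) ((f \<otimes>\<^bsub>?P\<^esub> g) i) \<le> hamming_length (fst i) (f i) + hamming_length (fst i) (g i)"
        unfolding hom_product_apply(2)[OF i] by (intro hamming_length_comp perm fg i)
      also have "\<dots> \<le> c * S i E + d * S i E'" using Q i by (intro add_mono) (auto simp: Q_def)
      also have "\<dots> \<le> c * S i (E \<union> E') + d * S i (E \<union> E')"
        using Q by (intro add_mono mult_left_mono S_mono) (auto simp: Q_def)
      finally show ?thesis by (simp add: distrib_right)
    qed
    then have "Q (f \<otimes>\<^bsub>?P\<^esub> g) (c + d) (E \<union> E')" using Q by (auto simp: Q_def)
    then show "f \<otimes>\<^bsub>?P\<^esub> g \<in> K" using fg by (auto simp: K_def)
  next
    fix f assume "f \<in> K"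
    then obtain c E where f: "f \<in> carrier ?P" and Q: "Q f c E" by (auto simp: K_def)
    have "Q (inv\<^bsub>?P\<^esub> f) c E"
      using Q f hamming_length_inv[OF perm[OF f]] by (auto simp: Q_def hom_product_apply(3))
    then show "inv\<^bsub>?P\<^esub> f \<in> K" using f by (auto simp: K_def)
  qed
  moreover have "x \<otimes>\<^bsub>?P\<^esub> f \<otimes>\<^bsub>?P\<^esub> inv\<^bsub>?P\<^esub> x \<in> K" if x: "x \<in> carrier ?P" and "f \<in> K" for x f
  proof -
    obtain c E where f: "f \<in> carrier ?P" and Q: "Q f c E" using \<open>f \<in> K\<close> by (auto simp: K_def)
    have "hamming_length (fst i) ((x \<otimes>\<^bsub>?P\<^esub> f \<otimes>\<^bsub>?P\<^esub> inv\<^bsub>?P\<^esub> x) i) = hamming_length (fst i) (f i)"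
      if i: "i \<in> ?I" for i
      unfolding hom_product_apply(2)[OF i] hom_product_apply(3)[OF i x]
      by (rule hamming_length_conj) (rule perm[OF x i])
    then have "Q (x \<otimes>\<^bsub>?P\<^esub> f \<otimes>\<^bsub>?P\<^esub> inv\<^bsub>?P\<^esub> x) c E" using Q by (auto simp: Q_def)
    then show ?thesis using f x by (auto simp: K_def)
  qed
  ultimately have "K \<lhd> ?P" by (simp add: P.normal_inv_iff)
  moreover have "hom_embed F H ` N \<subseteq> K"
  proof safe
    fix n assume n: "n \<in> N"
    have "Q (hom_embed F H n) 1 {n}" using n by (auto simp: Q_def S_def hom_embed_apply)
    then show "hom_embed F H n \<in> K" using hom_embed_closed[of n F] n N by (auto simp: K_def)
  qed
  ultimately have "f \<in> K" using f by (auto simp: normal_closure_def)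
  then show ?thesis unfolding K_def Q_def S_def by blast
qed

text \<open>Conjugators chosen coordinate by coordinate assemble to elements of the unrestricted
  product, so each factor peeled off \<open>f\<close> is a single conjugate of \<open>n\<close>
  times a single conjugate of its inverse. This works because \<open>k\<close> is the same for all
  coordinates.\<close>

lemma normal_contains_conj_prods:
  assumes F: "group F" and M: "M \<lhd> hom_product F H" and n: "n \<in> carrier F" "hom_embed F H n \<in> M"
  shows "f \<in> carrier (hom_product F H) \<Longrightarrow>
    (\<And>i. i \<in> hom_index F H \<Longrightarrow> f i \<in> conj_prods (fst i) (snd i n) k) \<Longrightarrow> f \<in> M"
proof (induction k arbitrary: f)
  case 0
  let ?P = "hom_product F H"
  interpret P: group ?P by (rule group_hom_product)
  interpret M: normal M ?P by fact
  have "f = \<one>\<^bsub>?P\<^esub>"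
  proof (rule PiE_ext)
    show "f \<in> (\<Pi>\<^sub>E i \<in> hom_index F H. carrier (H (fst i)))" "\<one>\<^bsub>?P\<^esub> \<in> (\<Pi>\<^sub>E i \<in> hom_index F H. carrier (H (fst i)))"
      using 0(1) P.one_closed by (simp_all add: hom_product_eq)
    show "f i = \<one>\<^bsub>?P\<^esub> i" if "i \<in> hom_index F H" for i
      using 0(2)[OF that] hom_product_apply(4)[OF that] by simp
  qed
  then show ?case by simp
next
  case (Suc k)
  let ?P = "hom_product F H" and ?I = "hom_index F H"
  interpret P: group ?P by (rule group_hom_product)
  interpret M: normal M ?P by fact
  let ?e = "hom_embed F H n"
  have e: "?e \<in> carrier ?P" using hom_embed_closed n(1) .
  have "\<forall>i \<in> ?I. \<exists>t. fst t \<in> conj_prods (fst i) (snd i n) k \<and> fst (snd t) \<in> carrier (alt_group (fst i)) \<and>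
      snd (snd t) \<in> carrier (alt_group (fst i)) \<and>
      f i = fst t \<circ> (fst (snd t) \<circ> snd i n \<circ> inv' (fst (snd t))) \<circ> (snd (snd t) \<circ> inv' (snd i n) \<circ> inv' (snd (snd t)))"
    using Suc.prems(2) by fastforce
  then obtain t where t: "\<forall>i \<in> ?I. fst (t i) \<in> conj_prods (fst i) (snd i n) k \<and> fst (snd (t i)) \<in> carrier (alt_group (fst i)) \<and>
      snd (snd (t i)) \<in> carrier (alt_group (fst i)) \<and>
      f i = fst (t i) \<circ> (fst (snd (t i)) \<circ> snd i n \<circ> inv' (fst (snd (t i)))) \<circ> (snd (snd (t i)) \<circ> inv' (snd i n) \<circ> inv' (snd (snd (t i))))"
    by (rule bchoice[THEN exE])
  define p where "p = (\<lambda>i \<in> ?I. fst (t i))"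
  define a where "a = (\<lambda>i \<in> ?I. fst (snd (t i)))"
  define b where "b = (\<lambda>i \<in> ?I. snd (snd (t i)))"
  have eH: "snd i n \<in> carrier (H (fst i))" if "i \<in> ?I" for i
    using hom_product_apply(1)[OF that e] hom_embed_apply[OF that] by simp
  have pP: "p \<in> carrier ?P"
    unfolding hom_product_eq p_def using t conj_prods_in_H[OF eH] by (auto simp: restrict_PiE_iff)
  have aP: "a \<in> carrier ?P" and bP: "b \<in> carrier ?P"
    unfolding hom_product_eq a_def b_def using t alt_subset_H by (simp_all add: restrict_PiE_iff)
  have pM: "p \<in> M" using t by (intro Suc.IH pP) (simp add: p_def)
  have aM: "a \<otimes>\<^bsub>?P\<^esub> ?e \<otimes>\<^bsub>?P\<^esub> inv\<^bsub>?P\<^esub> a \<in> M" using M.inv_op_closed2[OF aP n(2)] .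
  have bM: "b \<otimes>\<^bsub>?P\<^esub> inv\<^bsub>?P\<^esub> ?e \<otimes>\<^bsub>?P\<^esub> inv\<^bsub>?P\<^esub> b \<in> M" using M.inv_op_closed2[OF bP M.m_inv_closed[OF n(2)]] .
  have gM: "p \<otimes>\<^bsub>?P\<^esub> (a \<otimes>\<^bsub>?P\<^esub> ?e \<otimes>\<^bsub>?P\<^esub> inv\<^bsub>?P\<^esub> a) \<otimes>\<^bsub>?P\<^esub> (b \<otimes>\<^bsub>?P\<^esub> inv\<^bsub>?P\<^esub> ?e \<otimes>\<^bsub>?P\<^esub> inv\<^bsub>?P\<^esub> b) \<in> M" (is "?g \<in> M")
    by (rule M.m_closed[OF M.m_closed[OF pM aM] bM])
  have "f = ?g"
  proof (rule PiE_ext)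
    show "f \<in> (\<Pi>\<^sub>E i \<in> ?I. carrier (H (fst i)))" "?g \<in> (\<Pi>\<^sub>E i \<in> ?I. carrier (H (fst i)))"
      using Suc.prems(1) subsetD[OF M.subset gM] by (simp_all only: hom_product_eq carrier_product_group)
    show "f i = ?g i" if i: "i \<in> ?I" for i
    proof -
      have "p i = fst (t i)" "a i = fst (snd (t i))" "b i = snd (snd (t i))"
        using i by (simp_all add: p_def a_def b_def)
      then show ?thesis
        unfolding hom_product_apply(2)[OF i] hom_product_apply(3)[OF i e] hom_product_apply(3)[OF i aP]
          hom_product_apply(3)[OF i bP] hom_embed_apply[OF i] using t i by simp
    qed
  qed
  with gM show ?case by (simp only:)
qed

text \<open>The element \<open>n\<close> that serves a coordinate may vary. \<open>f\<close> is
  split into its part on the coordinates served by one \<open>n\<close>, filled up with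
  \<open>id\<close>, and the rest, which is left to the remaining elements of
  \<open>E\<close>.\<close>

lemma normal_contains_piecewise_conj_prods:
  assumes F: "group F" and M: "M \<lhd> hom_product F H"
  shows "finite E \<Longrightarrow> E \<subseteq> carrier F \<Longrightarrow> hom_embed F H ` E \<subseteq> M \<Longrightarrow> f \<in> carrier (hom_product F H) \<Longrightarrow>
    (\<And>i. i \<in> hom_index F H \<Longrightarrow> f i = id \<or> (\<exists>n \<in> E. f i \<in> conj_prods (fst i) (snd i n) k)) \<Longrightarrow> f \<in> M"
proof (induction E arbitrary: f rule: finite_induct)
  case empty
  let ?P = "hom_product F H"
  interpret P: group ?P by (rule group_hom_product)
  interpret M: normal M ?P by fact
  have "f = \<one>\<^bsub>?P\<^esub>"
  proof (rule PiE_ext)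
    show "f \<in> (\<Pi>\<^sub>E i \<in> hom_index F H. carrier (H (fst i)))" "\<one>\<^bsub>?P\<^esub> \<in> (\<Pi>\<^sub>E i \<in> hom_index F H. carrier (H (fst i)))"
      using empty(3) P.one_closed by (simp_all add: hom_product_eq)
    show "f i = \<one>\<^bsub>?P\<^esub> i" if "i \<in> hom_index F H" for i
      using empty(4)[OF that] hom_product_apply(4)[OF that] by auto
  qed
  then show ?case by simp
next
  case (insert n E)
  let ?P = "hom_product F H" and ?I = "hom_index F H"
  interpret P: group ?P by (rule group_hom_product)
  interpret M: normal M ?P by fact
  define A where "A = {i \<in> ?I. f i \<in> conj_prods (fst i) (snd i n) k}"
  define g where "g = (\<lambda>i \<in> ?I. if i \<in> A then f i else id)"
  define h where "h = (\<lambda>i \<in> ?I. if i \<in> A then id else f i)"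
  have id: "id \<in> carrier (H m)" for m using alt_subset_H alt_id by blast
  have fH: "f i \<in> carrier (H (fst i))" if "i \<in> ?I" for i using hom_product_apply(1)[OF that insert.prems(3)] .
  have gP: "g \<in> carrier ?P" and hP: "h \<in> carrier ?P"
    unfolding hom_product_eq g_def h_def using id fH by (auto simp: restrict_PiE_iff)
  have "g \<in> M"
  proof (rule normal_contains_conj_prods[OF F M _ _ gP])
    show "n \<in> carrier F" "hom_embed F H n \<in> M" using insert.prems by auto
    fix i assume i: "i \<in> ?I"
    have "snd i n permutes {1..fst i}"
      using hom_indexD(2)[OF i] insert.prems(1) by (intro H_permutes) (auto simp: hom_def)
    then show "g i \<in> conj_prods (fst i) (snd i n) k"
      using i id_in_conj_prods by (auto simp: g_def A_def)
  qed
  moreover have "h \<in> M"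
    by (rule insert.IH[OF _ _ hP]) (use insert.prems in \<open>auto simp: h_def A_def\<close>)
  ultimately have "g \<otimes>\<^bsub>?P\<^esub> h \<in> M" by (rule M.m_closed)
  moreover have "f = g \<otimes>\<^bsub>?P\<^esub> h"
  proof (rule PiE_ext)
    show "f \<in> (\<Pi>\<^sub>E i \<in> ?I. carrier (H (fst i)))" "g \<otimes>\<^bsub>?P\<^esub> h \<in> (\<Pi>\<^sub>E i \<in> ?I. carrier (H (fst i)))"
      using insert.prems(3) P.m_closed[OF gP hP] by (simp_all add: hom_product_eq)
    show "f i = (g \<otimes>\<^bsub>?P\<^esub> h) i" if i: "i \<in> ?I" for i
      unfolding hom_product_apply(2)[OF i] using i by (auto simp: g_def h_def fun_eq_iff)
  qed
  ultimately show ?case by simp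
qed

text \<open>The witness \<open>n\<close> may vary with the homomorphism, but \<open>E\<close> and
  \<open>k\<close> may not: they provide the finite set and the uniform count
  \<open>48 * k + 8\<close> of factors. Degrees up to 4, out of reach of
  \<open>evenperm_in_conj_prods\<close>, contribute only \<open>id\<close>.\<close>

lemma normal_closure_of_hamming_ratio:
  assumes F: "group F" and w: "w \<in> carrier F" and E: "finite E" "E \<subseteq> N" "N \<subseteq> carrier F"
    and small: "\<And>m \<phi>. 1 \<le> m \<Longrightarrow> m \<le> 4 \<Longrightarrow> \<phi> \<in> hom F (H m) \<Longrightarrow> \<phi> w = id"
    and even: "\<And>m \<phi>. 1 \<le> m \<Longrightarrow> \<phi> \<in> hom F (H m) \<Longrightarrow> evenperm (\<phi> w)"
    and ratio: "\<And>m \<phi>. 1 \<le> m \<Longrightarrow> \<phi> \<in> hom F (H m) \<Longrightarrow>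
      \<exists>n \<in> E. hamming_length m (\<phi> w) \<le> real k * hamming_length m (\<phi> n)"
  shows "hom_embed F H w \<in> normal_closure (hom_product F H) (hom_embed F H ` N)"
  unfolding normal_closure_def
proof (intro InterI, safe)
  fix M assume M: "M \<lhd> hom_product F H" and NM: "hom_embed F H ` N \<subseteq> M"
  show "hom_embed F H w \<in> M"
  proof (rule normal_contains_piecewise_conj_prods[OF F M E(1) _ _ hom_embed_closed[OF w]])
    show "E \<subseteq> carrier F" "hom_embed F H ` E \<subseteq> M" using E NM by auto
    fix i assume i: "i \<in> hom_index F H"
    note iD = hom_indexD[OF i]
    have perm: "snd i g permutes {1..fst i}" if "g \<in> carrier F" for g
      using iD(2) that by (intro H_permutes) (auto simp: hom_def)
    show "hom_embed F H w i = id \<or> (\<exists>n \<in> E. hom_embed F H w i \<in> conj_prods (fst i) (snd i n) (48 * k + 8))"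
    proof (cases "fst i \<le> 4")
      case True
      then show ?thesis using small[OF iD(1) _ iD(2)] hom_embed_apply[OF i] by simp
    next
      case False
      obtain n where n: "n \<in> E" "hamming_length (fst i) (snd i w) \<le> real k * hamming_length (fst i) (snd i n)"
        using ratio[OF iD] by blast
      then have nF: "n \<in> carrier F" using E by blast
      have "real (card (moved (snd i w))) / fst i \<le> real (k * card (moved (snd i n))) / fst i"
        using n(2) by (simp add: hamming_length_eq[OF perm[OF w]] hamming_length_eq[OF perm[OF nF]])
      then have "card (moved (snd i w)) \<le> k * card (moved (snd i n))"
        using iD(1) by (auto simp only: divide_le_cancel of_nat_le_iff)
      then have "snd i w \<in> conj_prods (fst i) (snd i n) (48 * k + 8)"
        using False by (intro evenperm_in_conj_prods perm w nF even[OF iD]) auto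
      then show ?thesis using n(1) hom_embed_apply[OF i] by auto
    qed
  qed
qed

end

section \<open>Sofic quotients and separating homomorphisms\<close>

text \<open>A form of soficity at one element in which genuine homomorphisms of \<open>F\<close>
  replace almost multiplicative maps on the quotient. The bound \<open>a\<close> stays fixed while
  \<open>E\<close> grows and \<open>\<epsilon>\<close> shrinks.\<close>

definition separates :: "('a, 'b) monoid_scheme \<Rightarrow> 'a set \<Rightarrow> real \<Rightarrow> 'a \<Rightarrow> bool" where
  "separates F N a w \<longleftrightarrow> (\<forall>E \<epsilon>. finite E \<and> E \<subseteq> N \<and> \<epsilon> > 0 \<longrightarrow>
     (\<exists>m \<ge> 1. \<exists>\<phi> \<in> hom F (sym_group m).
        a \<le> hamming_length m (\<phi> w) \<and> (\<forall>n \<in> E. hamming_length m (\<phi> n) < \<epsilon>)))"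

text \<open>Lengths \<open>x\<close> and \<open>y\<close> become \<open>x + y - x * y\<close> in a
  tensor product. This is at least either length, so lower bounds for different elements survive
  together, and at most the sum, so halving \<open>\<epsilon>\<close> pays for each new
  element.\<close>

lemma separates_simultaneously:
  assumes F: "group F" and N: "N \<subseteq> carrier F"
    and W: "finite W" "W \<subseteq> carrier F" "\<And>w. w \<in> W \<Longrightarrow> separates F N a w"
    and E: "finite E" "E \<subseteq> N" "\<epsilon> > 0"
  shows "\<exists>m \<ge> 1. \<exists>\<phi> \<in> hom F (sym_group m).
    (\<forall>w \<in> W. a \<le> hamming_length m (\<phi> w)) \<and> (\<forall>n \<in> E. hamming_length m (\<phi> n) < \<epsilon>)"
  using W E(3)
proof (induction W arbitrary: \<epsilon> rule: finite_induct)
  case empty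
  have "(\<lambda>_. id) \<in> hom F (sym_group 1)"
    by (intro homI) (auto simp: sym_group_carrier sym_group_mult permutes_id)
  then show ?case using empty by (intro exI[of _ 1]) (auto intro!: bexI[of _ "\<lambda>_. id"])
next
  case (insert w W)
  have "\<epsilon> / 2 > 0" using insert.prems by simp
  then obtain l \<psi> where l: "l \<ge> 1" "\<psi> \<in> hom F (sym_group l)"
    "\<forall>w \<in> W. a \<le> hamming_length l (\<psi> w)" "\<forall>n \<in> E. hamming_length l (\<psi> n) < \<epsilon> / 2"
    using insert.IH[of "\<epsilon> / 2"] insert.prems by auto
  obtain m \<phi> where m: "m \<ge> 1" "\<phi> \<in> hom F (sym_group m)"
    "a \<le> hamming_length m (\<phi> w)" "\<forall>n \<in> E. hamming_length m (\<phi> n) < \<epsilon> / 2"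
    using insert.prems(2)[of w] E(1,2) \<open>\<epsilon> / 2 > 0\<close> unfolding separates_def by (meson insertI1)
  obtain \<chi> where \<chi>: "\<chi> \<in> hom F (sym_group (l * m))"
    "\<And>g. g \<in> carrier F \<Longrightarrow> 1 - hamming_length (l * m) (\<chi> g) =
       (1 - hamming_length l (\<psi> g)) * (1 - hamming_length m (\<phi> g))"
    using ex_tensor_hom[OF F l(1) m(1) l(2) m(2)] by blast
  have bounds: "hamming_length l (\<psi> g) \<le> hamming_length (l * m) (\<chi> g)"
    "hamming_length m (\<phi> g) \<le> hamming_length (l * m) (\<chi> g)"
    "hamming_length (l * m) (\<chi> g) \<le> hamming_length l (\<psi> g) + hamming_length m (\<phi> g)"
    if g: "g \<in> carrier F" for g
  proof -
    define x y where "x = hamming_length l (\<psi> g)" and "y = hamming_length m (\<phi> g)"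
    have xy: "0 \<le> x" "x \<le> 1" "0 \<le> y" "y \<le> 1"
      by (simp_all add: x_def y_def hamming_length_nonneg hamming_length_le_1)
    have z: "hamming_length (l * m) (\<chi> g) = x + y - x * y"
      using \<chi>(2)[OF g] by (simp add: x_def y_def algebra_simps)
    have "x * y \<le> x" "x * y \<le> y" "0 \<le> x * y"
      using xy by (simp_all add: mult_left_le mult_left_le_one_le)
    then show "x \<le> hamming_length (l * m) (\<chi> g)" "y \<le> hamming_length (l * m) (\<chi> g)"
      "hamming_length (l * m) (\<chi> g) \<le> x + y"
      unfolding z by linarith+
  qed
  have "a \<le> hamming_length (l * m) (\<chi> v)" if "v \<in> insert w W" for v
    using that bounds(1)[of v] bounds(2)[of v] l(3) m(3) insert.prems(1) by fastforce
  moreover have "hamming_length (l * m) (\<chi> n) < \<epsilon>" if "n \<in> E" for n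
    using that bounds(3)[of n] l(4) m(4) E(2) N by fastforce
  moreover have "l * m \<ge> 1" using l(1) m(1) by simp
  ultimately show ?case using \<chi>(1) by blast
qed

text \<open>Compose a homomorphism with a section \<open>\<sigma>\<close> of the quotient map. The
  multiplication errors are then values at elements of \<open>N\<close>, finitely many for finite
  \<open>\<Phi>\<close>.\<close>

theorem sofic_if_separates:
  assumes F: "group F" and N: "N \<lhd> F" and a: "a > 0"
    and sep: "\<And>w. w \<in> carrier F - N \<Longrightarrow> separates F N a w"
  shows "sofic (F Mod N)"
proof -
  interpret F: group F by fact
  interpret N: normal N F by fact
  let ?Q = "F Mod N"
  have Qc: "carrier ?Q = rcosets\<^bsub>F\<^esub> N" and Q1: "\<one>\<^bsub>?Q\<^esub> = N" and Qm: "\<And>C D. C \<otimes>\<^bsub>?Q\<^esub> D = C <#>\<^bsub>F\<^esub> D"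
    by (simp_all add: FactGroup_def)
  \<comment> \<open>The trivial coset is sent to the identity so that the approximation is exactly
    the identity there.\<close>
  define \<sigma> where "\<sigma> C = (if C = N then \<one>\<^bsub>F\<^esub> else SOME x. x \<in> carrier F \<and> C = N #>\<^bsub>F\<^esub> x)" for C
  have \<sigma>: "\<sigma> C \<in> carrier F" "N #>\<^bsub>F\<^esub> \<sigma> C = C" if C: "C \<in> carrier ?Q" for C
  proof -
    have ex: "\<exists>x. x \<in> carrier F \<and> C = N #>\<^bsub>F\<^esub> x" using C unfolding Qc RCOSETS_def by blast
    have N1: "N #>\<^bsub>F\<^esub> \<one>\<^bsub>F\<^esub> = N" using F.coset_mult_one N.subset by blast
    show "\<sigma> C \<in> carrier F" "N #>\<^bsub>F\<^esub> \<sigma> C = C"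
      using someI_ex[OF ex] N1 by (auto simp: \<sigma>_def)
  qed
  have \<sigma>N: "\<sigma> C \<notin> N" if "C \<in> carrier ?Q" "C \<noteq> N" for C
    using F.coset_join2[OF \<sigma>(1)[OF that(1)] N.subgroup_axioms] \<sigma>(2)[OF that(1)] that(2) by auto
  \<comment> \<open>The failure of the section to be multiplicative; the homomorphism turns it into
    the multiplication error.\<close>
  define d where "d C D = \<sigma> (C \<otimes>\<^bsub>?Q\<^esub> D) \<otimes>\<^bsub>F\<^esub> inv\<^bsub>F\<^esub> (\<sigma> C \<otimes>\<^bsub>F\<^esub> \<sigma> D)" for C D
  have dN: "d C D \<in> N" if CD: "C \<in> carrier ?Q" "D \<in> carrier ?Q" for C D
  proof -
    have "C \<otimes>\<^bsub>?Q\<^esub> D \<in> carrier ?Q" using CD group.is_monoid[OF N.factorgroup_is_group] monoid.m_closed by fast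
    note s = \<sigma>[OF this] \<sigma>[OF CD(1)] \<sigma>[OF CD(2)]
    have "N #>\<^bsub>F\<^esub> (\<sigma> C \<otimes>\<^bsub>F\<^esub> \<sigma> D) = (N #>\<^bsub>F\<^esub> \<sigma> C) <#>\<^bsub>F\<^esub> (N #>\<^bsub>F\<^esub> \<sigma> D)"
      by (rule N.rcos_sum[symmetric]) (fact s)+
    also have "\<dots> = N #>\<^bsub>F\<^esub> \<sigma> (C \<otimes>\<^bsub>?Q\<^esub> D)" using s by (simp add: Qm)
    finally have "\<sigma> (C \<otimes>\<^bsub>?Q\<^esub> D) \<in> N #>\<^bsub>F\<^esub> (\<sigma> C \<otimes>\<^bsub>F\<^esub> \<sigma> D)"
      using F.rcos_self[OF s(1) N.subgroup_axioms] by simp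
    then obtain n where "n \<in> N" "\<sigma> (C \<otimes>\<^bsub>?Q\<^esub> D) = n \<otimes>\<^bsub>F\<^esub> (\<sigma> C \<otimes>\<^bsub>F\<^esub> \<sigma> D)"
      by (auto simp: r_coset_def)
    moreover from this have "d C D = n"
      using s by (simp add: d_def F.m_assoc N.mem_carrier)
    ultimately show ?thesis by simp
  qed
  show ?thesis
    unfolding sofic_def Q1
  proof (intro exI[of _ "\<lambda>C. if C = N then 0 else a"] conjI allI impI)
    show "(if N = N then 0 else a) = 0" by simp
    show "\<forall>C \<in> carrier ?Q. C \<noteq> N \<longrightarrow> 0 < (if C = N then 0 else a)" using a by simp
    fix \<Phi> :: "'a set set" and \<epsilon> :: real
    assume "finite \<Phi> \<and> \<Phi> \<subseteq> carrier ?Q \<and> 0 < \<epsilon>"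
    then have \<Phi>: "finite \<Phi>" "\<Phi> \<subseteq> carrier ?Q" and \<epsilon>: "0 < \<epsilon>" by auto
    let ?W = "\<sigma> ` (\<Phi> - {N})" and ?E = "(\<lambda>(C, D). d C D) ` (\<Phi> \<times> \<Phi>)"
    have "\<exists>m \<ge> 1. \<exists>\<phi> \<in> hom F (sym_group m).
      (\<forall>w \<in> ?W. a \<le> hamming_length m (\<phi> w)) \<and> (\<forall>n \<in> ?E. hamming_length m (\<phi> n) < \<epsilon>)"
    proof (rule separates_simultaneously[OF F N.subset _ _ _ _ _ \<epsilon>])
      show "?W \<subseteq> carrier F" using \<sigma> \<Phi>(2) by blast
      show "separates F N a w" if "w \<in> ?W" for w using that \<sigma> \<sigma>N \<Phi>(2) by (intro sep) blast
      show "?E \<subseteq> N" using dN \<Phi>(2) by auto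
    qed (use \<Phi>(1) in auto)
    then obtain m \<phi> where m: "m \<ge> 1" and \<phi>: "\<phi> \<in> hom F (sym_group m)"
      and W: "\<forall>w \<in> ?W. a \<le> hamming_length m (\<phi> w)" and E: "\<forall>n \<in> ?E. hamming_length m (\<phi> n) < \<epsilon>"
      by blast
    note \<phi>f = sym_group_hom_facts[OF F \<phi>]
    show "\<exists>m \<ge> 1. \<exists>\<phi> \<in> \<Phi> \<rightarrow> carrier (sym_group m).
        (N \<in> \<Phi> \<longrightarrow> \<phi> N = \<one>\<^bsub>sym_group m\<^esub>) \<and>
        (\<forall>g \<in> \<Phi>. (if g = N then 0 else a) \<le> hamming_length m (\<phi> g)) \<and>
        (\<forall>g \<in> \<Phi>. \<forall>h \<in> \<Phi>. g \<otimes>\<^bsub>?Q\<^esub> h \<in> \<Phi> \<longrightarrow>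
           hamming_length m (\<phi> (g \<otimes>\<^bsub>?Q\<^esub> h) \<otimes>\<^bsub>sym_group m\<^esub>
             inv\<^bsub>sym_group m\<^esub> (\<phi> g \<otimes>\<^bsub>sym_group m\<^esub> \<phi> h)) < \<epsilon>)"
    proof (intro exI[of _ m] conjI m bexI[of _ "\<lambda>C. \<phi> (\<sigma> C)"] ballI impI)
      show "\<phi> (\<sigma> N) = \<one>\<^bsub>sym_group m\<^esub>" by (simp add: \<sigma>_def \<phi>f(4) sym_group_one)
      show "(\<lambda>C. \<phi> (\<sigma> C)) \<in> \<Phi> \<rightarrow> carrier (sym_group m)"
        using \<phi>f(1) \<sigma>(1) \<Phi>(2) by (auto simp only: sym_group_carrier Pi_iff)
      show "(if C = N then 0 else a) \<le> hamming_length m (\<phi> (\<sigma> C))" if "C \<in> \<Phi>" for C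
        using that W by (auto simp: hamming_length_nonneg)
      fix C D assume CD: "C \<in> \<Phi>" "D \<in> \<Phi>" "C \<otimes>\<^bsub>?Q\<^esub> D \<in> \<Phi>"
      then have s: "\<sigma> C \<in> carrier F" "\<sigma> D \<in> carrier F" "\<sigma> (C \<otimes>\<^bsub>?Q\<^esub> D) \<in> carrier F" using \<sigma> \<Phi>(2) by blast+
      have "\<phi> (\<sigma> C) \<circ> \<phi> (\<sigma> D) \<in> carrier (sym_group m)"
        using \<phi>f(1) s permutes_compose by (simp only: sym_group_carrier) blast
      then have "\<phi> (\<sigma> (C \<otimes>\<^bsub>?Q\<^esub> D)) \<otimes>\<^bsub>sym_group m\<^esub> inv\<^bsub>sym_group m\<^esub> (\<phi> (\<sigma> C) \<otimes>\<^bsub>sym_group m\<^esub> \<phi> (\<sigma> D)) = \<phi> (d C D)"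
        using s by (simp add: d_def \<phi>f(2,3) sym_group_mult)
      moreover have "d C D \<in> ?E" using CD by auto
      ultimately show "hamming_length m (\<phi> (\<sigma> (C \<otimes>\<^bsub>?Q\<^esub> D)) \<otimes>\<^bsub>sym_group m\<^esub>
          inv\<^bsub>sym_group m\<^esub> (\<phi> (\<sigma> C) \<otimes>\<^bsub>sym_group m\<^esub> \<phi> (\<sigma> D))) < \<epsilon>"
        using E by (metis (no_types, lifting))
    qed
  qed
qed

section \<open>From sofic approximations to homomorphisms\<close>

text \<open>The metric for which the length is the distance from \<open>id\<close>. Its invariance
  under composition with permutations on either side carries the error estimates.\<close>

definition hamming_dist :: "nat \<Rightarrow> (nat \<Rightarrow> nat) \<Rightarrow> (nat \<Rightarrow> nat) \<Rightarrow> real" where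
  "hamming_dist m p q = card {x \<in> {1..m}. p x \<noteq> q x} / m"

lemma hamming_dist_id: "hamming_dist m p id = hamming_length m p"
  by (simp add: hamming_dist_def hamming_length_def)

lemma hamming_dist_commute: "hamming_dist m p q = hamming_dist m q p"
  unfolding hamming_dist_def by metis

lemma hamming_dist_triangle: "hamming_dist m p r \<le> hamming_dist m p q + hamming_dist m q r"
proof -
  let ?S = "\<lambda>p q. {x \<in> {1..m}. p x \<noteq> q x}"
  have "card (?S p r) \<le> card (?S p q \<union> ?S q r)" by (intro card_mono) auto
  also have "\<dots> \<le> card (?S p q) + card (?S q r)" by (rule card_Un_le)
  finally have "real (card (?S p r)) \<le> real (card (?S p q) + card (?S q r))" by (rule of_nat_mono)
  then show ?thesis
    unfolding hamming_dist_def add_divide_distrib[symmetric] of_nat_add by (rule divide_right_mono) simp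
qed

lemma hamming_dist_comp_left:
  assumes "s permutes {1..m}"
  shows "hamming_dist m (s \<circ> p) (s \<circ> q) = hamming_dist m p q"
  unfolding hamming_dist_def using inj_eq[OF permutes_inj[OF assms]] by simp

lemma hamming_dist_comp_right:
  assumes s: "s permutes {1..m}"
  shows "hamming_dist m (p \<circ> s) (q \<circ> s) = hamming_dist m p q"
proof -
  have "s ` {x \<in> {1..m}. p (s x) \<noteq> q (s x)} = {x \<in> {1..m}. p x \<noteq> q x}"
  proof (intro equalityI subsetI)
    fix y assume y: "y \<in> {x \<in> {1..m}. p x \<noteq> q x}"
    have "s (inv' s y) = y" using permutes_inverses(1)[OF s] .
    moreover have "inv' s y \<in> {1..m}" using y permutes_in_image[OF permutes_inv[OF s], of y] by blast
    ultimately show "y \<in> s ` {x \<in> {1..m}. p (s x) \<noteq> q (s x)}"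
      using y by (intro image_eqI[of _ _ "inv' s y"]) simp_all
  qed (use permutes_in_image[OF s] in blast)
  then have "card {x \<in> {1..m}. p (s x) \<noteq> q (s x)} = card {x \<in> {1..m}. p x \<noteq> q x}"
    using card_image[OF inj_on_subset[OF permutes_inj[OF s] subset_UNIV], of "{x \<in> {1..m}. p (s x) \<noteq> q (s x)}"]
    by (simp only:)
  then show ?thesis by (simp add: hamming_dist_def)
qed

lemma hamming_length_comp_inv:
  assumes "q permutes {1..m}"
  shows "hamming_length m (p \<circ> inv' q) = hamming_dist m p q"
proof -
  have "hamming_dist m ((p \<circ> inv' q) \<circ> q) (id \<circ> q) = hamming_dist m (p \<circ> inv' q) id"
    by (rule hamming_dist_comp_right[OF assms])
  moreover have "(p \<circ> inv' q) \<circ> q = p" using permutes_inv_o(2)[OF assms] by (simp only: comp_assoc comp_id)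
  ultimately show ?thesis by (simp only: hamming_dist_id id_comp)
qed

text \<open>The values of an approximation \<open>\<psi>\<close> at the cosets of the basis define a
  genuine homomorphism \<open>\<phi>\<close> of the free group. Along a fixed word
  \<open>\<phi>\<close> and \<open>\<psi>\<close> drift apart by at most a multiple of the word
  length, and only finitely many words matter.\<close>

theorem separates_if_sofic:
  assumes F: "group F" and B: "free_basis F B" "finite B" and N: "N \<lhd> F"
    and sofic: "sofic (F Mod N)" and w: "w \<in> carrier F - N"
  shows "\<exists>a > 0. separates F N a w"
proof -
  interpret F: group F by fact
  interpret N: normal N F by fact
  let ?Q = "F Mod N"
  define c where "c g = N #>\<^bsub>F\<^esub> g" for g
  have Q1: "\<one>\<^bsub>?Q\<^esub> = N" by (simp add: FactGroup_def)
  have cQ: "c g \<in> carrier ?Q" if "g \<in> carrier F" for g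
    using that by (auto simp: FactGroup_def RCOSETS_def c_def)
  have cm: "c g \<otimes>\<^bsub>?Q\<^esub> c h = c (g \<otimes>\<^bsub>F\<^esub> h)" if "g \<in> carrier F" "h \<in> carrier F" for g h
    using that N.rcos_sum by (simp add: FactGroup_def c_def)
  have cN: "c g = N \<longleftrightarrow> g \<in> N" if "g \<in> carrier F" for g
    using F.coset_join2[OF that N.subgroup_axioms] F.rcos_self[OF that N.subgroup_axioms] by (auto simp: c_def)
  have Bc: "B \<subseteq> carrier F" and gen: "generate F B = carrier F" using B(1) by (simp_all add: free_basis_def)
  obtain \<alpha> where "\<alpha> N = (0 :: real)" and \<alpha>: "\<forall>g \<in> carrier ?Q. g \<noteq> N \<longrightarrow> \<alpha> g > 0"
    and app: "\<forall>\<Phi> \<epsilon>. finite \<Phi> \<and> \<Phi> \<subseteq> carrier ?Q \<and> \<epsilon> > 0 \<longrightarrow>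
      (\<exists>m \<ge> 1. \<exists>\<psi> \<in> \<Phi> \<rightarrow> carrier (sym_group m). (N \<in> \<Phi> \<longrightarrow> \<psi> N = \<one>\<^bsub>sym_group m\<^esub>) \<and>
        (\<forall>g \<in> \<Phi>. hamming_length m (\<psi> g) \<ge> \<alpha> g) \<and>
        (\<forall>g \<in> \<Phi>. \<forall>h \<in> \<Phi>. g \<otimes>\<^bsub>?Q\<^esub> h \<in> \<Phi> \<longrightarrow>
           hamming_length m (\<psi> (g \<otimes>\<^bsub>?Q\<^esub> h) \<otimes>\<^bsub>sym_group m\<^esub>
             inv\<^bsub>sym_group m\<^esub> (\<psi> g \<otimes>\<^bsub>sym_group m\<^esub> \<psi> h)) < \<epsilon>))"
    using sofic unfolding sofic_def Q1 by (elim exE conjE) (rule that)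
  \<comment> \<open>Half of the guaranteed length is kept, the other half absorbs the drift.\<close>
  define a where "a = \<alpha> (c w) / 2"
  have a: "a > 0" using \<alpha> cQ[of w] cN[of w] w by (auto simp: a_def)
  have "separates F N a w"
    unfolding separates_def
  proof (intro allI impI)
    fix E and \<epsilon> :: real assume "finite E \<and> E \<subseteq> N \<and> \<epsilon> > 0"
    then have E: "finite E" "E \<subseteq> N" and \<epsilon>: "\<epsilon> > 0" by auto
    define G where "G = insert w E"
    have G: "finite G" "G \<subseteq> carrier F" using E w N.subset by (auto simp: G_def)
    have "\<forall>g \<in> G. \<exists>v. snd ` set v \<subseteq> B \<and> eval_word F v = g"
      using F.generate_eq_eval_word[OF Bc] gen G(2) by blast
    then obtain W where W: "\<And>g. g \<in> G \<Longrightarrow> snd ` set (W g) \<subseteq> B" "\<And>g. g \<in> G \<Longrightarrow> eval_word F (W g) = g"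
      by metis
    \<comment> \<open>All suffixes of the chosen words, so that the induction over a word stays
      inside the finite set on which \<open>\<psi>\<close> is controlled.\<close>
    define V where "V = (\<Union>g \<in> G. (\<lambda>i. drop i (W g)) ` {..length (W g)})"
    have V: "finite V" using G(1) by (simp add: V_def)
    have VB: "snd ` set v \<subseteq> B" if vV: "v \<in> V" for v
    proof -
      obtain g i where "g \<in> G" "v = drop i (W g)" using vV by (auto simp: V_def)
      then show ?thesis using W(1)[of g] set_drop_subset[of i "W g"] by blast
    qed
    have Vtl: "v \<in> V" if lv: "l # v \<in> V" for l v
    proof -
      obtain g i where g: "g \<in> G" "l # v = drop i (W g)" using lv by (auto simp: V_def)
      then have "i < length (W g)" by (metis drop_all linorder_not_le list.distinct(1))
      moreover have "v = drop (Suc i) (W g)" using g(2) by (metis drop_Suc list.sel(3) tl_drop)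
      ultimately have "v \<in> (\<lambda>i. drop i (W g)) ` {..length (W g)}" by auto
      then show ?thesis using g(1) unfolding V_def by blast
    qed
    define L where "L = (\<Sum>g \<in> G. length (W g))"
    have L: "length (W g) \<le> L" if "g \<in> G" for g
      unfolding L_def using member_le_sum[OF that, of "\<lambda>g. length (W g)"] G(1) by simp
    \<comment> \<open>Chosen so that the drift \<open>2 * L * \<delta>\<close> stays below both
      \<open>\<epsilon>\<close> and \<open>a\<close>; the added 1 makes this strict and keeps the
      denominator positive.\<close>
    define \<delta> where "\<delta> = min \<epsilon> a / (2 * real L + 1)"
    have \<delta>: "\<delta> > 0" using \<epsilon> a by (simp add: \<delta>_def)
    have "2 * real L * \<delta> < (2 * real L + 1) * \<delta>" using \<delta> by (intro mult_strict_right_mono) simp_all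
    then have L\<delta>: "2 * real L * \<delta> < min \<epsilon> a" by (simp add: \<delta>_def)
    \<comment> \<open>Inverses of the basis are included because \<open>\<phi>\<close> sends them to
      inverses, which \<open>\<psi>\<close> matches only approximately; comparing them uses the
      trivial coset \<open>N\<close>.\<close>
    define \<Phi> where "\<Phi> = insert N (c ` B \<union> c ` (\<lambda>b. inv\<^bsub>F\<^esub> b) ` B \<union> c ` eval_word F ` V)"
    have evF: "eval_word F v \<in> carrier F" if "v \<in> V" for v
      using VB[OF that] Bc by (intro F.eval_word_closed) blast
    have N\<Phi>: "N \<in> carrier ?Q" using cQ[OF F.one_closed] cN[OF F.one_closed] N.one_closed by simp
    have "finite \<Phi>" using B(2) V by (simp add: \<Phi>_def)
    moreover have "\<Phi> \<subseteq> carrier ?Q"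
      unfolding \<Phi>_def using N\<Phi> cQ Bc evF by auto
    ultimately obtain m \<psi> where m: "m \<ge> 1" and \<psi>: "\<psi> \<in> \<Phi> \<rightarrow> carrier (sym_group m)" "N \<in> \<Phi> \<longrightarrow> \<psi> N = \<one>\<^bsub>sym_group m\<^esub>"
      and \<psi>\<alpha>: "\<forall>g \<in> \<Phi>. \<alpha> g \<le> hamming_length m (\<psi> g)"
      and \<psi>\<delta>: "\<forall>g \<in> \<Phi>. \<forall>h \<in> \<Phi>. g \<otimes>\<^bsub>?Q\<^esub> h \<in> \<Phi> \<longrightarrow>
           hamming_length m (\<psi> (g \<otimes>\<^bsub>?Q\<^esub> h) \<otimes>\<^bsub>sym_group m\<^esub>
             inv\<^bsub>sym_group m\<^esub> (\<psi> g \<otimes>\<^bsub>sym_group m\<^esub> \<psi> h)) < \<delta>"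
      using app[rule_format, of \<Phi> \<delta>] \<delta> by blast
    have \<psi>p: "\<psi> C permutes {1..m}" if "C \<in> \<Phi>" for C
      using \<psi>(1) that by (simp only: sym_group_carrier[symmetric]) blast
    have \<psi>N: "\<psi> N = id" using \<psi>(2) by (simp add: \<Phi>_def sym_group_one)
    have defect: "hamming_dist m (\<psi> (c (g \<otimes>\<^bsub>F\<^esub> h))) (\<psi> (c g) \<circ> \<psi> (c h)) < \<delta>"
      if "g \<in> carrier F" "h \<in> carrier F" "c g \<in> \<Phi>" "c h \<in> \<Phi>" "c (g \<otimes>\<^bsub>F\<^esub> h) \<in> \<Phi>" for g h
    proof -
      have p: "\<psi> (c g) \<circ> \<psi> (c h) permutes {1..m}" using that \<psi>p by (intro permutes_compose) auto
      then have "\<psi> (c g) \<circ> \<psi> (c h) \<in> carrier (sym_group m)" by (simp only: sym_group_carrier)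
      then show ?thesis
        using \<psi>\<delta>[rule_format, OF that(3,4)] cm[OF that(1,2)] that(5) hamming_length_comp_inv[OF p]
        by (simp add: sym_group_mult)
    qed
    have "(\<lambda>b. \<psi> (c b)) \<in> B \<rightarrow> carrier (sym_group m)"
      using \<psi>(1) by (auto simp: \<Phi>_def)
    then obtain \<phi> where \<phi>: "\<phi> \<in> hom F (sym_group m)" "\<And>b. b \<in> B \<Longrightarrow> \<phi> b = \<psi> (c b)"
      using free_basis_ex_hom[OF F B(1) sym_group_is_group] by blast
    note \<phi>f = sym_group_hom_facts[OF F \<phi>(1)]
    have letter: "hamming_dist m (\<phi> (eval_letter F l)) (\<psi> (c (eval_letter F l))) \<le> \<delta>"
      and letter\<Phi>: "c (eval_letter F l) \<in> \<Phi>" if l: "snd l \<in> B" for l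
    proof -
      obtain s b where sb: "l = (s, b)" "b \<in> B" using l by (cases l) auto
      have bF: "b \<in> carrier F" using sb Bc by blast
      have in\<Phi>: "c b \<in> \<Phi>" "c (inv\<^bsub>F\<^esub> b) \<in> \<Phi>" "N \<in> \<Phi>" using sb by (auto simp: \<Phi>_def)
      then show "c (eval_letter F l) \<in> \<Phi>" using sb by simp
      show "hamming_dist m (\<phi> (eval_letter F l)) (\<psi> (c (eval_letter F l))) \<le> \<delta>"
      proof (cases s)
        case True
        then show ?thesis using sb \<phi>(2) \<delta> by (simp add: hamming_dist_def)
      next
        case False
        let ?p = "\<psi> (c b)" and ?q = "\<psi> (c (inv\<^bsub>F\<^esub> b))"
        have p: "?p permutes {1..m}" and q: "?q permutes {1..m}" using \<psi>p in\<Phi> by blast+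
        have "c (inv\<^bsub>F\<^esub> b \<otimes>\<^bsub>F\<^esub> b) = N" using bF cN[OF F.one_closed] N.one_closed by simp
        then have "hamming_dist m id (?q \<circ> ?p) < \<delta>"
          using defect[of "inv\<^bsub>F\<^esub> b" b] bF in\<Phi> \<psi>N by simp
        moreover have "hamming_dist m (inv' ?p \<circ> ?p) (?q \<circ> ?p) = hamming_dist m (inv' ?p) ?q"
          by (rule hamming_dist_comp_right[OF p])
        ultimately show ?thesis
          using permutes_inv_o(2)[OF p] sb False \<phi>f(3)[OF bF] \<phi>(2) by simp
      qed
    qed
    \<comment> \<open>Each letter costs \<open>\<delta>\<close> twice: once for replacing the letter
      and once for the multiplication error of \<open>\<psi>\<close>.\<close>
    have word: "hamming_dist m (\<phi> (eval_word F v)) (\<psi> (c (eval_word F v))) \<le> 2 * length v * \<delta>" if "v \<in> V" for v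
      using that
    proof (induction v)
      case Nil
      have "c \<one>\<^bsub>F\<^esub> = N" using cN[OF F.one_closed] N.one_closed by simp
      then show ?case using \<phi>f(4) \<psi>N by (simp add: hamming_dist_def)
    next
      case (Cons l v)
      let ?l = "eval_letter F l" and ?v = "eval_word F v"
      have v: "v \<in> V" using Vtl Cons.prems .
      have lB: "snd l \<in> B" using VB[OF Cons.prems] by simp
      have lF: "?l \<in> carrier F" using lB Bc by (intro F.eval_letter_closed) blast
      have vF: "?v \<in> carrier F" using evF v .
      have ev\<Phi>: "c (eval_word F u) \<in> \<Phi>" if "u \<in> V" for u using that by (simp add: \<Phi>_def)
      have in\<Phi>: "c ?l \<in> \<Phi>" "c ?v \<in> \<Phi>" "c (?l \<otimes>\<^bsub>F\<^esub> ?v) \<in> \<Phi>"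
        using letter\<Phi>[OF lB] ev\<Phi>[OF v] ev\<Phi>[OF Cons.prems] F.eval_word_Cons[of l v] by simp_all
      have "hamming_dist m (\<phi> ?l \<circ> \<phi> ?v) (\<psi> (c (?l \<otimes>\<^bsub>F\<^esub> ?v)))
          \<le> hamming_dist m (\<phi> ?l \<circ> \<phi> ?v) (\<psi> (c ?l) \<circ> \<phi> ?v)
            + hamming_dist m (\<psi> (c ?l) \<circ> \<phi> ?v) (\<psi> (c ?l) \<circ> \<psi> (c ?v))
            + hamming_dist m (\<psi> (c ?l) \<circ> \<psi> (c ?v)) (\<psi> (c (?l \<otimes>\<^bsub>F\<^esub> ?v)))"
        using hamming_dist_triangle[of m "\<phi> ?l \<circ> \<phi> ?v" "\<psi> (c (?l \<otimes>\<^bsub>F\<^esub> ?v))" "\<psi> (c ?l) \<circ> \<psi> (c ?v)"]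
          hamming_dist_triangle[of m "\<phi> ?l \<circ> \<phi> ?v" "\<psi> (c ?l) \<circ> \<psi> (c ?v)" "\<psi> (c ?l) \<circ> \<phi> ?v"] by linarith
      also have "\<dots> \<le> \<delta> + 2 * length v * \<delta> + \<delta>"
        unfolding hamming_dist_comp_right[OF \<phi>f(1)[OF vF]] hamming_dist_comp_left[OF \<psi>p[OF in\<Phi>(1)]]
        using letter[OF lB] Cons.IH[OF v] defect[OF lF vF in\<Phi>]
          hamming_dist_commute[of m "\<psi> (c ?l) \<circ> \<psi> (c ?v)" "\<psi> (c (?l \<otimes>\<^bsub>F\<^esub> ?v))"] by linarith
      also have "\<dots> = 2 * length (l # v) * \<delta>" by (simp add: algebra_simps)
      finally show ?case by (simp only: F.eval_word_Cons \<phi>f(2)[OF lF vF])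
    qed
    have dist: "hamming_dist m (\<phi> g) (\<psi> (c g)) < min \<epsilon> a" if g: "g \<in> G" for g
    proof -
      have "W g \<in> V" using g by (force simp: V_def)
      then have "hamming_dist m (\<phi> g) (\<psi> (c g)) \<le> 2 * length (W g) * \<delta>"
        using word[of "W g"] W(2)[OF g] by simp
      also have "\<dots> \<le> 2 * real L * \<delta>"
        using L[OF g] \<delta> by (intro mult_right_mono) simp_all
      finally show ?thesis using L\<delta> by linarith
    qed
    have "a \<le> hamming_length m (\<phi> w)"
    proof -
      have wG: "w \<in> G" by (simp add: G_def)
      then have "W w \<in> V" by (force simp: V_def)
      then have "c w \<in> \<Phi>" using W(2)[OF wG] unfolding \<Phi>_def by (metis UnI2 imageI insertI2)
      then have "2 * a \<le> hamming_dist m (\<psi> (c w)) id" using \<psi>\<alpha> by (simp add: a_def hamming_dist_id)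
      also have "\<dots> \<le> hamming_dist m (\<psi> (c w)) (\<phi> w) + hamming_dist m (\<phi> w) id"
        by (rule hamming_dist_triangle)
      finally show ?thesis
        using dist[OF wG] hamming_dist_commute[of m "\<phi> w" "\<psi> (c w)"] by (simp add: hamming_dist_id)
    qed
    moreover have "hamming_length m (\<phi> n) < \<epsilon>" if "n \<in> E" for n
    proof -
      have "c n = N" using cN that E(2) N.subset by blast
      then show ?thesis using dist[of n] that \<psi>N by (simp add: G_def hamming_dist_id)
    qed
    ultimately show "\<exists>m \<ge> 1. \<exists>\<phi> \<in> hom F (sym_group m).
        a \<le> hamming_length m (\<phi> w) \<and> (\<forall>n \<in> E. hamming_length m (\<phi> n) < \<epsilon>)"
      using m \<phi>(1) by blast
  qed
  then show ?thesis using a by blast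
qed

section \<open>Closedness in the product\<close>

lemma separates_mono:
  assumes "separates F N a w" "N' \<subseteq> N" "b \<le> a"
  shows "separates F N' b w"
  unfolding separates_def
proof (intro allI impI)
  fix E and \<epsilon> :: real assume "finite E \<and> E \<subseteq> N' \<and> 0 < \<epsilon>"
  then have "finite E \<and> E \<subseteq> N \<and> 0 < \<epsilon>" using assms(2) by blast
  then obtain m \<phi> where "m \<ge> 1" "\<phi> \<in> hom F (sym_group m)" "a \<le> hamming_length m (\<phi> w)"
    "\<forall>n \<in> E. hamming_length m (\<phi> n) < \<epsilon>"
    using assms(1) unfolding separates_def by blast
  moreover from this have "b \<le> hamming_length m (\<phi> w)" using assms(3) by linarith
  ultimately show "\<exists>m \<ge> 1. \<exists>\<phi> \<in> hom F (sym_group m).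
      b \<le> hamming_length m (\<phi> w) \<and> (\<forall>n \<in> E. hamming_length m (\<phi> n) < \<epsilon>)" by blast
qed

lemma hom_eq_on_free_basis:
  assumes F: "group F" and B: "free_basis F B" and G: "group G"
    and \<phi>: "\<phi> \<in> hom F G" "\<phi> \<in> extensional (carrier F)" and \<psi>: "\<psi> \<in> hom F G" "\<psi> \<in> extensional (carrier F)"
    and eq: "\<And>b. b \<in> B \<Longrightarrow> \<phi> b = \<psi> b"
  shows "\<phi> = \<psi>"
proof (rule extensionalityI[OF \<phi>(2) \<psi>(2)])
  fix g assume g: "g \<in> carrier F"
  have Bc: "B \<subseteq> carrier F" and gen: "generate F B = carrier F" using B by (simp_all add: free_basis_def)
  obtain w where w: "snd ` set w \<subseteq> B" "eval_word F w = g"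
    using group.generate_eq_eval_word[OF F Bc] g gen by blast
  have wF: "snd ` set w \<subseteq> carrier F" using w(1) Bc by blast
  have "\<phi> g = eval_word G (map (apsnd \<phi>) w)"
    using hom_eval_word[OF F G \<phi>(1) wF] w(2) by simp
  also have "map (apsnd \<phi>) w = map (apsnd \<psi>) w"
    using w(1) eq by (auto simp: apsnd_def)
  also have "eval_word G (map (apsnd \<psi>) w) = \<psi> g"
    using hom_eval_word[OF F G \<psi>(1) wF] w(2) by simp
  finally show "\<phi> g = \<psi> g" .
qed

context perm_family
begin

text \<open>A homomorphism is determined by its values on the finite basis, and each value lies in a
  finite group.\<close>

lemma finite_small_hom_index:
  assumes F: "group F" and B: "free_basis F B" "finite B"
  shows "finite {i \<in> hom_index F H. fst i \<le> k}"
proof -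
  have Bc: "B \<subseteq> carrier F" using B by (simp add: free_basis_def)
  have fin: "finite (hom F (H m) \<inter> extensional (carrier F))" for m
  proof (rule inj_on_finite)
    show "inj_on (\<lambda>\<phi>. restrict \<phi> B) (hom F (H m) \<inter> extensional (carrier F))"
    proof (rule inj_onI)
      fix \<phi> \<psi> assume \<phi>: "\<phi> \<in> hom F (H m) \<inter> extensional (carrier F)"
        and \<psi>: "\<psi> \<in> hom F (H m) \<inter> extensional (carrier F)" and eq: "restrict \<phi> B = restrict \<psi> B"
      have "\<phi> b = \<psi> b" if "b \<in> B" for b using fun_cong[OF eq, of b] that by simp
      then show "\<phi> = \<psi>" using \<phi> \<psi> by (intro hom_eq_on_free_basis[OF F B(1) H_group[of m]]) auto
    qed
    show "(\<lambda>\<phi>. restrict \<phi> B) ` (hom F (H m) \<inter> extensional (carrier F)) \<subseteq> (\<Pi>\<^sub>E b \<in> B. {p. p permutes {1..m}})"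
    proof safe
      fix \<phi> b assume "\<phi> \<in> hom F (H m)" "b \<in> B"
      then have "\<phi> b \<in> carrier (H m)" using Bc by (auto simp: hom_def)
      then show "restrict \<phi> B b permutes {1..m}" using H_permutes \<open>b \<in> B\<close> by simp
    qed simp
    show "finite (\<Pi>\<^sub>E b \<in> B. {p. p permutes {1..m}})"
      using B(2) finite_permutations[of "{1..m}"] by (intro finite_PiE) auto
  qed
  have "{i \<in> hom_index F H. fst i \<le> k} \<subseteq> (SIGMA m : {..k}. hom F (H m) \<inter> extensional (carrier F))"
    by (auto simp: hom_index_def)
  then show ?thesis by (rule finite_subset) (intro finite_SigmaI finite_atMost fin)
qed

text \<open>A doubled homomorphism has values in \<open>alt_group (2 * m)\<close>, hence in either
  family, so both products see all lengths that symmetric homomorphisms realize.\<close>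

lemma ex_hom_of_sym_hom:
  assumes F: "group F" and m: "m \<ge> 1" and \<phi>: "\<phi> \<in> hom F (sym_group m)"
  shows "\<exists>i \<in> hom_index F H. \<forall>g \<in> carrier F. hamming_length (fst i) (snd i g) = hamming_length m (\<phi> g)"
proof -
  obtain \<chi> where \<chi>: "\<chi> \<in> hom F (alt_group (2 * m))"
    "\<forall>g \<in> carrier F. hamming_length (2 * m) (\<chi> g) = hamming_length m (\<phi> g)"
    using ex_double_hom[OF F \<phi>] by blast
  have "\<chi> \<in> hom F (H (2 * m))"
    using \<chi>(1) alt_subset_H by (auto simp: hom_def H_mult alt_group_mult Pi_iff)
  then have "(2 * m, restrict \<chi> (carrier F)) \<in> hom_index F H"
    using m by (intro hom_index_hom[OF F]) auto
  then show ?thesis using \<chi>(2) by force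
qed

lemma hom_embed_inj:
  assumes F: "group F" and B: "free_basis F B" and uv: "u \<in> carrier F" "v \<in> carrier F"
    and eq: "hom_embed F H u = hom_embed F H v"
  shows "u = v"
proof (rule ccontr)
  interpret F: group F by fact
  assume "u \<noteq> v"
  let ?g = "u \<otimes>\<^bsub>F\<^esub> inv\<^bsub>F\<^esub> v"
  have g: "?g \<in> carrier F" "?g \<noteq> \<one>\<^bsub>F\<^esub>"
    using uv \<open>u \<noteq> v\<close> by (simp_all add: F.inv_solve_right')
  then obtain m \<phi> where m: "m \<ge> 1" and \<phi>: "\<phi> \<in> hom F (sym_group m)" and ne: "\<phi> ?g \<noteq> id"
    using free_basis_residually_symmetric[OF F B] by blast
  have perm: "\<phi> ?g permutes {1..m}" using sym_group_hom_facts(1)[OF F \<phi> g(1)] .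
  obtain i where i: "i \<in> hom_index F H" "hamming_length (fst i) (snd i ?g) = hamming_length m (\<phi> ?g)"
    using ex_hom_of_sym_hom[OF F m \<phi>] g(1) by blast
  note hf = sym_group_hom_facts[OF F H_hom_sym[OF hom_indexD(2)[OF i(1)]]]
  have "snd i u = snd i v" using fun_cong[OF eq, of i] hom_embed_apply[OF i(1)] by simp
  then have "snd i ?g = snd i v \<circ> inv' (snd i v)" using hf(2,3) uv by simp
  also have "\<dots> = id" using permutes_inv_o(1)[OF hf(1)[OF uv(2)]] .
  finally have "hamming_length m (\<phi> ?g) = 0" using i(2) by simp
  moreover have "finite (moved (\<phi> ?g))" using moved_subset[OF perm] finite_subset by blast
  ultimately have "moved (\<phi> ?g) = {}" using m by (simp add: hamming_length_eq[OF perm])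
  then show False using ne by (auto simp: moved_def fun_eq_iff)
qed

text \<open>The regular representation of the finite quotient \<open>F/K\<close> separates.\<close>

lemma separates_of_finite_index:
  assumes F: "group F" and K: "K \<lhd> F" "finite (rcosets\<^bsub>F\<^esub> K)" and w: "w \<in> carrier F - K"
  shows "separates F K 1 w"
proof -
  interpret F: group F by fact
  interpret K: normal K F by fact
  interpret Q: group "F Mod K" by (rule K.factorgroup_is_group)
  let ?Q = "F Mod K"
  define c where "c g = K #>\<^bsub>F\<^esub> g" for g
  have cQ: "c g \<in> carrier ?Q" if "g \<in> carrier F" for g
    using that by (auto simp: FactGroup_def RCOSETS_def c_def)
  have cm: "c (g \<otimes>\<^bsub>F\<^esub> h) = c g \<otimes>\<^bsub>?Q\<^esub> c h" if "g \<in> carrier F" "h \<in> carrier F" for g h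
    using that K.rcos_sum by (simp add: FactGroup_def c_def)
  have cK: "c g = \<one>\<^bsub>?Q\<^esub> \<longleftrightarrow> g \<in> K" if "g \<in> carrier F" for g
    using F.coset_join2[OF that K.subgroup_axioms] F.rcos_self[OF that K.subgroup_axioms]
    by (auto simp: c_def FactGroup_def)
  have finQ: "finite (carrier ?Q)" "carrier ?Q \<noteq> {}" using K(2) Q.one_closed by (auto simp: FactGroup_def)
  have c1: "c \<one>\<^bsub>F\<^esub> = \<one>\<^bsub>?Q\<^esub>" using cK[OF F.one_closed] K.one_closed by blast
  have "\<exists>\<phi> \<in> hom F (sym_group (card (carrier ?Q))). \<forall>g \<in> carrier F.
      1 - hamming_length (card (carrier ?Q)) (\<phi> g) = card {x \<in> carrier ?Q. c g \<otimes>\<^bsub>?Q\<^esub> x = x} / card (carrier ?Q)"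
  proof (rule sym_group_hom_of_action[OF F finQ])
    show "c g \<otimes>\<^bsub>?Q\<^esub> x \<in> carrier ?Q" if "g \<in> carrier F" "x \<in> carrier ?Q" for g x
      using Q.m_closed[OF cQ[OF that(1)] that(2)] .
    show "c (g \<otimes>\<^bsub>F\<^esub> h) \<otimes>\<^bsub>?Q\<^esub> x = c g \<otimes>\<^bsub>?Q\<^esub> (c h \<otimes>\<^bsub>?Q\<^esub> x)"
      if "g \<in> carrier F" "h \<in> carrier F" "x \<in> carrier ?Q" for g h x
      using Q.m_assoc[OF cQ[OF that(1)] cQ[OF that(2)] that(3)] by (simp only: cm[OF that(1,2)])
    show "c \<one>\<^bsub>F\<^esub> \<otimes>\<^bsub>?Q\<^esub> x = x" if "x \<in> carrier ?Q" for x
      using Q.l_one[OF that] by (simp only: c1)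
  qed
  then obtain \<phi> where \<phi>: "\<phi> \<in> hom F (sym_group (card (carrier ?Q)))"
    and len: "\<And>g. g \<in> carrier F \<Longrightarrow> 1 - hamming_length (card (carrier ?Q)) (\<phi> g)
      = card {x \<in> carrier ?Q. c g \<otimes>\<^bsub>?Q\<^esub> x = x} / card (carrier ?Q)" by blast
  have pos: "card (carrier ?Q) \<ge> 1"
    using finQ by (simp add: Suc_le_eq card_gt_0_iff)
  \<comment> \<open>The regular action is free: fixing one point would force
    \<open>w \<in> K\<close>.\<close>
  have "{x \<in> carrier ?Q. c w \<otimes>\<^bsub>?Q\<^esub> x = x} = {}"
    using w cK[of w] cQ[of w] Q.r_cancel_one by auto
  then have "card {x \<in> carrier ?Q. c w \<otimes>\<^bsub>?Q\<^esub> x = x} = 0" by (simp only: card.empty)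
  then have "hamming_length (card (carrier ?Q)) (\<phi> w) = 1" using len[of w] w by simp
  moreover have "hamming_length (card (carrier ?Q)) (\<phi> n) = 0" if "n \<in> K" for n
  proof -
    have n: "n \<in> carrier F" using that K.subset by blast
    then have "{x \<in> carrier ?Q. c n \<otimes>\<^bsub>?Q\<^esub> x = x} = carrier ?Q"
      using cK[OF n] that Q.l_one by force
    then show ?thesis using len[OF n] pos by simp
  qed
  ultimately show ?thesis
    unfolding separates_def using \<phi> pos by (intro allI impI exI[of _ "card (carrier ?Q)"]) (auto intro!: bexI[of _ \<phi>])
qed

text \<open>Separates \<open>w\<close> from \<open>N\<close> inside the finite quotient that records the homomorphisms to \<open>H m\<close> with
  \<open>m \<le> k\<close>: unless this succeeds, \<open>w\<close> may be changed by an element of \<open>N\<close> so as to lie in their kernels.\<close>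

lemma separates_or_small_kernel:
  assumes F: "group F" and B: "free_basis F B" "finite B" and N: "N \<lhd> F" and w: "w \<in> carrier F"
  shows "separates F N 1 w \<or> (\<exists>n \<in> N. \<forall>i \<in> hom_index F H. fst i \<le> k \<longrightarrow> snd i w = snd i n)"
proof -
  interpret F: group F by fact
  interpret N: normal N F by fact
  define J where "J = {i \<in> hom_index F H. fst i \<le> k}"
  have J: "finite J" unfolding J_def by (rule finite_small_hom_index[OF F B])
  have Jf: "g \<in> carrier F \<Longrightarrow> snd i g permutes {1..fst i}"
    "g \<in> carrier F \<Longrightarrow> h \<in> carrier F \<Longrightarrow> snd i (g \<otimes>\<^bsub>F\<^esub> h) = snd i g \<circ> snd i h"
    "g \<in> carrier F \<Longrightarrow> snd i (inv\<^bsub>F\<^esub> g) = inv' (snd i g)" "snd i \<one>\<^bsub>F\<^esub> = id" if "i \<in> J" for i g h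
    using sym_group_hom_facts[OF F H_hom_sym[OF hom_indexD(2)]] that unfolding J_def by auto
  \<comment> \<open>\<open>K\<close> is the product of \<open>N\<close> with the common kernel of
    the finitely many homomorphisms in \<open>J\<close>.\<close>
  define K where "K = {g \<in> carrier F. \<exists>n \<in> N. \<forall>i \<in> J. snd i g = snd i n}"
  have NF: "n \<in> carrier F" if "n \<in> N" for n using that N.subset by blast
  have "subgroup K F"
  proof
    show "K \<subseteq> carrier F" by (auto simp: K_def)
    show "\<one>\<^bsub>F\<^esub> \<in> K" using N.one_closed by (auto simp: K_def)
  next
    fix g h assume "g \<in> K" "h \<in> K"
    then obtain n l where gh: "g \<in> carrier F" "h \<in> carrier F" and nl: "n \<in> N" "l \<in> N"
      "\<forall>i \<in> J. snd i g = snd i n" "\<forall>i \<in> J. snd i h = snd i l" by (auto simp: K_def)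
    have "\<forall>i \<in> J. snd i (g \<otimes>\<^bsub>F\<^esub> h) = snd i (n \<otimes>\<^bsub>F\<^esub> l)" using gh nl NF Jf(2) by simp
    then show "g \<otimes>\<^bsub>F\<^esub> h \<in> K" using gh nl N.m_closed unfolding K_def by blast
  next
    fix g assume "g \<in> K"
    then obtain n where g: "g \<in> carrier F" and n: "n \<in> N" "\<forall>i \<in> J. snd i g = snd i n" by (auto simp: K_def)
    have "\<forall>i \<in> J. snd i (inv\<^bsub>F\<^esub> g) = snd i (inv\<^bsub>F\<^esub> n)" using g n NF Jf(3) by simp
    then show "inv\<^bsub>F\<^esub> g \<in> K" using g n N.m_inv_closed unfolding K_def by blast
  qed
  moreover have "x \<otimes>\<^bsub>F\<^esub> g \<otimes>\<^bsub>F\<^esub> inv\<^bsub>F\<^esub> x \<in> K" if x: "x \<in> carrier F" and "g \<in> K" for x g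
  proof -
    obtain n where g: "g \<in> carrier F" and n: "n \<in> N" "\<forall>i \<in> J. snd i g = snd i n"
      using \<open>g \<in> K\<close> by (auto simp: K_def)
    have "\<forall>i \<in> J. snd i (x \<otimes>\<^bsub>F\<^esub> g \<otimes>\<^bsub>F\<^esub> inv\<^bsub>F\<^esub> x) = snd i (x \<otimes>\<^bsub>F\<^esub> n \<otimes>\<^bsub>F\<^esub> inv\<^bsub>F\<^esub> x)"
      using x g n NF Jf(2) by simp
    then show ?thesis using x g N.inv_op_closed2[OF x n(1)] unfolding K_def by blast
  qed
  ultimately have KN: "K \<lhd> F" by (simp add: F.normal_inv_iff)
  have NK: "N \<subseteq> K" using NF by (auto simp: K_def)
  \<comment> \<open>The tuple of values takes finitely many values and determines the coset of
    \<open>K\<close>, so \<open>K\<close> has finite index.\<close>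
  define s where "s g = (\<lambda>i \<in> J. snd i g)" for g
  have "finite (s ` carrier F)"
  proof (rule finite_subset)
    show "s ` carrier F \<subseteq> (\<Pi>\<^sub>E i \<in> J. {p. p permutes {1..fst i}})"
      using Jf(1) by (auto simp: s_def simp del: atLeastAtMost_iff)
    show "finite (\<Pi>\<^sub>E i \<in> J. {p. p permutes {1..fst i}})"
      by (intro finite_PiE J finite_permutations finite_atLeastAtMost)
  qed
  moreover have coset_eq: "K #>\<^bsub>F\<^esub> g = K #>\<^bsub>F\<^esub> h" if gh: "g \<in> carrier F" "h \<in> carrier F" and s: "s g = s h" for g h
  proof -
    have "snd i (g \<otimes>\<^bsub>F\<^esub> inv\<^bsub>F\<^esub> h) = snd i \<one>\<^bsub>F\<^esub>" if i: "i \<in> J" for i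
    proof -
      have "snd i g = snd i h" using fun_cong[OF s, of i] i by (simp add: s_def)
      then show ?thesis using Jf(2,3,4)[OF i] gh permutes_inv_o(1)[OF Jf(1)[OF i gh(2)]] by simp
    qed
    then have "g \<otimes>\<^bsub>F\<^esub> inv\<^bsub>F\<^esub> h \<in> K" using gh N.one_closed unfolding K_def by blast
    then have "g \<in> K #>\<^bsub>F\<^esub> h"
      using gh by (auto simp: r_coset_def F.m_assoc intro!: bexI[of _ "g \<otimes>\<^bsub>F\<^esub> inv\<^bsub>F\<^esub> h"])
    then show ?thesis
      using F.repr_independence[OF _ gh(2) normal_imp_subgroup[OF KN]] by simp
  qed
  have "rcosets\<^bsub>F\<^esub> K \<subseteq> (\<lambda>t. K #>\<^bsub>F\<^esub> (inv_into (carrier F) s t)) ` s ` carrier F"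
  proof
    fix C assume "C \<in> rcosets\<^bsub>F\<^esub> K"
    then obtain g where g: "g \<in> carrier F" "C = K #>\<^bsub>F\<^esub> g" by (auto simp: RCOSETS_def)
    have "K #>\<^bsub>F\<^esub> g = K #>\<^bsub>F\<^esub> inv_into (carrier F) s (s g)"
      using g by (intro coset_eq) (auto simp: inv_into_into f_inv_into_f)
    then show "C \<in> (\<lambda>t. K #>\<^bsub>F\<^esub> (inv_into (carrier F) s t)) ` s ` carrier F" using g by blast
  qed
  ultimately have fin: "finite (rcosets\<^bsub>F\<^esub> K)" by (meson finite_imageI finite_subset)
  show ?thesis
  proof (cases "w \<in> K")
    case True
    then show ?thesis unfolding K_def J_def by blast
  next
    case False
    then have "separates F K 1 w" using separates_of_finite_index[OF F KN fin] w by blast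
    then have "separates F N 1 w" by (rule separates_mono) (use NK in auto)
    then show ?thesis ..
  qed
qed

text \<open>For symmetric groups, the sign of a homomorphism factors through \<open>S\<^sub>2\<close>.\<close>

lemma evenperm_if_small_kernel:
  assumes F: "group F" and w: "w \<in> carrier F"
    and small: "\<And>i. i \<in> hom_index F H \<Longrightarrow> fst i \<le> 2 \<Longrightarrow> snd i w = id"
    and \<phi>: "\<phi> \<in> hom F (H m)"
  shows "evenperm (\<phi> w)"
proof (cases "H = alt_group")
  case True
  then show ?thesis using \<phi> w by (auto simp: hom_def Pi_iff alt_group_carrier)
next
  case False
  then have H: "H = sym_group" using H_cases by blast
  note \<phi>f = sym_group_hom_facts[OF F H_hom_sym[OF \<phi>]]
  interpret F: group F by fact
  define \<chi> where "\<chi> g = (if evenperm (\<phi> g) then id else transpose 1 2 :: nat \<Rightarrow> nat)" for g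
  have "\<chi> \<in> hom F (H 2)"
  proof (rule homI)
    show "\<chi> g \<in> carrier (H 2)" for g
      by (auto simp: \<chi>_def H sym_group_carrier permutes_id intro!: permutes_swap_id)
    fix g h assume gh: "g \<in> carrier F" "h \<in> carrier F"
    have "permutation (\<phi> g)" "permutation (\<phi> h)"
      using \<phi>f(1) gh permutes_imp_permutation by blast+
    then show "\<chi> (g \<otimes>\<^bsub>F\<^esub> h) = \<chi> g \<otimes>\<^bsub>H 2\<^esub> \<chi> h"
      using \<phi>f(2)[OF gh] by (simp add: \<chi>_def H_mult evenperm_comp)
  qed
  then have "(2, restrict \<chi> (carrier F)) \<in> hom_index F H" by (intro hom_index_hom[OF F]) simp_all
  then have "\<chi> w = id" using small w by fastforce
  moreover have "transpose 1 2 \<noteq> (id :: nat \<Rightarrow> nat)" by (simp add: transpose_eq_id_iff)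
  ultimately show ?thesis by (auto simp: \<chi>_def split: if_splits)
qed

text \<open>The argument is run for \<open>v\<close>, which is \<open>w\<close> corrected by
  \<open>n0 \<in> N\<close> so as to be killed in all degrees up to 4. Amplification gives
  \<open>v\<close> length at least 1/2; returning to \<open>w\<close> loses less than 1/4, the
  length of the image of \<open>n0\<close>.\<close>

theorem separates_if_closed:
  assumes F: "group F" and B: "free_basis F B" "finite B" and N: "N \<lhd> F"
    and closed: "normal_closure (hom_product F H) (hom_embed F H ` N) \<inter> hom_embed F H ` carrier F
      \<subseteq> hom_embed F H ` N"
    and w: "w \<in> carrier F - N"
  shows "separates F N (1/4) w"
proof (cases "separates F N 1 w")
  case True
  then show ?thesis by (rule separates_mono) auto
next
  case False
  interpret F: group F by fact
  interpret N: normal N F by fact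
  obtain n0 where n0: "n0 \<in> N" "\<forall>i \<in> hom_index F H. fst i \<le> 4 \<longrightarrow> snd i w = snd i n0"
    using separates_or_small_kernel[OF F B N, of w 4] w False by blast
  have n0F: "n0 \<in> carrier F" and wF: "w \<in> carrier F" using n0(1) N.subset w by blast+
  define v where "v = w \<otimes>\<^bsub>F\<^esub> inv\<^bsub>F\<^esub> n0"
  have vF: "v \<in> carrier F" using wF n0F by (simp add: v_def)
  have vN: "v \<notin> N"
  proof
    assume "v \<in> N"
    then have "v \<otimes>\<^bsub>F\<^esub> n0 \<in> N" using n0(1) by (rule N.m_closed)
    then show False using w wF n0F by (simp add: v_def F.m_assoc)
  qed
  have v_eq: "\<phi> v = \<phi> w \<circ> inv' (\<phi> n0)" if "\<phi> \<in> hom F (sym_group m)" for m \<phi>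
    using sym_group_hom_facts(2,3)[OF F that] wF n0F by (simp add: v_def)
  have small: "snd i v = id" if i: "i \<in> hom_index F H" "fst i \<le> 4" for i
  proof -
    have h: "snd i \<in> hom F (sym_group (fst i))" using H_hom_sym[OF hom_indexD(2)[OF i(1)]] .
    have "snd i w = snd i n0" using n0(2) i by blast
    then show ?thesis
      unfolding v_eq[OF h] using permutes_inv_o(1)[OF sym_group_hom_facts(1)[OF F h n0F]] by simp
  qed
  have small': "\<phi> v = id" if "1 \<le> m" "m \<le> 4" "\<phi> \<in> hom F (H m)" for m \<phi>
    using small[OF hom_index_hom[OF F that(1,3)]] that(2) vF by simp
  have even: "evenperm (\<phi> v)" if "\<phi> \<in> hom F (H m)" for m \<phi>
    by (rule evenperm_if_small_kernel[OF F vF _ that]) (use small in auto)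
  show ?thesis
    unfolding separates_def
  proof (intro allI impI)
    fix E and \<epsilon> :: real assume "finite E \<and> E \<subseteq> N \<and> \<epsilon> > 0"
    then have E: "finite E" "E \<subseteq> N" and \<epsilon>: "\<epsilon> > 0" by auto
    \<comment> \<open>Including \<open>n0\<close> keeps its image short, as needed for the return
      from \<open>v\<close> to \<open>w\<close>, and makes the set nonempty for the
      amplification.\<close>
    let ?E = "insert n0 E"
    define \<delta> where "\<delta> = min \<epsilon> (1/4)"
    have \<delta>: "\<delta> > 0" using \<epsilon> by (simp add: \<delta>_def)
    obtain k :: nat where k: "2 / \<delta> < real k" using reals_Archimedean2 by blast
    have "0 < 2 / \<delta>" using \<delta> by simp
    then have k0: "real k > 0" using k by linarith
    have k\<delta>: "2 / real k < \<delta>" using k k0 \<delta> by (simp add: field_simps)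
    \<comment> \<open>If no homomorphism had these ratios, one finite set and one \<open>k\<close>
      would serve all coordinates, putting \<open>v\<close> into the normal closure and, by
      closedness and injectivity, into \<open>N\<close>.\<close>
    have "\<exists>m \<phi>. 1 \<le> m \<and> \<phi> \<in> hom F (H m) \<and> (\<forall>n \<in> ?E. real k * hamming_length m (\<phi> n) < hamming_length m (\<phi> v))"
    proof (rule ccontr)
      assume "\<not> ?thesis"
      then have ratio: "\<exists>n \<in> ?E. hamming_length m (\<phi> v) \<le> real k * hamming_length m (\<phi> n)"
        if "1 \<le> m" "\<phi> \<in> hom F (H m)" for m \<phi>
        using that by (meson linorder_not_le)
      have "hom_embed F H v \<in> normal_closure (hom_product F H) (hom_embed F H ` N)"
      proof (rule normal_closure_of_hamming_ratio[OF F vF])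
        show "finite ?E" "?E \<subseteq> N" "N \<subseteq> carrier F" using E n0(1) N.subset by auto
      qed (rule small' even ratio; assumption)+
      then have "hom_embed F H v \<in> hom_embed F H ` N" using closed vF by blast
      then obtain n where "n \<in> N" "hom_embed F H v = hom_embed F H n" by blast
      then show False using hom_embed_inj[OF F B(1) vF] N.subset vN by blast
    qed
    then obtain m \<phi> where m: "1 \<le> m" and \<phi>: "\<phi> \<in> hom F (H m)"
      and big: "\<forall>n \<in> ?E. real k * hamming_length m (\<phi> n) < hamming_length m (\<phi> v)" by blast
    have "\<exists>l \<ge> 1. \<exists>\<chi> \<in> hom F (sym_group l). hamming_length l (\<chi> v) \<ge> 1/2 \<and>
        (\<forall>n \<in> ?E. hamming_length l (\<chi> n) \<le> 2 / real k)"
      using big E(2) n0(1) N.subset by (intro ex_amplified_hom[OF F m H_hom_sym[OF \<phi>] vF k0]) auto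
    then obtain l \<chi> where l: "l \<ge> 1" and \<chi>: "\<chi> \<in> hom F (sym_group l)" "hamming_length l (\<chi> v) \<ge> 1/2"
      "\<forall>n \<in> ?E. hamming_length l (\<chi> n) \<le> 2 / real k" by blast
    have n0p: "\<chi> n0 permutes {1..l}" using sym_group_hom_facts(1)[OF F \<chi>(1) n0F] .
    have "hamming_length l (\<chi> v) \<le> hamming_length l (\<chi> w) + hamming_length l (inv' (\<chi> n0))"
      unfolding v_eq[OF \<chi>(1)] by (rule hamming_length_comp) (rule permutes_inv[OF n0p])
    also have "hamming_length l (inv' (\<chi> n0)) < 1/4"
      using \<chi>(3) k\<delta> hamming_length_inv[OF n0p] by (simp add: \<delta>_def)
    finally have "1/4 \<le> hamming_length l (\<chi> w)" using \<chi>(2) by linarith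
    moreover have "hamming_length l (\<chi> n) < \<epsilon>" if "n \<in> E" for n
    proof -
      have "hamming_length l (\<chi> n) \<le> 2 / real k" using \<chi>(3) that by blast
      also have "\<dots> < \<epsilon>" using k\<delta> by (simp add: \<delta>_def)
      finally show ?thesis .
    qed
    ultimately show "\<exists>m \<ge> 1. \<exists>\<phi> \<in> hom F (sym_group m).
        1/4 \<le> hamming_length m (\<phi> w) \<and> (\<forall>n \<in> E. hamming_length m (\<phi> n) < \<epsilon>)"
      using l \<chi>(1) by blast
  qed
qed

text \<open>Membership would bound the length of \<open>w\<close> by a fixed multiple of lengths of
  finitely many elements of \<open>N\<close>, in every coordinate. A separating homomorphism,
  doubled to appear as a coordinate, keeps the former at \<open>a\<close> and makes the latter
  arbitrarily small.\<close>

theorem closed_if_separates: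
  assumes F: "group F" and N: "N \<lhd> F" and w: "w \<in> carrier F" and sep: "separates F N a w" "a > 0"
  shows "hom_embed F H w \<notin> normal_closure (hom_product F H) (hom_embed F H ` N)"
proof
  interpret F: group F by fact
  interpret N: normal N F by fact
  assume "hom_embed F H w \<in> normal_closure (hom_product F H) (hom_embed F H ` N)"
  then obtain c :: real and E where c: "c \<ge> 0" and E: "finite E" "E \<subseteq> N"
    and bound: "\<And>i. i \<in> hom_index F H \<Longrightarrow>
      hamming_length (fst i) (hom_embed F H w i) \<le> c * (\<Sum>n \<in> E. hamming_length (fst i) (snd i n))"
    using normal_closure_hamming_bound[OF F N.subset] by metis
  define \<epsilon> where "\<epsilon> = a / (c * real (card E) + 1)"
  have den: "c * real (card E) + 1 > 0" using c by (simp add: add_nonneg_pos)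
  have \<epsilon>: "\<epsilon> > 0" using sep(2) den by (simp add: \<epsilon>_def)
  have small: "c * real (card E) * \<epsilon> < a"
  proof -
    have "(c * real (card E) + 1) * \<epsilon> = a" using den by (simp add: \<epsilon>_def)
    then show ?thesis using \<epsilon> by (simp add: distrib_right)
  qed
  obtain m \<phi> where m: "m \<ge> 1" and \<phi>: "\<phi> \<in> hom F (sym_group m)"
    and len: "a \<le> hamming_length m (\<phi> w)" "\<forall>n \<in> E. hamming_length m (\<phi> n) < \<epsilon>"
    using sep(1) E \<epsilon> unfolding separates_def by meson
  obtain i where i: "i \<in> hom_index F H"
    "\<forall>g \<in> carrier F. hamming_length (fst i) (snd i g) = hamming_length m (\<phi> g)"
    using ex_hom_of_sym_hom[OF F m \<phi>] by blast
  have "a \<le> c * (\<Sum>n \<in> E. hamming_length (fst i) (snd i n))"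
    using bound[OF i(1)] hom_embed_apply[OF i(1)] i(2) w len(1) by simp
  also have "\<dots> \<le> c * (\<Sum>n \<in> E. \<epsilon>)"
  proof (intro mult_left_mono sum_mono c)
    fix n assume n: "n \<in> E"
    then have "hamming_length (fst i) (snd i n) = hamming_length m (\<phi> n)" using i(2) E(2) N.subset by blast
    then show "hamming_length (fst i) (snd i n) \<le> \<epsilon>" using len(2) n by fastforce
  qed
  also have "\<dots> = c * real (card E) * \<epsilon>" by simp
  finally show False using small by linarith
qed

text \<open>From soficity each \<open>w\<close> outside \<open>N\<close> gets its own bound
  \<open>a\<close>, which suffices to exclude it from the closure. Conversely closedness yields the
  uniform bound 1/4 that \<open>sofic_if_separates\<close> asks for.\<close>

theorem sofic_iff_closed:
  assumes F: "group F" and B: "free_basis F B" "finite B" and N: "N \<lhd> F"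
  shows "sofic (F Mod N) \<longleftrightarrow> hom_embed F H ` N =
    normal_closure (hom_product F H) (hom_embed F H ` N) \<inter> hom_embed F H ` carrier F"
proof
  interpret N: normal N F by fact
  assume sofic: "sofic (F Mod N)"
  show "hom_embed F H ` N = normal_closure (hom_product F H) (hom_embed F H ` N) \<inter> hom_embed F H ` carrier F"
  proof (intro equalityI subsetI)
    fix f assume "f \<in> hom_embed F H ` N"
    then show "f \<in> normal_closure (hom_product F H) (hom_embed F H ` N) \<inter> hom_embed F H ` carrier F"
      using N.subset by (auto simp: normal_closure_def)
  next
    fix f assume f: "f \<in> normal_closure (hom_product F H) (hom_embed F H ` N) \<inter> hom_embed F H ` carrier F"
    then obtain w where w: "w \<in> carrier F" "f = hom_embed F H w" by blast
    have "w \<in> N"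
      using closed_if_separates[OF F N w(1)] separates_if_sofic[OF F B N sofic, of w] w f by blast
    then show "f \<in> hom_embed F H ` N" using w(2) by blast
  qed
next
  assume "hom_embed F H ` N = normal_closure (hom_product F H) (hom_embed F H ` N) \<inter> hom_embed F H ` carrier F"
  then show "sofic (F Mod N)"
    by (intro sofic_if_separates[OF F N, of "1/4"] separates_if_closed[OF F B N]) auto
qed

end

theorem mainTheorem4:
  fixes F :: "('a, 'b) monoid_scheme" and B N :: "'a set"
  assumes "group F"
    and "finite B"
    and "free_basis F B"
    and "N \<lhd> F"
  shows "(sofic (F Mod N) \<longleftrightarrow>
            hom_embed F alt_group ` N =
              normal_closure (hom_product F alt_group) (hom_embed F alt_group ` N)
              \<inter> hom_embed F alt_group ` carrier F) \<and>
         (sofic (F Mod N) \<longleftrightarrow>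
            hom_embed F sym_group ` N =
              normal_closure (hom_product F sym_group) (hom_embed F sym_group ` N)
              \<inter> hom_embed F sym_group ` carrier F)"
proof -
  interpret alt: perm_family alt_group by unfold_locales simp
  interpret sym: perm_family sym_group by unfold_locales simp
  show ?thesis
    using alt.sofic_iff_closed[OF assms(1,3,2,4)] sym.sofic_iff_closed[OF assms(1,3,2,4)] ..
qed

end
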